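(* Let $\mathcal{K} \subset \mathbb{P}^{2}_{\mathbb{C}}$ be the Klein arrangement of $21$ lines and let $\ell \in \mathcal{K}$ be any line. Then the arrangement $\mathcal{K}' :=\mathcal{K} \setminus \{\ell\}$ is minimal plus-one generated with exponents $(9,11,12)$.
   Context: Let $S=\mathbb{C}[x,y,z]$ with its standard grading. An arrangement of $d$ lines in $\mathbb{P}^2_{\mathbb{C}}$ is a set of $d$ pairwise distinct lines; it is regarded as the reduced plane curve $f=0$ of degree $d$, where $f\in S$ is the product of linear forms defining the lines. For a reduced plane curve $C:f=0$ of degree $d$, let $J_f=\langle \partial_x f,\partial_y f,\partial_z f\rangle$ be the Jacobian ideal and $M(f)=S/J_f$ the Milnor algebra. $C$ is an $m$-syzygy curve with exponents $(d_1,\ldots,d_m)$ if $M(f)$ has a minimal graded free resolution $$0 \rightarrow \bigoplus_{i=1}^{m-2}S(-e_{i}) \rightarrow \bigoplus_{i=1}^{m}S(1-d - d_{i}) \rightarrow S^{3}(1-d)\rightarrow S \rightarrow M(f) \rightarrow 0$$ with $e_1\le\cdots\le e_{m-2}$ and $1\le d_1\le\cdots\le d_m$. $C$ is plus-one generated with exponents $(d_1,d_2,d_3)$ if it is a $3$-syzygy curve with these exponents and $d_1+d_2=d$. It is minimal plus-one generated if moreover $d_3=d_2+1$. The Klein arrangement is the reflection arrangement of the complex reflection group $G_{24}$ (Shephard–Todd) acting on $\mathbb{C}^3$: let $\mathrm{PSL}(2,7)$ (the simple group of order $168$) be embedded in $\mathrm{PGL}_3(\mathbb{C})$ (the embedding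 is unique up to automorphism and conjugacy); each of its $21$ involutions fixes pointwise exactly one line of $\mathbb{P}^2_{\mathbb{C}}$, and $\mathcal{K}$ is the set of these $21$ lines. *)

theory Defs
  imports
    "HOL-Analysis.Analysis"
    "HOL-Algebra.Algebraic_Closure_Type"
    "HOL-Computational_Algebra.Squarefree"
    "HOL-Library.Poly_Mapping"
begin

section \<open>The graded ring \<open>S = \<complex>[x,y,z]\<close>\<close>

text \<open>
  A monomial is an exponent vector indexed by the three-element type \<open>3\<close>;
  the variables \<open>x, y, z\<close> are \<open>var 0, var 1, var 2\<close>.
\<close>

type_synonym monom3 = "3 \<Rightarrow>\<^sub>0 nat"
type_synonym poly3 = "monom3 \<Rightarrow>\<^sub>0 complex"

abbreviation S_ring :: "poly3 ring" where
  "S_ring \<equiv> ring_of_type_algebra"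

definition var :: "3 \<Rightarrow> poly3" where
  "var i = Poly_Mapping.single (Poly_Mapping.single i 1) 1"

definition mon_degree :: "monom3 \<Rightarrow> nat" where
  "mon_degree m = (\<Sum>i\<in>UNIV. Poly_Mapping.lookup m i)"

text \<open>The graded piece \<open>S\<^sub>k\<close>, for an integer \<open>k\<close>; it is \<open>{0}\<close> if \<open>k < 0\<close>.\<close>

definition homogeneous :: "int \<Rightarrow> poly3 \<Rightarrow> bool" where
  "homogeneous k p \<longleftrightarrow> (\<forall>m\<in>Poly_Mapping.keys p. int (mon_degree m) = k)"

text \<open>
  The partial derivative with respect to \<open>var i\<close>. The subtraction of exponent vectors
  truncates only in terms whose coefficient is 0.
\<close>

definition partial :: "3 \<Rightarrow> poly3 \<Rightarrow> poly3" where
  "partial i p = (\<Sum>m\<in>Poly_Mapping.keys p.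
     Poly_Mapping.single (m - Poly_Mapping.single i 1)
       (of_nat (Poly_Mapping.lookup m i) * Poly_Mapping.lookup p m))"

definition irrelevant_ideal :: "poly3 set" where
  "irrelevant_ideal = genideal S_ring (range var)"

definition jacobian_ideal :: "poly3 \<Rightarrow> poly3 set" where
  "jacobian_ideal f = genideal S_ring (range (\<lambda>i. partial i f))"

definition milnor_algebra :: "poly3 \<Rightarrow> poly3 set ring" where
  "milnor_algebra f = S_ring Quot jacobian_ideal f"

definition reduced_plane_curve :: "nat \<Rightarrow> poly3 \<Rightarrow> bool" where
  "reduced_plane_curve d f \<longleftrightarrow> 1 \<le> d \<and> f \<noteq> 0 \<and> homogeneous (int d) f \<and> squarefree f"


section \<open>Graded free modules and resolutions\<close>

text \<open>
  A list of integers \<open>ks\<close> stands for the graded free module \<open>\<Oplus>\<^sub>i S(ks ! i)\<close>. Its elements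
  are the vectors of polynomials supported on the indices below \<open>length ks\<close>, and the twist
  convention is \<open>S(k)\<^sub>t = S\<^bsub>k+t\<^esub>\<close>.
\<close>

definition free_module :: "int list \<Rightarrow> (nat \<Rightarrow> poly3) set" where
  "free_module ks = {v. \<forall>i\<ge>length ks. v i = 0}"

definition graded_part :: "int list \<Rightarrow> int \<Rightarrow> (nat \<Rightarrow> poly3) set" where
  "graded_part ks t = {v \<in> free_module ks. \<forall>i<length ks. homogeneous (ks ! i + t) (v i)}"

definition graded_hom ::
    "int list \<Rightarrow> int list \<Rightarrow> ((nat \<Rightarrow> poly3) \<Rightarrow> (nat \<Rightarrow> poly3)) \<Rightarrow> bool" where
  "graded_hom ks ls \<phi> \<longleftrightarrow>
     \<phi> \<in> free_module ks \<rightarrow> free_module ls \<and>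
     (\<forall>v\<in>free_module ks. \<forall>w\<in>free_module ks. \<phi> (\<lambda>i. v i + w i) = (\<lambda>i. \<phi> v i + \<phi> w i)) \<and>
     (\<forall>p. \<forall>v\<in>free_module ks. \<phi> (\<lambda>i. p * v i) = (\<lambda>i. p * \<phi> v i)) \<and>
     (\<forall>t. \<phi> ` graded_part ks t \<subseteq> graded_part ls t)"

definition module_kernel :: "int list \<Rightarrow> ((nat \<Rightarrow> poly3) \<Rightarrow> (nat \<Rightarrow> poly3)) \<Rightarrow> (nat \<Rightarrow> poly3) set"
  where "module_kernel ks \<phi> = {v \<in> free_module ks. \<phi> v = (\<lambda>_. 0)}"

text \<open>
  The image of \<open>\<phi>\<close> lies in \<open>\<mm> F\<close>, where \<open>F\<close> is the target of \<open>\<phi>\<close> and \<open>\<mm>\<close> the irrelevant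
  ideal; for a free module, \<open>\<mm> F\<close> consists of the vectors with all coordinates in \<open>\<mm>\<close>.
\<close>

definition minimal_map :: "int list \<Rightarrow> ((nat \<Rightarrow> poly3) \<Rightarrow> (nat \<Rightarrow> poly3)) \<Rightarrow> bool" where
  "minimal_map ks \<phi> \<longleftrightarrow> (\<forall>v\<in>free_module ks. \<forall>i. \<phi> v i \<in> irrelevant_ideal)"

text \<open>The canonical projection \<open>S \<rightarrow> M(f)\<close>, on \<open>S\<close> seen as the free module \<open>[0]\<close>.\<close>

definition milnor_projection :: "poly3 \<Rightarrow> (nat \<Rightarrow> poly3) \<Rightarrow> poly3 set" where
  "milnor_projection f v = jacobian_ideal f +>\<^bsub>S_ring\<^esub> v 0"

text \<open>
  \<open>0 \<rightarrow> F3 \<rightarrow> F2 \<rightarrow> F1 \<rightarrow> S \<rightarrow> M(f) \<rightarrow> 0\<close> is a minimal graded free resolution for suitable maps.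
\<close>

definition has_minimal_graded_free_resolution ::
    "poly3 \<Rightarrow> int list \<Rightarrow> int list \<Rightarrow> int list \<Rightarrow> bool" where
  "has_minimal_graded_free_resolution f F3 F2 F1 \<longleftrightarrow>
     (\<exists>\<phi>3 \<phi>2 \<phi>1.
        graded_hom F3 F2 \<phi>3 \<and> graded_hom F2 F1 \<phi>2 \<and> graded_hom F1 [0] \<phi>1 \<and>
        module_kernel F3 \<phi>3 = {\<lambda>_. 0} \<and>
        \<phi>3 ` free_module F3 = module_kernel F2 \<phi>2 \<and>
        \<phi>2 ` free_module F2 = module_kernel F1 \<phi>1 \<and>
        \<phi>1 ` free_module F1 =
          {v \<in> free_module [0]. milnor_projection f v = \<zero>\<^bsub>milnor_algebra f\<^esub>} \<and>
        milnor_projection f ` free_module [0] = carrier (milnor_algebra f) \<and>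
        minimal_map F3 \<phi>3 \<and> minimal_map F2 \<phi>2 \<and> minimal_map F1 \<phi>1)"

text \<open>\<open>f = 0\<close> is an \<open>m\<close>-syzygy curve of degree \<open>d\<close> with exponents \<open>ds\<close>, where \<open>m = length ds\<close>.\<close>

definition syzygy_curve :: "nat \<Rightarrow> poly3 \<Rightarrow> nat list \<Rightarrow> bool" where
  "syzygy_curve d f ds \<longleftrightarrow>
     reduced_plane_curve d f \<and> sorted ds \<and> (\<forall>a\<in>set ds. 1 \<le> a) \<and>
     (\<exists>es :: int list. length es + 2 = length ds \<and> sorted es \<and>
        has_minimal_graded_free_resolution f
          (map (\<lambda>e. - e) es)
          (map (\<lambda>a. 1 - int d - int a) ds)
          (replicate 3 (1 - int d)))"

definition plus_one_generated :: "nat \<Rightarrow> poly3 \<Rightarrow> nat \<Rightarrow> nat \<Rightarrow> nat \<Rightarrow> bool" where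
  "plus_one_generated d f d1 d2 d3 \<longleftrightarrow> syzygy_curve d f [d1, d2, d3] \<and> d1 + d2 = d"

definition minimal_plus_one_generated :: "nat \<Rightarrow> poly3 \<Rightarrow> nat \<Rightarrow> nat \<Rightarrow> nat \<Rightarrow> bool" where
  "minimal_plus_one_generated d f d1 d2 d3 \<longleftrightarrow>
     plus_one_generated d f d1 d2 d3 \<and> d3 = d2 + 1"


section \<open>The projective plane and line arrangements\<close>

text \<open>
  A point of the projective plane is a one-dimensional subspace of \<open>\<complex>\<^sup>3\<close>, and a line is a set
  of points.
\<close>

type_synonym point = "(complex ^ 3) set"

definition proj_point :: "complex ^ 3 \<Rightarrow> point" where
  "proj_point v = range (\<lambda>c. c *s v)"

definition proj_line :: "complex ^ 3 \<Rightarrow> point set" where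
  "proj_line a = {proj_point v | v. v \<noteq> 0 \<and> (\<Sum>i\<in>UNIV. a $ i * v $ i) = 0}"

definition proj_lines :: "point set set" where
  "proj_lines = {proj_line a | a. a \<noteq> 0}"

definition linear_form :: "complex ^ 3 \<Rightarrow> poly3" where
  "linear_form a = (\<Sum>i\<in>UNIV. Poly_Mapping.single 0 (a $ i) * var i)"

definition line_arrangement :: "point set set \<Rightarrow> bool" where
  "line_arrangement A \<longleftrightarrow> finite A \<and> A \<subseteq> proj_lines"

text \<open>
  \<open>f\<close> is a product of linear forms defining the lines of \<open>A\<close>; such an \<open>f\<close> is unique up to a
  nonzero constant.
\<close>

definition arrangement_equation :: "point set set \<Rightarrow> poly3 \<Rightarrow> bool" where
  "arrangement_equation A f \<longleftrightarrow>
     (\<exists>a. (\<forall>L\<in>A. a L \<noteq> 0 \<and> proj_line (a L) = L) \<and> f = (\<Prod>L\<in>A. linear_form (a L)))"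

definition minimal_plus_one_generated_arrangement ::
    "point set set \<Rightarrow> nat \<Rightarrow> nat \<Rightarrow> nat \<Rightarrow> bool" where
  "minimal_plus_one_generated_arrangement A d1 d2 d3 \<longleftrightarrow>
     line_arrangement A \<and>
     (\<forall>f. arrangement_equation A f \<longrightarrow> minimal_plus_one_generated (card A) f d1 d2 d3)"


section \<open>The Klein arrangement\<close>

definition SL27 :: "(7 ^ 2 ^ 2) monoid" where
  "SL27 = \<lparr>carrier = {A. det A = 1}, monoid.mult = (**), one = mat 1\<rparr>"

definition PSL27 :: "(7 ^ 2 ^ 2) set monoid" where
  "PSL27 = SL27 Mod {mat 1, - mat 1}"

definition GL3 :: "(complex ^ 3 ^ 3) monoid" where
  "GL3 = \<lparr>carrier = {A. invertible A}, monoid.mult = (**), one = mat 1\<rparr>"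

definition PGL3 :: "(complex ^ 3 ^ 3) set monoid" where
  "PGL3 = GL3 Mod {mat c | c. c \<noteq> 0}"

text \<open>An element of \<open>PGL3\<close> is a class of matrices, all of which act on points in the same way.\<close>

definition fixes_point :: "(complex ^ 3 ^ 3) set \<Rightarrow> point \<Rightarrow> bool" where
  "fixes_point T P \<longleftrightarrow> (\<forall>A\<in>T. (*v) A ` P = P)"

definition involutions :: "('a, 'b) monoid_scheme \<Rightarrow> 'a set" where
  "involutions G = {g \<in> carrier G. g \<noteq> \<one>\<^bsub>G\<^esub> \<and> g \<otimes>\<^bsub>G\<^esub> g = \<one>\<^bsub>G\<^esub>}"

definition klein_arrangement :: "point set set \<Rightarrow> bool" where
  "klein_arrangement K \<longleftrightarrow>
     (\<exists>\<rho>. \<rho> \<in> hom PSL27 PGL3 \<and> inj_on \<rho> (carrier PSL27) \<and>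
        K = {L \<in> proj_lines. \<exists>g\<in>involutions PSL27. \<forall>P\<in>L. fixes_point (\<rho> g) P})"

end

theory Submission
  imports Defs
begin

text \<open>
  With suitable coordinates the Klein arrangement is the orbit of \<open>x\<close>, \<open>x + y\<close> and \<open>w x + y + z\<close>
  under signed permutations, where \<open>w\<^sup>2 = w - 2\<close>, and \<open>\<ell>\<close> is \<open>x = 0\<close>. In the squares of the
  coordinates everything is small: two tangent vector fields \<open>\<theta>\<^sub>9\<close>, \<open>\<theta>\<^sub>1\<^sub>1\<close> have the form
  \<open>t \<mapsto> t N(t\<^sup>2)\<close> with \<open>N\<close> a quadratic polynomial whose coefficients are symmetric functions of
  \<open>x\<^sup>2, y\<^sup>2, z\<^sup>2\<close>, and by Saito's criterion they form, with the Euler field, a basis of the fields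
  tangent to \<open>\<K>\<close>. If \<open>\<theta>\<close> is tangent to \<open>\<K>'\<close>, then \<open>x \<theta>\<close> is tangent to \<open>\<K>\<close>; reducing its
  expansion modulo \<open>x\<close> shows that one further field, of degree 12, generates everything, with a
  single relation \<open>x \<phi> = R \<theta>\<^sub>9 - (y\<^sup>2 + z\<^sup>2) \<theta>\<^sub>1\<^sub>1\<close> modulo the Euler field. Subtracting multiples
  of the Euler field turns the generators into syzygies of the partial derivatives.

  The coordinates come from the group. An involution of \<open>PGL\<^sub>3\<close> is \<open>2 v a\<^sup>T - 1\<close> with \<open>a v = 1\<close>, and it
  fixes the line \<open>a = 0\<close>; three commuting involutions give a basis, two involutions that permute
  them fix its scaling, and one involution outside the resulting group \<open>S\<^sub>4\<close> yields \<open>w\<close>. All 21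
  involutions are conjugates of these.
\<close>

text \<open>Why the degrees are 4, 2 and 12: the other 20 lines meet \<open>x = 0\<close> in 8
  points, namely the quadruple points \<open>y\<close>, \<open>z\<close>, \<open>y + z\<close>,
  \<open>y - z\<close> and four triple points, the zeros of \<open>quad_factor\<close>. On
  \<open>x = 0\<close> the determinant of a tangent field with the Euler field is divisible by the
  product of these points. For the fields of degree 9 and 11 the cofactors are, up to sign,
  \<open>y^2 + z^2\<close> and \<open>quad_mult\<close>, of degrees 2 and 4. They are coprime, so
  the relation on \<open>x = 0\<close> has degree 4 + 9 = 2 + 11 = 13, and division by
  \<open>x\<close> gives a field of degree 12 = 20 - 8.

  The arrangement is given by an arbitrary embedding, so the coordinates are arbitrary independent
  linear forms. The algebra is therefore done in any domain with suitable elements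
  \<open>w, x, y, z\<close>, where identities are settled by Groebner bases, and specialised
  afterwards.

  The Euler multiples that turn fields into syzygies would be unwieldy. They are never computed: the
  Euler field multiplies \<open>F\<close> by 20, so it cannot enter a relation between fields that
  kill \<open>F\<close>.\<close>

unbundle no Formal_Power_Series.fps_syntax

section \<open>Vector fields tangent to the Klein arrangement\<close>

fun form :: "'a \<times> 'a \<times> 'a \<Rightarrow> 'a \<Rightarrow> 'a \<Rightarrow> 'a \<Rightarrow> 'a::comm_ring_1" where
  "form (a, b, c) p q r = a * p + b * q + c * r"

text \<open>The lines other than \<open>(1,0,0)\<close>, which is the one to be deleted.\<close>

definition klein_roots :: "'a::comm_ring_1 \<Rightarrow> ('a \<times> 'a \<times> 'a) list" where
  "klein_roots w = [(0,1,0), (0,0,1),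
     (1,1,0), (1,-1,0), (1,0,1), (1,0,-1), (0,1,1), (0,1,-1),
     (w,1,1), (w,-1,-1), (w,-1,1), (w,1,-1),
     (1,w,1), (-1,w,-1), (-1,w,1), (1,w,-1),
     (1,1,w), (-1,-1,w), (-1,1,w), (1,-1,w)]"

text \<open>
  Modulo the Euler field, an equivariant field is determined by two symmetric polynomials in the
  squares \<open>a, b, c\<close> of the coordinates. The coefficients below solve the linear system that
  expresses tangency to \<open>w x + y + z\<close>.
\<close>

definition lin9 :: "'a::comm_ring_1 \<Rightarrow> 'a \<Rightarrow> 'a \<Rightarrow> 'a \<Rightarrow> 'a" where
  "lin9 w a b c = (3*w - 12) * (a+b+c)^3 + (13 + 13*w) * (a+b+c) * (a*b+a*c+b*c) + (5 - 31*w) * (a*b*c)"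

definition quad9 :: "'a::comm_ring_1 \<Rightarrow> 'a \<Rightarrow> 'a \<Rightarrow> 'a \<Rightarrow> 'a" where
  "quad9 w a b c = (14 - 4*w) * (a+b+c)^2 - (14 + 14*w) * (a*b+a*c+b*c)"

definition lin11 :: "'a::comm_ring_1 \<Rightarrow> 'a \<Rightarrow> 'a \<Rightarrow> 'a \<Rightarrow> 'a" where
  "lin11 w a b c = (4 + 48*w) * (a+b+c)^2 * (a*b+a*c+b*c) + (2 - 6*w) * (a*b+a*c+b*c)^2 - (28 + 21*w) * (a+b+c)^4"

definition quad11 :: "'a::comm_ring_1 \<Rightarrow> 'a \<Rightarrow> 'a \<Rightarrow> 'a \<Rightarrow> 'a" where
  "quad11 w a b c = (30 + 24*w) * (a+b+c)^3 + (9 - 51*w) * (a+b+c) * (a*b+a*c+b*c) + (57 + 5*w) * (a*b*c)"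

definition radial9 :: "'a::comm_ring_1 \<Rightarrow> 'a \<Rightarrow> 'a \<Rightarrow> 'a \<Rightarrow> 'a \<Rightarrow> 'a" where
  "radial9 w a b c t = lin9 w a b c * t + quad9 w a b c * t^2"

definition radial11 :: "'a::comm_ring_1 \<Rightarrow> 'a \<Rightarrow> 'a \<Rightarrow> 'a \<Rightarrow> 'a \<Rightarrow> 'a" where
  "radial11 w a b c t = lin11 w a b c * t + quad11 w a b c * t^2"

text \<open>For \<open>w*w = w - 2\<close> this is \<open>- (w*w*b - c) * (b - w*w*c)\<close>. At
  \<open>b = y^2\<close>, \<open>c = z^2\<close> it is, up to sign, the product of
  \<open>w*y + z\<close>, \<open>w*y - z\<close>, \<open>y + w*z\<close> and \<open>y - w*z\<close>,
  the four triple points on \<open>x = 0\<close>.\<close>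

definition quad_factor :: "'a::comm_ring_1 \<Rightarrow> 'a \<Rightarrow> 'a \<Rightarrow> 'a" where
  "quad_factor w b c = (2 - w) * (b^2 + c^2) + (3 - 3*w) * (b*c)"

definition quad_mult :: "'a::comm_ring_1 \<Rightarrow> 'a \<Rightarrow> 'a \<Rightarrow> 'a" where
  "quad_mult w b c = (2*w - 1) * (b^2 + c^2) + 6*w * (b*c)"

definition quart12 :: "'a::comm_ring_1 \<Rightarrow> 'a \<Rightarrow> 'a \<Rightarrow> 'a \<Rightarrow> 'a" where
  "quart12 w a b c = (28 + 21*w) * a^3 * (b + c) + (78 - 9*w) * a^2 * (b^2 + c^2) + (120 - 30*w) * a^2*b*c
     + (15*w - 4) * a * (b^3 + c^3) + (51*w - 106) * a*b*c * (b + c)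
     + (18 - 3*w) * (b^4 + c^4) + (30 - 50*w) * b*c * (b^2 + c^2) + (132 - 130*w) * b^2*c^2"

text \<open>Each factor on the right is Heron's quartic in three coordinates, one of them multiplied
  by \<open>w\<close>, with the squares as variables. It splits into four linear forms, so this
  determinant accounts for the 12 lines that involve \<open>w\<close>.\<close>

lemma radial_det:
  fixes w :: "'a::idom" assumes "w*w = w - 2"
  shows "lin9 w a b c * quad11 w a b c - quad9 w a b c * lin11 w a b c = (7+7*w) *
    ((((w*w*a)^2+b^2+c^2-2*(w*w*a)*b-2*(w*w*a)*c-2*b*c)
    * (a^2+(w*w*b)^2+c^2-2*a*(w*w*b)-2*a*c-2*(w*w*b)*c))
    * (a^2+b^2+(w*w*c)^2-2*a*b-2*a*(w*w*c)-2*b*(w*w*c)))"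
  using assms unfolding lin9_def quad9_def lin11_def quad11_def by Groebner_Basis.algebra

text \<open>For \<open>N(t) = lin*t + quad*t^2\<close>, the sum \<open>lin + quad*(b+c)\<close> is
  the divided difference of \<open>N\<close> at \<open>b\<close> and \<open>c\<close>. It measures
  how far the field is from a multiple of the Euler field on \<open>x = 0\<close>. Modulo
  \<open>a\<close>, the divided differences of both fields contain
  \<open>quad_factor\<close>.\<close>

lemma lin9_mod:
  fixes w :: "'a::idom"
  shows "lin9 w a b c + quad9 w a b c * (b+c) = (b+c) * quad_factor w b c
    + a * ((3*w-12)*a^2 + (18*w-9)*a*(b+c) - 9*(b^2+c^2) - 18*w*b*c)"
  unfolding lin9_def quad9_def quad_factor_def by Groebner_Basis.algebra

lemma lin11_mod:
  fixes w :: "'a::idom" assumes "w*w = w - 2"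
  shows "lin11 w a b c + quad11 w a b c * (b+c) = quad_factor w b c * quad_mult w b c
    + a * ((51-7*w)*(b^2*c+b*c^2) - (28+21*w)*a^3 - (78+12*w)*a^2*(b+c) - (59+15*w)*a*(b^2+c^2)
      + (18*w-114)*a*b*c - (9+15*w)*(b^3+c^3))"
  using assms unfolding lin11_def quad11_def quad_factor_def quad_mult_def by Groebner_Basis.algebra

text \<open>Modulo \<open>a\<close> the two divided differences are \<open>b + c\<close> and
  \<open>quad_mult\<close> times the same factor, so cross-multiplying cancels them;
  \<open>quart12\<close> is the quotient by \<open>a\<close>.\<close>

lemma quart12:
  fixes w :: "'a::idom" assumes "w*w = w - 2"
  shows "quad_mult w b c * (lin9 w a b c + quad9 w a b c * (b+c)) - (b+c) * (lin11 w a b c + quad11 w a b c * (b+c))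
    = a * quart12 w a b c"
  using assms unfolding lin9_def quad9_def lin11_def quad11_def quad_mult_def quart12_def by Groebner_Basis.algebra

lemma radial9_tangent:
  fixes w :: "'a::idom" assumes "w*w = w - 2" "w*x + y + z = 0"
  shows "w * (x * radial9 w (x^2) (y^2) (z^2) (x^2)) + y * radial9 w (x^2) (y^2) (z^2) (y^2) + z * radial9 w (x^2) (y^2) (z^2) (z^2) = 0"
  using assms unfolding radial9_def lin9_def quad9_def by Groebner_Basis.algebra

lemma radial11_tangent:
  fixes w :: "'a::idom" assumes "w*w = w - 2" "w*x + y + z = 0"
  shows "w * (x * radial11 w (x^2) (y^2) (z^2) (x^2)) + y * radial11 w (x^2) (y^2) (z^2) (y^2) + z * radial11 w (x^2) (y^2) (z^2) (z^2) = 0"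
  using assms unfolding radial11_def lin11_def quad11_def by Groebner_Basis.algebra

lemma radial9_sym:
  "radial9 w b a c t = radial9 w a b c t" "radial9 w c b a t = radial9 w a b c t"
  unfolding radial9_def lin9_def quad9_def by (simp_all add: ac_simps)

lemma radial11_sym:
  "radial11 w b a c t = radial11 w a b c t" "radial11 w c b a t = radial11 w a b c t"
  unfolding radial11_def lin11_def quad11_def by (simp_all add: ac_simps)

abbreviation all_roots :: "'a::comm_ring_1 \<Rightarrow> ('a \<times> 'a \<times> 'a) list" where
  "all_roots w \<equiv> (1,0,0) # klein_roots w"

text \<open>Replacing the signs by elements with \<open>s * s = 1\<close> folds the 21 roots into
  nine patterns.\<close>

lemma klein_roots_cases [consumes 1]:
  fixes w :: "'a::idom"
  assumes "c \<in> set (all_roots w)"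
    and "P (1,0,0)" "P (0,1,0)" "P (0,0,1)"
    and "\<And>s. s * s = 1 \<Longrightarrow> P (1,s,0)" "\<And>s. s * s = 1 \<Longrightarrow> P (1,0,s)" "\<And>s. s * s = 1 \<Longrightarrow> P (0,1,s)"
    and "\<And>s r. s * s = 1 \<Longrightarrow> r * r = 1 \<Longrightarrow> P (w,s,r)"
    and "\<And>s r. s * s = 1 \<Longrightarrow> r * r = 1 \<Longrightarrow> P (s,w,r)"
    and "\<And>s r. s * s = 1 \<Longrightarrow> r * r = 1 \<Longrightarrow> P (s,r,w)"
  shows "P c"
proof -
  have "\<forall>c\<in>set (all_roots w). P c"
    by (simp add: klein_roots_def assms(2-))
  then show ?thesis using assms(1) by blast
qed

text \<open>The field is equivariant under signed permutations because \<open>N\<close> sees only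
  squares and is symmetric in them. This alone gives tangency to the mirrors of the signed
  permutations, and it moves every other root to \<open>(w,1,1)\<close>, the only one that needs a
  computation.\<close>

lemma tangent_roots:
  fixes w x y z :: "'a::idom"
  assumes sym: "\<And>a b c t. N b a c t = N a b c t" "\<And>a b c t. N c b a t = N a b c t"
    and tangent: "\<And>x y z. w*x + y + z = 0 \<Longrightarrow>
      w * (x * N (x^2) (y^2) (z^2) (x^2)) + y * N (x^2) (y^2) (z^2) (y^2) + z * N (x^2) (y^2) (z^2) (z^2) = 0"
    and c: "c \<in> set (all_roots w)" and zero: "form c x y z = 0"
  shows "form c (x * N (x^2) (y^2) (z^2) (x^2)) (y * N (x^2) (y^2) (z^2) (y^2)) (z * N (x^2) (y^2) (z^2) (z^2)) = 0"
proof -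
  have sq: "(s * p)^2 = p^2" if "s * s = 1" for s p :: 'a
    using that by (simp add: power_mult_distrib power2_eq_square)
  have opp: "p * N (x^2) (y^2) (z^2) (p^2) + s * (q * N (x^2) (y^2) (z^2) (q^2)) = 0"
    if "p + s * q = 0" "s * s = 1" for p q s :: 'a
  proof -
    from that(1) have p: "p = - (s * q)" by (simp add: add_eq_0_iff2)
    show ?thesis unfolding p power2_minus sq[OF that(2)] by (simp add: mult.assoc)
  qed
  have tangent': "w * (x * N (x^2) (y^2) (z^2) (x^2)) + s * (y * N (x^2) (y^2) (z^2) (y^2)) + r * (z * N (x^2) (y^2) (z^2) (z^2)) = 0"
    if "w * x + s * y + r * z = 0" "s * s = 1" "r * r = 1" for x y z r s
    using tangent[OF that(1)] unfolding sq[OF that(2)] sq[OF that(3)] mult.assoc .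
  from c show ?thesis using zero
  proof (induct c rule: klein_roots_cases)
    case (4 s)
    then have "x + s * y = 0" by simp
    from opp[OF this 4(1)] show ?case by simp
  next
    case (5 s)
    then have "x + s * z = 0" by simp
    from opp[OF this 5(1)] show ?case by simp
  next
    case (6 s)
    then have "y + s * z = 0" by simp
    from opp[OF this 6(1)] show ?case by simp
  next
    case (7 s r)
    then have "w * x + s * y + r * z = 0" by simp
    from tangent'[OF this 7(1,2)] show ?case by simp
  next
    case (8 s r)
    then have "w * y + s * x + r * z = 0" by (simp add: add_ac)
    from tangent'[OF this 8(1,2)] show ?case by (simp add: sym(1)[of "x^2" "y^2"] add_ac)
  next
    case (9 s r)
    then have "w * z + r * y + s * x = 0" by (simp add: add_ac)
    from tangent'[OF this 9(2,1)] show ?case by (simp add: sym(2)[of "x^2" _ "z^2"] add_ac)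
  qed simp_all
qed

text \<open>An endomorphism with kernel \<open>(a)\<close> replaces the quotient map by
  \<open>a\<close>. Its values lie in a domain, so \<open>a\<close> is prime if it is nonzero, and
  restricted polynomials stay in the same ring and can be lifted without change.\<close>

locale ring_substitution =
  fixes \<sigma> :: "'a::idom \<Rightarrow> 'a" and a :: 'a
  assumes add [simp]: "\<sigma> (p + q) = \<sigma> p + \<sigma> q"
    and mult [simp]: "\<sigma> (p * q) = \<sigma> p * \<sigma> q"
    and one [simp]: "\<sigma> 1 = 1"
    and kernel: "\<sigma> p = 0 \<longleftrightarrow> a dvd p"
begin

lemma zero [simp]: "\<sigma> 0 = 0"
  using add[of 0 0] unfolding add_0_right by (metis add_cancel_right_right)

lemma uminus [simp]: "\<sigma> (- p) = - \<sigma> p"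
  using add[of p "- p"] by (simp add: eq_neg_iff_add_eq_0 add.commute)

lemma diff [simp]: "\<sigma> (p - q) = \<sigma> p - \<sigma> q"
  using add[of p "- q"] by simp

lemma power [simp]: "\<sigma> (p ^ n) = \<sigma> p ^ n"
  by (induction n) simp_all

lemma of_nat [simp]: "\<sigma> (of_nat n) = of_nat n"
  by (induction n) simp_all

lemma numeral [simp]: "\<sigma> (numeral n) = numeral n"
  using of_nat[of "numeral n"] by simp

lemma prime_elem: "a \<noteq> 0 \<Longrightarrow> prime_elem a"
  unfolding prime_elem_def using kernel[of 1] by (auto simp flip: kernel)

lemma form_eq:
  assumes "c \<in> set (all_roots w)" "\<sigma> w = w"
  shows "\<sigma> (form c p q r) = form c (\<sigma> p) (\<sigma> q) (\<sigma> r)"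
proof -
  have "\<forall>c\<in>set (all_roots w). \<sigma> (form c p q r) = form c (\<sigma> p) (\<sigma> q) (\<sigma> r)"
    by (simp add: klein_roots_def assms(2))
  then show ?thesis using assms(1) by blast
qed

lemma radial_eq:
  assumes "\<sigma> w = w"
  shows "\<sigma> (radial9 w p q r t) = radial9 w (\<sigma> p) (\<sigma> q) (\<sigma> r) (\<sigma> t)"
    "\<sigma> (radial11 w p q r t) = radial11 w (\<sigma> p) (\<sigma> q) (\<sigma> r) (\<sigma> t)"
  by (simp_all add: radial9_def radial11_def lin9_def quad9_def lin11_def quad11_def assms)

end

section \<open>Products of non-associated primes and determinants of tangent fields\<close>

lemma prod_list_dvd:
  fixes f :: "'b \<Rightarrow> 'a::idom"
  assumes "distinct cs" "\<And>c. c \<in> set cs \<Longrightarrow> prime_elem (f c)"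
    and "\<And>c d. c \<in> set cs \<Longrightarrow> d \<in> set cs \<Longrightarrow> c \<noteq> d \<Longrightarrow> \<not> f c dvd f d"
    and "\<And>c. c \<in> set cs \<Longrightarrow> f c dvd p"
  shows "prod_list (map f cs) dvd p"
  using assms
proof (induction cs arbitrary: p)
  case (Cons c cs)
  from Cons.prems(4)[of c] obtain q where q: "p = f c * q" by auto
  have "f d dvd q" if "d \<in> set cs" for d
  proof -
    have "f d dvd f c * q" "\<not> f d dvd f c" "prime_elem (f d)"
      using Cons.prems(1) Cons.prems(2)[of d] Cons.prems(3)[of d c] Cons.prems(4)[of d] that q by auto
    then show ?thesis by (simp add: prime_elem_dvd_mult_iff)
  qed
  with Cons have "prod_list (map f cs) dvd q" by simp
  then show ?case by (simp add: q mult_dvd_mono)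
qed simp

lemma prime_dvd_prod_list:
  fixes f :: "'b \<Rightarrow> 'a::idom"
  assumes "prime_elem p" "p dvd prod_list (map f cs)"
  shows "\<exists>c\<in>set cs. p dvd f c"
  using assms(2)
proof (induction cs)
  case Nil
  then show ?case using assms(1) by (simp add: prime_elem_not_unit)
next
  case (Cons c cs)
  then show ?case using assms(1) by (auto simp: prime_elem_dvd_mult_iff)
qed

definition det3 :: "'a::comm_ring_1 \<Rightarrow> 'a \<Rightarrow> 'a \<Rightarrow> 'a \<Rightarrow> 'a \<Rightarrow> 'a \<Rightarrow> 'a \<Rightarrow> 'a \<Rightarrow> 'a \<Rightarrow> 'a" where
  "det3 a1 a2 a3 b1 b2 b3 c1 c2 c3 =
     a1 * (b2 * c3 - b3 * c2) - a2 * (b1 * c3 - b3 * c1) + a3 * (b1 * c2 - b2 * c1)"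

text \<open>Cramer's rule: \<open>k1\<close> times the determinant is the determinant whose first
  column is replaced by the values of the form on the three rows, and \<open>l\<close> divides those
  values. The same holds for \<open>k2\<close> and \<open>k3\<close>, and one of the three is a
  unit.\<close>

lemma dvd_det3:
  fixes a1 :: "'a::idom"
  assumes d: "l dvd form (k1, k2, k3) a1 a2 a3" "l dvd form (k1, k2, k3) b1 b2 b3" "l dvd form (k1, k2, k3) c1 c2 c3"
    and u: "k1 dvd 1 \<or> k2 dvd 1 \<or> k3 dvd 1"
  shows "l dvd det3 a1 a2 a3 b1 b2 b3 c1 c2 c3"
proof -
  let ?d = "det3 a1 a2 a3 b1 b2 b3 c1 c2 c3"
  let ?a = "form (k1, k2, k3) a1 a2 a3" and ?b = "form (k1, k2, k3) b1 b2 b3" and ?c = "form (k1, k2, k3) c1 c2 c3"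
  have "?a * (b2*c3 - b3*c2) - ?b * (a2*c3 - a3*c2) + ?c * (a2*b3 - a3*b2) = k1 * ?d"
    "?b * (a1*c3 - a3*c1) - ?a * (b1*c3 - b3*c1) - ?c * (a1*b3 - a3*b1) = k2 * ?d"
    "?a * (b1*c2 - b2*c1) - ?b * (a1*c2 - a2*c1) + ?c * (a1*b2 - a2*b1) = k3 * ?d"
    unfolding det3_def form.simps by Groebner_Basis.algebra+
  with d have "l dvd k1 * ?d" "l dvd k2 * ?d" "l dvd k3 * ?d"
    by (metis dvd_add dvd_diff dvd_mult2)+
  moreover have "l dvd ?d" if "l dvd k * ?d" "k dvd 1" for k
  proof -
    from that(2) obtain k' where "1 = k * k'" ..
    then have "?d = k * ?d * k'" by (metis mult.assoc mult.commute mult_1)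
    with that(1) show ?thesis by (metis dvd_mult2)
  qed
  ultimately show ?thesis using u by blast
qed

lemma klein_roots_unit:
  "(k1, k2, k3) \<in> set (all_roots w) \<Longrightarrow> k1 dvd 1 \<or> k2 dvd 1 \<or> k3 dvd (1::'a::idom)"
  by (auto simp: klein_roots_def)

section \<open>Saito's criterion for all 21 lines\<close>

text \<open>
  Tangency to a line is checked in the image of a substitution that kills its equation, so that
  only polynomial identities remain.
\<close>

locale klein_coordinates =
  fixes w x y z :: "'a::idom"
  assumes w_sq: "w * w = w - 2"
    and unit: "of_nat (Suc n) dvd (1::'a)"
    and subst: "c \<in> set (all_roots w) \<Longrightarrow> \<exists>\<sigma>. ring_substitution \<sigma> (form c x y z) \<and> \<sigma> w = w"
    and subst_x: "\<exists>\<sigma>. ring_substitution \<sigma> x \<and> \<sigma> w = w \<and> \<sigma> y = y \<and> \<sigma> z = z \<and> (\<forall>p. \<sigma> (\<sigma> p) = \<sigma> p)"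
    and nonassoc: "c \<in> set (all_roots w) \<Longrightarrow> d \<in> set (all_roots w) \<Longrightarrow>
      c \<noteq> d \<Longrightarrow> \<not> form c x y z dvd form d x y z"
begin

abbreviation root_form :: "'a \<times> 'a \<times> 'a \<Rightarrow> 'a" where
  "root_form c \<equiv> form c x y z"

definition tangent :: "('a \<times> 'a \<times> 'a) list \<Rightarrow> 'a \<Rightarrow> 'a \<Rightarrow> 'a \<Rightarrow> bool" where
  "tangent cs p q r \<longleftrightarrow> (\<forall>c\<in>set cs. root_form c dvd form c p q r)"

abbreviation N9 :: "'a \<Rightarrow> 'a" where
  "N9 t \<equiv> radial9 w (x^2) (y^2) (z^2) (t^2)"

abbreviation N11 :: "'a \<Rightarrow> 'a" where
  "N11 t \<equiv> radial11 w (x^2) (y^2) (z^2) (t^2)"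

definition F :: 'a where
  "F = prod_list (map root_form (klein_roots w))"

lemma unit_numeral: "numeral n dvd (1::'a)"
  by (metis numeral_eq_Suc of_nat_numeral unit)

lemma two_neq_0: "(2::'a) \<noteq> 0"
  using unit_numeral[of "num.Bit0 num.One"] by (metis dvd_0_left zero_neq_one)

lemma unit_w: "(1 + w) dvd 1"
proof -
  \<comment> \<open>The norm of \<open>1 + w\<close>: the other root of the quadratic equation is
    \<open>1 - w\<close>.\<close>
  have "(1 + w) * (2 - w) = 4" using w_sq by Groebner_Basis.algebra
  then have "(1 + w) dvd 4" by (metis dvd_triv_left)
  then show ?thesis using unit_numeral by (rule dvd_trans)
qed

lemma w_neq: "w \<noteq> 0" "w \<noteq> 1" "w \<noteq> -1" "(1::'a) \<noteq> -1" "-1 \<noteq> (1::'a)" "0 \<noteq> w" "1 \<noteq> w" "-1 \<noteq> w"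
proof -
  have "(1::'a) + 1 \<noteq> 0" using two_neq_0 by simp
  then show 1: "(1::'a) \<noteq> -1" by (metis eq_neg_iff_add_eq_0)
  then show "-1 \<noteq> (1::'a)" by metis
  show 2: "w \<noteq> 0" using w_sq two_neq_0 by auto
  then show "0 \<noteq> w" by metis
  show 3: "w \<noteq> 1" using w_sq two_neq_0 by auto
  then show "1 \<noteq> w" by metis
  have "2 * 2 \<noteq> (0::'a)" using two_neq_0 by (metis mult_eq_0_iff)
  then show 4: "w \<noteq> -1" using w_sq by auto
  then show "-1 \<noteq> w" by metis
qed

lemma distinct_roots: "distinct (all_roots w)"
  by (simp add: klein_roots_def w_neq)

lemma prime_root: "c \<in> set (all_roots w) \<Longrightarrow> prime_elem (root_form c)"
proof -
  assume c: "c \<in> set (all_roots w)"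
  \<comment> \<open>Any root \<open>d\<close> other than \<open>c\<close> shows that
    \<open>root_form c\<close> is nonzero, since everything divides 0.\<close>
  define d :: "'a \<times> 'a \<times> 'a" where "d = (if c = (1,0,0) then (0,1,0) else (1,0,0))"
  have "d \<in> set (all_roots w)" "d \<noteq> c" by (auto simp: d_def klein_roots_def)
  from nonassoc[OF this(1) c this(2)] have "root_form c \<noteq> 0" by auto
  with subst[OF c] show ?thesis using ring_substitution.prime_elem by blast
qed

lemma prime_x: "prime_elem x" using prime_root[of "(1,0,0)"] by simp

lemma prime_y: "prime_elem y" using prime_root[of "(0,1,0)"] by (simp add: klein_roots_def)

lemma tangent_euler: "tangent cs x y z"
  by (simp add: tangent_def)

lemma tangent_radial:
  assumes sym: "\<And>a b c t. N b a c t = N a b c t" "\<And>a b c t. N c b a t = N a b c t"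
    and tangent: "\<And>x y z. w*x + y + z = 0 \<Longrightarrow>
      w * (x * N (x^2) (y^2) (z^2) (x^2)) + y * N (x^2) (y^2) (z^2) (y^2) + z * N (x^2) (y^2) (z^2) (z^2) = 0"
    and hom: "\<And>\<sigma> l p q r t. ring_substitution \<sigma> l \<Longrightarrow> \<sigma> w = w \<Longrightarrow> \<sigma> (N p q r t) = N (\<sigma> p) (\<sigma> q) (\<sigma> r) (\<sigma> t)"
  shows "tangent (all_roots w) (x * N (x^2) (y^2) (z^2) (x^2)) (y * N (x^2) (y^2) (z^2) (y^2)) (z * N (x^2) (y^2) (z^2) (z^2))"
    (is "tangent _ ?p ?q ?r")
  unfolding tangent_def
proof
  fix c assume c: "c \<in> set (all_roots w)"
  obtain \<sigma> where \<sigma>: "ring_substitution \<sigma> (root_form c)" "\<sigma> w = w" using subst[OF c] by blast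
  interpret ring_substitution \<sigma> "root_form c" by fact
  have "form c (\<sigma> x) (\<sigma> y) (\<sigma> z) = 0" using form_eq[OF c \<sigma>(2)] kernel by (metis dvd_refl)
  from tangent_roots[of N, OF sym tangent c this]
  have "\<sigma> (form c ?p ?q ?r) = 0" by (simp add: form_eq[OF c \<sigma>(2)] hom[OF \<sigma>])
  then show "root_form c dvd form c ?p ?q ?r" by (simp add: kernel)
qed

lemma tangent_9: "tangent (all_roots w) (x * N9 x) (y * N9 y) (z * N9 z)"
  by (rule tangent_radial[OF radial9_sym radial9_tangent[OF w_sq] ring_substitution.radial_eq(1)])

lemma tangent_11: "tangent (all_roots w) (x * N11 x) (y * N11 y) (z * N11 z)"
  by (rule tangent_radial[OF radial11_sym radial11_tangent[OF w_sq] ring_substitution.radial_eq(2)])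

text \<open>Each column contains its coordinate as a factor. What remains is, up to sign, the
  Vandermonde determinant of the squares times the determinant of the coefficients in
  \<open>radial_det\<close>. Coordinates and Vandermonde determinant give the nine mirrors of the
  signed permutations, the last factor the 12 other lines.\<close>

lemma saito_det:
  "det3 x y z (x * N9 x) (y * N9 y) (z * N9 z) (x * N11 x) (y * N11 y) (z * N11 z) = - (7 * (1 + w)) * (x * F)"
proof -
  define s t s' t' where "s = lin9 w (x^2) (y^2) (z^2)" and "t = quad9 w (x^2) (y^2) (z^2)"
    and "s' = lin11 w (x^2) (y^2) (z^2)" and "t' = quad11 w (x^2) (y^2) (z^2)"
  define h1 h2 h3 where
      "h1 = (w*w*x^2)^2+(y^2)^2+(z^2)^2-2*(w*w*x^2)*y^2-2*(w*w*x^2)*z^2-2*y^2*z^2"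
    and "h2 = (x^2)^2+(w*w*y^2)^2+(z^2)^2-2*x^2*(w*w*y^2)-2*x^2*z^2-2*(w*w*y^2)*z^2"
    and "h3 = (x^2)^2+(y^2)^2+(w*w*z^2)^2-2*x^2*y^2-2*x^2*(w*w*z^2)-2*y^2*(w*w*z^2)"
  have 1: "s * t' - t * s' = (7 + 7*w) * (h1 * h2 * h3)"
    unfolding s_def t_def s'_def t'_def h1_def h2_def h3_def by (rule radial_det[OF w_sq])
  have 2: "det3 x y z (x * N9 x) (y * N9 y) (z * N9 z) (x * N11 x) (y * N11 y) (z * N11 z) =
    - ((s * t' - t * s') * (x * y * z * ((x+y) * (x-y) * (x+z) * (x-z) * (y+z) * (y-z))))"
    unfolding det3_def radial9_def radial11_def s_def[symmetric] t_def[symmetric] s'_def[symmetric] t'_def[symmetric]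
    by Groebner_Basis.algebra
  have 3: "(w*x+y+z) * (w*x-y-z) * (w*x-y+z) * (w*x+y-z) = h1"
    "(x+w*y+z) * (-x+w*y-z) * (-x+w*y+z) * (x+w*y-z) = h2"
    "(x+y+w*z) * (-x-y+w*z) * (-x+y+w*z) * (x-y+w*z) = h3"
    unfolding h1_def h2_def h3_def by Groebner_Basis.algebra+
  have "F = y * z * ((x+y) * (x-y) * (x+z) * (x-z) * (y+z) * (y-z))
    * ((w*x+y+z) * (w*x-y-z) * (w*x-y+z) * (w*x+y-z)) * ((x+w*y+z) * (-x+w*y-z) * (-x+w*y+z) * (x+w*y-z))
    * ((x+y+w*z) * (-x-y+w*z) * (-x+y+w*z) * (x-y+w*z))"
    unfolding F_def klein_roots_def by (simp add: mult.assoc)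
  then have 4: "F = y * z * ((x+y) * (x-y) * (x+z) * (x-z) * (y+z) * (y-z)) * h1 * h2 * h3"
    unfolding 3 .
  show ?thesis unfolding 2 1 4 by (simp add: algebra_simps)
qed

lemma dvd_det3_tangent:
  assumes "tangent (all_roots w) a1 a2 a3" "tangent (all_roots w) b1 b2 b3"
    "tangent (all_roots w) c1 c2 c3"
  shows "x * F dvd det3 a1 a2 a3 b1 b2 b3 c1 c2 c3"
proof -
  have "prod_list (map root_form (all_roots w)) dvd det3 a1 a2 a3 b1 b2 b3 c1 c2 c3"
  proof (rule prod_list_dvd[OF distinct_roots prime_root nonassoc], assumption+)
    fix c assume c: "c \<in> set (all_roots w)"
    obtain k1 k2 k3 where k: "c = (k1, k2, k3)" by (cases c)
    show "root_form c dvd det3 a1 a2 a3 b1 b2 b3 c1 c2 c3"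
      using assms c unfolding tangent_def k
      by (intro dvd_det3[of _ k1 k2 k3] klein_roots_unit[of k1 k2 k3 w]) blast+
  qed
  then show ?thesis by (simp add: F_def)
qed

lemma F_neq_0: "x * F \<noteq> 0"
proof -
  have "root_form c \<noteq> 0" if "c \<in> set (klein_roots w)" for c
    using prime_root[of c] that by (simp add: prime_elem_def)
  then have "0 \<notin> set (map root_form (klein_roots w))" unfolding set_map by (blast dest: sym)
  moreover have "x \<noteq> 0" using prime_x by (simp add: prime_elem_def)
  ultimately show ?thesis unfolding F_def by (simp only: mult_eq_0_iff prod_list_zero_iff simp_thms)
qed

text \<open>Cramer's rule: the numerators are determinants of three tangent fields, hence multiples
  of \<open>x * F\<close>, and the denominator is \<open>x * F\<close> times the unit
  \<open>- (7 * (1 + w))\<close>.\<close>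

lemma saito_basis:
  assumes "tangent (all_roots w) p q r"
  shows "\<exists>g h k. p = g * x + h * (x * N9 x) + k * (x * N11 x) \<and> q = g * y + h * (y * N9 y) + k * (y * N11 y) \<and>
     r = g * z + h * (z * N9 z) + k * (z * N11 z)"
proof -
  define d where "d = det3 x y z (x * N9 x) (y * N9 y) (z * N9 z) (x * N11 x) (y * N11 y) (z * N11 z)"
  have "7 * (1 + w) dvd 1 * 1" by (rule mult_dvd_mono[OF unit_numeral unit_w])
  then have u: "- (7 * (1 + w)) dvd 1" by (simp only: minus_dvd_iff mult_1)
  then obtain v where v: "- (7 * (1 + w)) * v = 1" by (metis dvd_def)
  note e = tangent_euler[of "all_roots w"]
  obtain g h k where
    g: "det3 p q r (x * N9 x) (y * N9 y) (z * N9 z) (x * N11 x) (y * N11 y) (z * N11 z) = x * F * g" and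
    h: "det3 x y z p q r (x * N11 x) (y * N11 y) (z * N11 z) = x * F * h" and
    k: "det3 x y z (x * N9 x) (y * N9 y) (z * N9 z) p q r = x * F * k"
    using dvd_det3_tangent[OF assms tangent_9 tangent_11] dvd_det3_tangent[OF e assms tangent_11]
      dvd_det3_tangent[OF e tangent_9 assms] by (metis dvd_def)
  have cramer: "det3 a1 a2 a3 b1 b2 b3 c1 c2 c3 * p = det3 p q r b1 b2 b3 c1 c2 c3 * a1
      + det3 a1 a2 a3 p q r c1 c2 c3 * b1 + det3 a1 a2 a3 b1 b2 b3 p q r * c1"
    "det3 a1 a2 a3 b1 b2 b3 c1 c2 c3 * q = det3 p q r b1 b2 b3 c1 c2 c3 * a2
      + det3 a1 a2 a3 p q r c1 c2 c3 * b2 + det3 a1 a2 a3 b1 b2 b3 p q r * c2"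
    "det3 a1 a2 a3 b1 b2 b3 c1 c2 c3 * r = det3 p q r b1 b2 b3 c1 c2 c3 * a3
      + det3 a1 a2 a3 p q r c1 c2 c3 * b3 + det3 a1 a2 a3 b1 b2 b3 p q r * c3"
    for a1 a2 a3 b1 b2 b3 c1 c2 c3
    unfolding det3_def by Groebner_Basis.algebra+
  have *: "t = v * g * a + v * h * b + v * k * c"
    if "- (7 * (1 + w)) * (x * F) * t = x * F * g * a + x * F * h * b + x * F * k * c" for t a b c
  proof -
    have "(x * F) * (- (7 * (1 + w)) * t) = (x * F) * (g * a + h * b + k * c)"
      using that by (simp only: algebra_simps)
    with F_neq_0 have "- (7 * (1 + w)) * t = g * a + h * b + k * c" by (metis mult_left_cancel)
    then have "v * (- (7 * (1 + w)) * t) = v * (g * a + h * b + k * c)" by simp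
    moreover have "v * (- (7 * (1 + w)) * t) = t" using v by (metis mult.assoc mult.commute mult_1)
    ultimately show ?thesis by (simp add: algebra_simps)
  qed
  show ?thesis
    using *[OF cramer(1)[of x y z "x * N9 x" "y * N9 y" "z * N9 z" "x * N11 x" "y * N11 y" "z * N11 z", unfolded saito_det g h k]]
      *[OF cramer(2)[of x y z "x * N9 x" "y * N9 y" "z * N9 z" "x * N11 x" "y * N11 y" "z * N11 z", unfolded saito_det g h k]]
      *[OF cramer(3)[of x y z "x * N9 x" "y * N9 y" "z * N9 z" "x * N11 x" "y * N11 y" "z * N11 z", unfolded saito_det g h k]]
    by blast
qed

end

section \<open>Deleting the line \<open>x = 0\<close>\<close>

lemma prime_square_dvd_mult:
  fixes p :: "'a::idom"
  assumes "prime_elem p" "p^2 dvd u * v" "\<not> p dvd u"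
  shows "p^2 dvd v"
proof -
  from assms(2) have "p dvd u * v" by (metis dvd_mult_left power2_eq_square)
  with assms have "p dvd v" by (simp add: prime_elem_dvd_mult_iff)
  then obtain v' where v: "v = p * v'" ..
  from assms(1) have "p \<noteq> 0" by (simp add: prime_elem_def)
  with assms(2) have "p dvd u * v'"
    unfolding v power2_eq_square by (metis dvd_mult_cancel_left mult.left_commute)
  with assms have "p dvd v'" by (simp add: prime_elem_dvd_mult_iff)
  then show ?thesis by (simp add: v power2_eq_square mult_dvd_mono)
qed

context klein_coordinates
begin

abbreviation "R12 \<equiv> quad_mult w (y^2) (z^2)"

text \<open>The new field is the combination in \<open>relation12\<close> divided by
  \<open>x\<close>. Its components contain the differences of \<open>N9\<close> and
  \<open>N11\<close> at two coordinates, hence a difference of squares times divided differences. In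
  the first component the factor \<open>x\<close> to be removed is visible; in the third,
  \<open>quart12\<close> provides \<open>x^2\<close>.\<close>

definition f12x :: 'a where
  "f12x = (x^2 - y^2) * (R12 * (lin9 w (x^2) (y^2) (z^2) + quad9 w (x^2) (y^2) (z^2) * (x^2 + y^2))
     - (y^2 + z^2) * (lin11 w (x^2) (y^2) (z^2) + quad11 w (x^2) (y^2) (z^2) * (x^2 + y^2)))"

definition f12z :: 'a where
  "f12z = x * z * (z^2 - y^2) * quart12 w (x^2) (y^2) (z^2)"

text \<open>The multiple of the Euler field that makes the second component of the relation
  vanish.\<close>

definition g12 :: 'a where
  "g12 = (y^2 + z^2) * N11 y - R12 * N9 y"

lemma relation12:
  "x * f12x = g12 * x + R12 * (x * N9 x) - (y^2 + z^2) * (x * N11 x)"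
  "0 = g12 * y + R12 * (y * N9 y) - (y^2 + z^2) * (y * N11 y)"
  "x * f12z = g12 * z + R12 * (z * N9 z) - (y^2 + z^2) * (z * N11 z)"
proof -
  define s t s' t' where "s = lin9 w (x^2) (y^2) (z^2)" and "t = quad9 w (x^2) (y^2) (z^2)"
    and "s' = lin11 w (x^2) (y^2) (z^2)" and "t' = quad11 w (x^2) (y^2) (z^2)"
  note d = s_def[symmetric] t_def[symmetric] s'_def[symmetric] t'_def[symmetric]
  show "x * f12x = g12 * x + R12 * (x * N9 x) - (y^2 + z^2) * (x * N11 x)"
    unfolding f12x_def g12_def radial9_def radial11_def d by Groebner_Basis.algebra
  show "0 = g12 * y + R12 * (y * N9 y) - (y^2 + z^2) * (y * N11 y)"
    unfolding g12_def by Groebner_Basis.algebra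
  have q: "x^2 * quart12 w (x^2) (y^2) (z^2) = R12 * (s + t * (y^2+z^2)) - (y^2+z^2) * (s' + t' * (y^2+z^2))"
    unfolding s_def t_def s'_def t'_def by (rule quart12[OF w_sq, symmetric])
  have "x * f12z = z * (z^2 - y^2) * (x^2 * quart12 w (x^2) (y^2) (z^2))"
    unfolding f12z_def by Groebner_Basis.algebra
  then show "x * f12z = g12 * z + R12 * (z * N9 z) - (y^2 + z^2) * (z * N11 z)"
    unfolding q g12_def radial9_def radial11_def d by Groebner_Basis.algebra
qed

lemma not_dvd_roots:
  "\<not> x dvd y" "\<not> x dvd z" "\<not> y dvd z" "\<not> z dvd y" "\<not> x dvd y + z" "\<not> x dvd y - z"
  using nonassoc[of "(1,0,0)" "(0,1,0)"] nonassoc[of "(1,0,0)" "(0,0,1)"] nonassoc[of "(0,1,0)" "(0,0,1)"]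
    nonassoc[of "(0,0,1)" "(0,1,0)"] nonassoc[of "(1,0,0)" "(0,1,1)"] nonassoc[of "(1,0,0)" "(0,1,-1)"]
  by (simp_all add: klein_roots_def)

lemma prime_z: "prime_elem z" using prime_root[of "(0,0,1)"] by (simp add: klein_roots_def)

lemma not_dvd_sum_squares: "\<not> y dvd y^2 + z^2" "\<not> z dvd y^2 + z^2"
proof -
  have "y dvd y^2 + z^2 \<Longrightarrow> y dvd z"
    by (metis dvd_add_right_iff dvd_power prime_elem_dvd_power prime_y zero_less_numeral)
  then show "\<not> y dvd y^2 + z^2" using not_dvd_roots by blast
  have "z dvd y^2 + z^2 \<Longrightarrow> z dvd y"
    by (metis dvd_add_left_iff dvd_power prime_elem_dvd_power prime_z zero_less_numeral)
  then show "\<not> z dvd y^2 + z^2" using not_dvd_roots by blast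
qed

lemma quad_factor_neq_0: "quad_factor w (y^2) (z^2) \<noteq> 0"
proof
  assume "quad_factor w (y^2) (z^2) = 0"
  \<comment> \<open>Multiplication by \<open>1 + w\<close> turns the coefficient
    \<open>2 - w\<close> of \<open>z^4\<close> into the unit 4; all other terms contain
    \<open>y\<close>.\<close>
  then have "4 * z^4 = y * (- ((1 + w) * (2 - w) * y^3 + (1 + w) * (3 - 3*w) * (y*z^2)))"
    using w_sq unfolding quad_factor_def by Groebner_Basis.algebra
  then have "y dvd 4 * z^4" by (metis dvd_triv_left)
  moreover have "\<not> y dvd 4" using unit_numeral prime_y by (meson dvd_trans prime_elem_not_unit)
  ultimately show False using prime_y not_dvd_roots by (metis prime_elem_dvd_mult_iff prime_elem_dvd_power)
qed

lemma tangent_times_x: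
  "tangent (klein_roots w) p q r \<Longrightarrow> tangent (all_roots w) (x * p) (x * q) (x * r)"
proof -
  assume t: "tangent (klein_roots w) p q r"
  have *: "form c (x * p) (x * q) (x * r) = x * form c p q r" for c by (cases c) (simp add: algebra_simps)
  show ?thesis using t unfolding tangent_def * by auto
qed

text \<open>
  Modulo \<open>x\<close>, the \<open>y\<close>- and \<open>z\<close>-components of \<open>x \<theta> = g \<theta>\<^sub>E + h \<theta>\<^sub>9 + k \<theta>\<^sub>1\<^sub>1\<close> give
  \<open>h (y\<^sup>2 + z\<^sup>2) + k R = 0\<close>. As \<open>R\<close> is a unit times \<open>y\<^sup>2 z\<^sup>2\<close> modulo \<open>y\<^sup>2 + z\<^sup>2\<close>, the pair \<open>(h, k)\<close>
  is a multiple of \<open>(R, - (y\<^sup>2 + z\<^sup>2))\<close>.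
\<close>

lemma deletion_basis:
  assumes "tangent (klein_roots w) p q r"
  shows "\<exists>m g h k. p = m * f12x + g * x + h * (x * N9 x) + k * (x * N11 x) \<and>
     q = g * y + h * (y * N9 y) + k * (y * N11 y) \<and>
     r = m * f12z + g * z + h * (z * N9 z) + k * (z * N11 z)"
proof -
  obtain g h k where
    p: "x * p = g * x + h * (x * N9 x) + k * (x * N11 x)" and
    q: "x * q = g * y + h * (y * N9 y) + k * (y * N11 y)" and
    r: "x * r = g * z + h * (z * N9 z) + k * (z * N11 z)"
    using saito_basis[OF tangent_times_x[OF assms]] by blast
  obtain \<sigma> where "ring_substitution \<sigma> x" and \<sigma>: "\<sigma> w = w" "\<sigma> y = y" "\<sigma> z = z" "\<And>p. \<sigma> (\<sigma> p) = \<sigma> p"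
    using subst_x by blast
  interpret ring_substitution \<sigma> x by fact
  define b c where "b = y^2" and "c = z^2"
  have bc: "\<sigma> b = b" "\<sigma> c = c" by (simp_all add: b_def c_def \<sigma>)
  have x0: "\<sigma> x = 0" by (simp add: kernel)
  have nz: "y \<noteq> 0" "z \<noteq> 0" "x \<noteq> 0" using prime_x prime_y prime_z by (simp_all add: prime_elem_def)
  have bc0: "b + c \<noteq> 0" using not_dvd_sum_squares unfolding b_def c_def by (metis dvd_0_right)
  have "(y - z) * (y + z) \<noteq> 0" using not_dvd_roots by (metis dvd_0_right mult_eq_0_iff)
  then have bc1: "b - c \<noteq> 0" unfolding b_def c_def by (simp add: power2_eq_square algebra_simps)
  have "\<sigma> (x * q) = y * (\<sigma> g + \<sigma> h * radial9 w 0 b c b + \<sigma> k * radial11 w 0 b c b)"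
    unfolding q by (simp add: radial_eq[OF \<sigma>(1)] \<sigma> x0 b_def c_def algebra_simps)
  then have 1: "\<sigma> g + \<sigma> h * radial9 w 0 b c b + \<sigma> k * radial11 w 0 b c b = 0"
    using nz by (simp add: x0)
  have "\<sigma> (x * r) = z * (\<sigma> g + \<sigma> h * radial9 w 0 b c c + \<sigma> k * radial11 w 0 b c c)"
    unfolding r by (simp add: radial_eq[OF \<sigma>(1)] \<sigma> x0 b_def c_def algebra_simps)
  then have 2: "\<sigma> g + \<sigma> h * radial9 w 0 b c c + \<sigma> k * radial11 w 0 b c c = 0"
    using nz by (simp add: x0)
  have 3: "lin9 w 0 b c + quad9 w 0 b c * (b+c) = (b+c) * quad_factor w b c"
    "lin11 w 0 b c + quad11 w 0 b c * (b+c) = quad_factor w b c * quad_mult w b c"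
    using lin9_mod[of w 0 b c] lin11_mod[OF w_sq, of 0 b c] by simp_all
  \<comment> \<open>Subtracting \<open>2\<close> from \<open>1\<close> eliminates the Euler
    coefficient \<open>\<sigma> g\<close> and leaves divided differences, where \<open>3\<close>
    exposes the common factor.\<close>
  have "(b - c) * (quad_factor w b c * (\<sigma> h * (b + c) + \<sigma> k * quad_mult w b c)) = 0"
    using 1 2 3 unfolding radial9_def radial11_def by Groebner_Basis.algebra
  then have hk: "\<sigma> h * (b + c) + \<sigma> k * quad_mult w b c = 0"
    using bc1 quad_factor_neq_0 unfolding b_def c_def by simp
  \<comment> \<open>Since \<open>quad_mult w b c = (2*w - 1)*(b + c)^2 + 2*(1 + w)*b*c\<close>, the
    part divisible by \<open>b + c\<close> is absorbed into \<open>s\<close>. The right-hand side of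
    \<open>4\<close> then shows the squares \<open>b = y^2\<close> and \<open>c = z^2\<close>, which
    are prime to \<open>b + c\<close>.\<close>
  define s where "s = \<sigma> h + \<sigma> k * ((2*w - 1) * (b + c))"
  have 4: "(b + c) * s = b * (c * (- (2 * (1 + w)) * \<sigma> k))"
    using hk unfolding s_def quad_mult_def by Groebner_Basis.algebra
  then have "y^2 dvd (b + c) * s" unfolding b_def by (metis dvd_triv_left)
  then have "y^2 dvd s" using prime_square_dvd_mult[OF prime_y] not_dvd_sum_squares unfolding b_def c_def by blast
  then obtain s' where s': "s = b * s'" unfolding b_def ..
  have "b * ((b + c) * s') = b * (c * (- (2 * (1 + w)) * \<sigma> k))"
    using 4 unfolding s' by (simp only: mult.left_commute)
  then have 5: "(b + c) * s' = c * (- (2 * (1 + w)) * \<sigma> k)"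
    using nz by (simp add: b_def)
  then have "z^2 dvd (b + c) * s'" unfolding c_def by (metis dvd_triv_left)
  then have "z^2 dvd s'" using prime_square_dvd_mult[OF prime_z] not_dvd_sum_squares unfolding b_def c_def by blast
  then obtain n where n: "s' = c * n" unfolding c_def ..
  have "c * ((b + c) * n) = c * (- (2 * (1 + w)) * \<sigma> k)"
    using 5 unfolding n by (simp only: mult.left_commute)
  then have 6: "(b + c) * n = - (2 * (1 + w)) * \<sigma> k"
    using nz by (simp add: c_def)
  have "2 * (1 + w) dvd 1 * 1" by (rule mult_dvd_mono[OF unit_numeral unit_w])
  then obtain v where v: "2 * (1 + w) * v = 1" by (metis dvd_def mult_1)
  define m where "m = n * v"
  have k0: "\<sigma> k = - (b + c) * m" using 6 v unfolding m_def by Groebner_Basis.algebra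
  have h0: "\<sigma> h = m * quad_mult w b c"
  proof -
    have "(b + c) * \<sigma> h = (b + c) * (m * quad_mult w b c)" using hk k0 by Groebner_Basis.algebra
    with bc0 show ?thesis by (metis mult_left_cancel)
  qed
  \<comment> \<open>Idempotence of \<open>\<sigma>\<close> gives \<open>\<sigma> m = m\<close>, so
    that \<open>k\<close> and \<open>h\<close> differ from the expected multiples of
    \<open>m\<close> by elements of the kernel, that is, by multiples of \<open>x\<close>.\<close>
  have "\<sigma> (\<sigma> k) = - (b + c) * \<sigma> m" unfolding k0 by (simp add: bc)
  then have "- (b + c) * \<sigma> m = - (b + c) * m" by (metis \<sigma>(4) k0)
  then have m: "\<sigma> m = m" using bc0 by (metis mult_left_cancel neg_equal_0_iff_equal)
  have "x dvd k + (b + c) * m" by (simp add: kernel[symmetric] k0 m bc algebra_simps)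
  then obtain k' where "k + (b + c) * m = x * k'" ..
  then have k: "k = x * k' - (b + c) * m" by (simp add: algebra_simps)
  have "x dvd h - m * quad_mult w b c" by (simp add: kernel[symmetric] h0 m bc quad_mult_def \<sigma>)
  then obtain h' where "h - m * quad_mult w b c = x * h'" ..
  then have h: "h = x * h' + m * R12" unfolding b_def c_def by (simp add: algebra_simps)
  \<comment> \<open>The second component determines the Euler coefficient modulo \<open>x\<close>,
    because \<open>relation12\<close> has 0 there and \<open>x\<close> does not divide
    \<open>y\<close>.\<close>
  have "x * (q - y * (h' * N9 y + k' * N11 y)) = y * (g - m * g12)"
    using q unfolding h k g12_def b_def c_def by Groebner_Basis.algebra
  then have "x dvd y * (g - m * g12)" by (metis dvd_triv_left)
  then have "x dvd g - m * g12" using prime_x not_dvd_roots by (metis prime_elem_dvd_mult_iff)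
  then obtain g' where "g - m * g12 = x * g'" ..
  then have g: "g = x * g' + m * g12" by (simp add: algebra_simps)
  have "x * p = x * (m * f12x + g' * x + h' * (x * N9 x) + k' * (x * N11 x))"
    using relation12(1) unfolding p g h k b_def c_def by Groebner_Basis.algebra
  then have p': "p = m * f12x + g' * x + h' * (x * N9 x) + k' * (x * N11 x)"
    by (rule mult_left_cancel[OF nz(3), THEN iffD1])
  have "x * q = x * (g' * y + h' * (y * N9 y) + k' * (y * N11 y))"
    using relation12(2) unfolding q g h k b_def c_def by Groebner_Basis.algebra
  then have q': "q = g' * y + h' * (y * N9 y) + k' * (y * N11 y)"
    by (rule mult_left_cancel[OF nz(3), THEN iffD1])
  have "x * r = x * (m * f12z + g' * z + h' * (z * N9 z) + k' * (z * N11 z))"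
    using relation12(3) unfolding r g h k b_def c_def by Groebner_Basis.algebra
  then have "r = m * f12z + g' * z + h' * (z * N9 z) + k' * (z * N11 z)"
    by (rule mult_left_cancel[OF nz(3), THEN iffD1])
  with p' q' show ?thesis by blast
qed

end

section \<open>Derivations, tangency in terms of \<open>F\<close>, and syzygies\<close>

definition derivation :: "('a::comm_ring_1 \<Rightarrow> 'a) \<Rightarrow> bool" where
  "derivation d \<longleftrightarrow> (\<forall>p q. d (p + q) = d p + d q) \<and> (\<forall>p q. d (p * q) = p * d q + q * d p)"

lemma derivation_simps:
  assumes "derivation d"
  shows "d (p + q) = d p + d q" "d (p * q) = p * d q + q * d p" "d 0 = 0" "d 1 = 0" "d (- p) = - d p" "d (p - q) = d p - d q"
proof -
  show 1: "d (p + q) = d p + d q" and 2: "d (p * q) = p * d q + q * d p" for p q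
    using assms by (auto simp: derivation_def)
  show 3: "d 0 = 0" using 1[of 0 0] by (metis add_0_right add_cancel_right_right)
  show "d 1 = 0" using 2[of 1 1] by (metis add_cancel_right_right mult_1)
  show 4: "d (- p) = - d p" for p using 1[of p "- p"] 3 by (simp add: eq_neg_iff_add_eq_0 add.commute)
  show "d (p - q) = d p - d q" using 1[of p "- q"] 4[of q] by simp
qed

locale klein_derivations = klein_coordinates +
  fixes d1 d2 d3 :: "'a \<Rightarrow> 'a"
  assumes derivation: "derivation d1" "derivation d2" "derivation d3"
    and d1: "d1 w = 0" "d1 x = 1" "d1 y = 0" "d1 z = 0"
    and d2: "d2 w = 0" "d2 x = 0" "d2 y = 1" "d2 z = 0"
    and d3: "d3 w = 0" "d3 x = 0" "d3 y = 0" "d3 z = 1"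
begin

definition D :: "'a \<Rightarrow> 'a \<Rightarrow> 'a \<Rightarrow> 'a \<Rightarrow> 'a" where
  "D p q r f = p * d1 f + q * d2 f + r * d3 f"

lemmas d_simps = derivation_simps[OF derivation(1)] derivation_simps[OF derivation(2)] derivation_simps[OF derivation(3)]

lemma D_mult: "D p q r (f * g) = f * D p q r g + g * D p q r f"
  by (simp add: D_def d_simps algebra_simps)

lemma D_1: "D p q r 1 = 0"
  by (simp add: D_def d_simps)

lemma D_root: "c \<in> set (all_roots w) \<Longrightarrow> D p q r (root_form c) = form c p q r"
proof -
  have "\<forall>c\<in>set (all_roots w). D p q r (root_form c) = form c p q r"
    by (simp add: klein_roots_def D_def d_simps d1 d2 d3)
  then show "c \<in> set (all_roots w) \<Longrightarrow> D p q r (root_form c) = form c p q r" by blast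
qed

lemma D_prod_euler:
  "set cs \<subseteq> set (klein_roots w) \<Longrightarrow>
    D x y z (prod_list (map root_form cs)) = of_nat (length cs) * prod_list (map root_form cs)"
proof (induction cs)
  case (Cons c cs)
  then have "D x y z (root_form c) = root_form c" by (intro D_root) auto
  with Cons show ?case by (simp add: D_mult algebra_simps)
qed (simp add: D_1)

lemma prod_dvd_D:
  "\<forall>c\<in>set cs. root_form c dvd D p q r (root_form c) \<Longrightarrow>
    prod_list (map root_form cs) dvd D p q r (prod_list (map root_form cs))"
proof (induction cs)
  case (Cons c cs)
  then have "root_form c * prod_list (map root_form cs) dvd prod_list (map root_form cs) * D p q r (root_form c)"
    by (subst mult.commute) (intro mult_dvd_mono; simp)
  with Cons show ?case by (simp add: D_mult mult_dvd_mono)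
qed simp

text \<open>By the product rule, modulo one factor only the term that differentiates this factor
  survives, and the product of the others is prime to it.\<close>

lemma root_dvd_D:
  "distinct cs \<Longrightarrow> set cs \<subseteq> set (klein_roots w) \<Longrightarrow>
    prod_list (map root_form cs) dvd D p q r (prod_list (map root_form cs)) \<Longrightarrow>
    \<forall>c\<in>set cs. root_form c dvd D p q r (root_form c)"
proof (induction cs)
  case (Cons c cs)
  let ?P = "prod_list (map root_form cs)"
  have sub: "insert c (set cs) \<subseteq> set (all_roots w)" using Cons.prems(2) by auto
  have c: "prime_elem (root_form c)" using sub by (intro prime_root) auto
  have d: "root_form c * ?P dvd root_form c * D p q r ?P + ?P * D p q r (root_form c)"
    using Cons.prems(3) by (simp add: D_mult)
  then have "root_form c dvd ?P * D p q r (root_form c)"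
    by (meson dvd_add_right_iff dvd_mult_left dvd_triv_left)
  moreover have "\<not> root_form c dvd ?P"
  proof
    assume "root_form c dvd ?P"
    then obtain e where "e \<in> set cs" "root_form c dvd root_form e" using prime_dvd_prod_list[OF c] by blast
    moreover from this(1) have "c \<noteq> e" using Cons.prems(1) by auto
    ultimately show False using nonassoc[of c e] sub by blast
  qed
  ultimately have 1: "root_form c dvd D p q r (root_form c)" using c by (metis prime_elem_dvd_mult_iff)
  have "?P dvd root_form c * D p q r ?P"
    using d by (meson dvd_add_left_iff dvd_mult_right dvd_triv_left)
  have "?P dvd D p q r ?P"
  proof (rule prod_list_dvd)
    show "distinct cs" using Cons.prems(1) by simp
  next
    fix e assume "e \<in> set cs"
    then show "prime_elem (root_form e)" using sub by (intro prime_root) auto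
  next
    fix e e' assume "e \<in> set cs" "e' \<in> set cs" "e \<noteq> e'"
    then show "\<not> root_form e dvd root_form e'" using sub by (intro nonassoc) auto
  next
    fix e assume e: "e \<in> set cs"
    then have pe: "prime_elem (root_form e)" using sub by (intro prime_root) auto
    have "root_form e dvd ?P" using e by (induction cs) auto
    then have "root_form e dvd root_form c * D p q r ?P"
      using \<open>?P dvd root_form c * D p q r ?P\<close> by (rule dvd_trans)
    moreover have "\<not> root_form e dvd root_form c" using e Cons.prems(1) sub by (intro nonassoc) auto
    ultimately show "root_form e dvd D p q r ?P" using pe by (metis prime_elem_dvd_mult_iff)
  qed
  with Cons have "\<forall>c\<in>set cs. root_form c dvd D p q r (root_form c)" by simp
  with 1 show ?case by simp
qed simp

lemma tangent_iff_F_dvd: "tangent (klein_roots w) p q r \<longleftrightarrow> F dvd D p q r F"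
proof -
  have *: "(\<forall>c\<in>set (klein_roots w). root_form c dvd D p q r (root_form c)) \<longleftrightarrow> tangent (klein_roots w) p q r"
    unfolding tangent_def by (intro ball_cong refl) (simp add: D_root)
  have "distinct (klein_roots w)" using distinct_roots by simp
  then show ?thesis using prod_dvd_D[of "klein_roots w" p q r] root_dvd_D[of "klein_roots w" p q r]
    unfolding F_def * by blast
qed

lemma D_euler: "D x y z F = 20 * F"
proof -
  have "D x y z F = of_nat (length (klein_roots w)) * F" unfolding F_def by (rule D_prod_euler) simp
  then show ?thesis by (simp add: klein_roots_def)
qed

lemma tangent_sub: "tangent (all_roots w) p q r \<Longrightarrow> tangent (klein_roots w) p q r"
  by (simp add: tangent_def)

lemma tangent_12: "tangent (klein_roots w) f12x 0 f12z"
  unfolding tangent_def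
proof
  fix c assume c: "c \<in> set (klein_roots w)"
  have "x * form c f12x 0 f12z = g12 * root_form c + R12 * form c (x * N9 x) (y * N9 y) (z * N9 z)
    - (y^2 + z^2) * form c (x * N11 x) (y * N11 y) (z * N11 z)"
  proof -
    obtain i j k where "c = (i, j, k)" by (cases c)
    then have e: "form c p q r = i * p + j * q + k * r" for p q r by simp
    show ?thesis unfolding e using relation12 by Groebner_Basis.algebra
  qed
  moreover have "root_form c dvd \<dots>"
    using c tangent_9 tangent_11 unfolding tangent_def by (intro dvd_add dvd_diff dvd_mult) auto
  ultimately have "root_form c dvd x * form c f12x 0 f12z" by metis
  moreover have "\<not> root_form c dvd root_form (1,0,0)"
    using c distinct_roots by (intro nonassoc) auto
  ultimately show "root_form c dvd form c f12x 0 f12z"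
    using prime_root[of c] c by (simp add: prime_elem_dvd_mult_iff)
qed

text \<open>The cofactors exist by tangency. A choice is enough: later only their defining equation
  and their degree enter, and the degree follows from that equation.\<close>

definition K9 :: 'a where "K9 = (SOME k. D (x * N9 x) (y * N9 y) (z * N9 z) F = F * k)"
definition K11 :: 'a where "K11 = (SOME k. D (x * N11 x) (y * N11 y) (z * N11 z) F = F * k)"
definition K12 :: 'a where "K12 = (SOME k. D f12x 0 f12z F = F * k)"

lemma K9: "D (x * N9 x) (y * N9 y) (z * N9 z) F = F * K9"
  unfolding K9_def using tangent_sub[OF tangent_9] tangent_iff_F_dvd by (intro someI_ex[where P = "\<lambda>k. _ = F * k"]) (metis dvd_def)

lemma K11: "D (x * N11 x) (y * N11 y) (z * N11 z) F = F * K11"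
  unfolding K11_def using tangent_sub[OF tangent_11] tangent_iff_F_dvd by (intro someI_ex[where P = "\<lambda>k. _ = F * k"]) (metis dvd_def)

lemma K12: "D f12x 0 f12z F = F * K12"
  unfolding K12_def using tangent_12 tangent_iff_F_dvd by (intro someI_ex[where P = "\<lambda>k. _ = F * k"]) (metis dvd_def)

text \<open>The factor 20 is the degree of \<open>F\<close>: the Euler field maps \<open>F\<close>
  to \<open>20 * F\<close>, so subtracting the cofactor times the Euler field cancels
  exactly.\<close>

definition syz9 :: "'a \<Rightarrow> 'a" where "syz9 t = 20 * (t * N9 t) - K9 * t"
definition syz11 :: "'a \<Rightarrow> 'a" where "syz11 t = 20 * (t * N11 t) - K11 * t"
definition syz12x :: 'a where "syz12x = 20 * f12x - K12 * x"
definition syz12y :: 'a where "syz12y = - (K12 * y)"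
definition syz12z :: 'a where "syz12z = 20 * f12z - K12 * z"

lemma D_syz:
  "D (syz9 x) (syz9 y) (syz9 z) F = 0" "D (syz11 x) (syz11 y) (syz11 z) F = 0" "D syz12x syz12y syz12z F = 0"
  using K9 K11 K12 D_euler unfolding D_def syz9_def syz11_def syz12x_def syz12y_def syz12z_def
  by Groebner_Basis.algebra+

lemma F_nz: "F \<noteq> 0" using F_neq_0 by auto

text \<open>Both fields kill \<open>F\<close>, hence so does their difference, which maps
  \<open>F\<close> to \<open>20 * g * F\<close>. This replaces every explicit computation with the
  cofactors.\<close>

lemma euler_coeff_eq_0:
  assumes "D (p + g * x) (q + g * y) (r + g * z) F = 0" "D p q r F = 0"
  shows "g = 0"
proof -
  have "20 * (g * F) = 0" using assms D_euler unfolding D_def by Groebner_Basis.algebra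
  moreover have "(20::'a) \<noteq> 0" using unit_numeral by (metis dvd_0_left zero_neq_one)
  ultimately show ?thesis using F_nz by simp
qed

lemma syz_relation:
  "x * syz12x = R12 * syz9 x - (y^2 + z^2) * syz11 x"
  "x * syz12y = R12 * syz9 y - (y^2 + z^2) * syz11 y"
  "x * syz12z = R12 * syz9 z - (y^2 + z^2) * syz11 z"
proof -
  \<comment> \<open>The Euler coefficient left over when \<open>relation12\<close> is rewritten in
    terms of the syzygies; both sides kill \<open>F\<close>, so it is 0.\<close>
  define g where "g = 20 * g12 + R12 * K9 - (y^2 + z^2) * K11 - x * K12"
  have 1: "x * syz12x = R12 * syz9 x - (y^2 + z^2) * syz11 x + g * x"
    "x * syz12y = R12 * syz9 y - (y^2 + z^2) * syz11 y + g * y"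
    "x * syz12z = R12 * syz9 z - (y^2 + z^2) * syz11 z + g * z"
    using relation12 unfolding g_def syz12x_def syz12y_def syz12z_def syz9_def syz11_def by Groebner_Basis.algebra+
  have "g = 0"
  proof (rule euler_coeff_eq_0)
    show "D (R12 * syz9 x - (y^2 + z^2) * syz11 x + g * x) (R12 * syz9 y - (y^2 + z^2) * syz11 y + g * y)
      (R12 * syz9 z - (y^2 + z^2) * syz11 z + g * z) F = 0"
      unfolding 1[symmetric] using D_syz(3) unfolding D_def by Groebner_Basis.algebra
    show "D (R12 * syz9 x - (y^2 + z^2) * syz11 x) (R12 * syz9 y - (y^2 + z^2) * syz11 y)
      (R12 * syz9 z - (y^2 + z^2) * syz11 z) F = 0"
      using D_syz(1,2) unfolding D_def by Groebner_Basis.algebra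
  qed
  with 1 show "x * syz12x = R12 * syz9 x - (y^2 + z^2) * syz11 x"
    "x * syz12y = R12 * syz9 y - (y^2 + z^2) * syz11 y"
    "x * syz12z = R12 * syz9 z - (y^2 + z^2) * syz11 z" by simp_all
qed

lemma syz_generate:
  assumes "D p q r F = 0"
  shows "\<exists>h k m. p = h * syz9 x + k * syz11 x + m * syz12x \<and> q = h * syz9 y + k * syz11 y + m * syz12y \<and>
    r = h * syz9 z + k * syz11 z + m * syz12z"
proof -
  have "tangent (klein_roots w) p q r" using assms by (simp add: tangent_iff_F_dvd)
  then obtain m g h k where *: "p = m * f12x + g * x + h * (x * N9 x) + k * (x * N11 x)"
     "q = g * y + h * (y * N9 y) + k * (y * N11 y)"
     "r = m * f12z + g * z + h * (z * N9 z) + k * (z * N11 z)"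
    using deletion_basis by blast
  obtain u where u: "20 * u = (1::'a)" using unit_numeral by (metis dvd_def)
  \<comment> \<open>All Euler contributions of the expansion, those of the cofactors included;
    \<open>u\<close> is the inverse of 20.\<close>
  define g' where "g' = g + u * (m * K12 + h * K9 + k * K11)"
  have 1: "p = u * h * syz9 x + u * k * syz11 x + u * m * syz12x + g' * x"
     "q = u * h * syz9 y + u * k * syz11 y + u * m * syz12y + g' * y"
     "r = u * h * syz9 z + u * k * syz11 z + u * m * syz12z + g' * z"
    using u unfolding * g'_def syz9_def syz11_def syz12x_def syz12y_def syz12z_def by Groebner_Basis.algebra+
  have "g' = 0"
  proof (rule euler_coeff_eq_0)
    show "D (u * h * syz9 x + u * k * syz11 x + u * m * syz12x + g' * x)
       (u * h * syz9 y + u * k * syz11 y + u * m * syz12y + g' * y)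
       (u * h * syz9 z + u * k * syz11 z + u * m * syz12z + g' * z) F = 0"
      using assms unfolding 1[symmetric] .
    show "D (u * h * syz9 x + u * k * syz11 x + u * m * syz12x)
       (u * h * syz9 y + u * k * syz11 y + u * m * syz12y)
       (u * h * syz9 z + u * k * syz11 z + u * m * syz12z) F = 0"
      using D_syz unfolding D_def by Groebner_Basis.algebra
  qed
  with 1 show ?thesis by auto
qed

text \<open>Subtracting multiples of the Euler row does not change a determinant that contains this
  row, so together with the Euler field the two syzygies have \<open>20 * 20\<close> times the
  nonzero determinant of \<open>saito_det\<close>.\<close>

lemma syz_independent:
  assumes "h * syz9 x + k * syz11 x = 0" "h * syz9 y + k * syz11 y = 0" "h * syz9 z + k * syz11 z = 0"
  shows "h = 0 \<and> k = 0"
proof -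
  let ?d = "det3 x y z (x * N9 x) (y * N9 y) (z * N9 z) (x * N11 x) (y * N11 y) (z * N11 z)"
  have "20 * 20 * ?d * h = 0" "20 * 20 * ?d * k = 0"
    using assms unfolding det3_def syz9_def syz11_def by Groebner_Basis.algebra+
  moreover have "?d \<noteq> 0"
  proof -
    have "7 * (1 + w) dvd 1 * 1" by (rule mult_dvd_mono[OF unit_numeral unit_w])
    then have "- (7 * (1 + w)) \<noteq> 0" by (metis dvd_0_left mult_1 neg_equal_0_iff_equal zero_neq_one)
    with F_neq_0 show ?thesis unfolding saito_det by (metis mult_eq_0_iff)
  qed
  moreover have "(20::'a) \<noteq> 0" using unit_numeral by (metis dvd_0_left zero_neq_one)
  ultimately show ?thesis by (metis mult_eq_0_iff)
qed

lemma not_x_dvd_sum_squares: "\<not> x dvd y^2 + z^2"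
proof
  assume "x dvd y^2 + z^2"
  obtain \<sigma> where "ring_substitution \<sigma> x" and \<sigma>: "\<sigma> w = w" "\<sigma> y = y" "\<sigma> z = z"
    using subst_x by blast
  interpret ring_substitution \<sigma> x by fact
  have "y^2 + z^2 = 0" using kernel[of "y^2 + z^2"] \<open>x dvd y^2 + z^2\<close> by (simp add: \<sigma>)
  then show False using not_dvd_sum_squares by (metis dvd_0_right)
qed

end

section \<open>The polynomial ring\<close>

definition const :: "complex \<Rightarrow> poly3" where
  "const c = Poly_Mapping.single 0 c"

lemma const_simps [simp]:
  "const 0 = 0" "const 1 = 1" "const (a + b) = const a + const b" "const (a * b) = const a * const b"
  "const (- a) = - const a" "const (a - b) = const a - const b"
  by (simp_all add: const_def single_add mult_single single_uminus single_diff)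

lemma const_numeral [simp]: "const (numeral n) = numeral n"
  by (simp add: const_def)

lemma const_of_nat [simp]: "const (of_nat n) = of_nat n"
  by (simp add: const_def)

lemma const_eq_0_iff [simp]: "const a = 0 \<longleftrightarrow> a = 0"
  by (metis const_def const_simps(1) lookup_single_eq)

lemma const_sum: "const (sum f A) = (\<Sum>a\<in>A. const (f a))"
  by (induction A rule: infinite_finite_induct) simp_all

lemma poly_sum_singles: "(\<Sum>m\<in>Poly_Mapping.keys p. Poly_Mapping.single m (Poly_Mapping.lookup p m)) = p"
proof (rule poly_mapping_eqI)
  fix k
  show "Poly_Mapping.lookup (\<Sum>m\<in>Poly_Mapping.keys p. Poly_Mapping.single m (Poly_Mapping.lookup p m)) k = Poly_Mapping.lookup p k"
    by (simp add: lookup_sum lookup_single when_def in_keys_iff sum.delta)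
qed

lemma poly_add_induct [case_names zero add]:
  fixes p :: "'a \<Rightarrow>\<^sub>0 'b::comm_monoid_add"
  assumes "P 0" "\<And>m c p. P p \<Longrightarrow> P (Poly_Mapping.single m c + p)"
  shows "P p"
proof -
  have "P (\<Sum>m\<in>A. Poly_Mapping.single m (Poly_Mapping.lookup p m))" if "finite A" for A
    using that by (induction A) (simp_all add: assms)
  from this[OF finite_keys[of p]] show ?thesis by (simp add: poly_sum_singles)
qed

lemma var_power: "var i ^ n = Poly_Mapping.single (Poly_Mapping.single i n) 1"
  by (induction n) (simp_all add: var_def mult_single single_add[symmetric])

lemma monomial_prod: "Poly_Mapping.single m c = const c * (\<Prod>i\<in>UNIV. var i ^ Poly_Mapping.lookup m i)"
proof -
  have "(\<Prod>i\<in>A. var i ^ Poly_Mapping.lookup m i) = Poly_Mapping.single (\<Sum>i\<in>A. Poly_Mapping.single i (Poly_Mapping.lookup m i)) 1"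
    if "finite A" for A
    using that by (induction A) (simp_all add: var_power mult_single)
  from this[of UNIV] have "(\<Prod>i\<in>UNIV. var i ^ Poly_Mapping.lookup m i) = Poly_Mapping.single (\<Sum>i\<in>UNIV. Poly_Mapping.single i (Poly_Mapping.lookup m i)) 1" by simp
  also have "(\<Sum>i\<in>UNIV. Poly_Mapping.single i (Poly_Mapping.lookup m i)) = m"
    by (rule poly_mapping_eqI) (simp add: lookup_sum lookup_single when_def)
  finally show ?thesis by (simp add: const_def mult_single)
qed

lemma poly3_induct [case_names const var add mult]:
  assumes const: "\<And>c. P (const c)" and var: "\<And>i. P (var i)"
    and add: "\<And>p q. P p \<Longrightarrow> P q \<Longrightarrow> P (p + q)" and mult: "\<And>p q. P p \<Longrightarrow> P q \<Longrightarrow> P (p * q)"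
  shows "P p"
proof (induction p rule: poly_add_induct)
  case zero
  show ?case using const[of 0] by simp
next
  case (add m c p)
  have 1: "P 1" using const[of 1] by simp
  then have pow: "P (var i ^ n)" for i n by (induction n) (simp_all add: var mult)
  have "P (\<Prod>i\<in>A. var i ^ Poly_Mapping.lookup m i)" if "finite A" for A
    using that by (induction A) (simp_all add: 1 mult pow)
  then have "P (Poly_Mapping.single m c)" by (simp add: monomial_prod mult const)
  with add show ?case using assms(3) by blast
qed

definition insertion :: "(3 \<Rightarrow> poly3) \<Rightarrow> poly3 \<Rightarrow> poly3" where
  "insertion h p = (\<Sum>m\<in>Poly_Mapping.keys p. const (Poly_Mapping.lookup p m) * (\<Prod>i\<in>UNIV. h i ^ Poly_Mapping.lookup m i))"

lemma insertion_superset: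
  assumes "finite A" "Poly_Mapping.keys p \<subseteq> A"
  shows "insertion h p = (\<Sum>m\<in>A. const (Poly_Mapping.lookup p m) * (\<Prod>i\<in>UNIV. h i ^ Poly_Mapping.lookup m i))"
  unfolding insertion_def using assms by (intro sum.mono_neutral_left) (auto simp: in_keys_iff)

lemma insertion_add: "insertion h (p + q) = insertion h p + insertion h q"
proof -
  let ?A = "Poly_Mapping.keys p \<union> Poly_Mapping.keys q"
  have "insertion h r = (\<Sum>m\<in>?A. const (Poly_Mapping.lookup r m) * (\<Prod>i\<in>UNIV. h i ^ Poly_Mapping.lookup m i))"
    if "r \<in> {p, q, p + q}" for r
    using that keys_add[of p q] by (intro insertion_superset) auto
  then show ?thesis by (simp add: lookup_add algebra_simps sum.distrib)
qed

lemma insertion_single: "insertion h (Poly_Mapping.single m c) = const c * (\<Prod>i\<in>UNIV. h i ^ Poly_Mapping.lookup m i)"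
  by (subst insertion_superset[of "{m}"]) auto

lemma insertion_0: "insertion h 0 = 0"
  by (simp add: insertion_def)

lemma insertion_mult: "insertion h (p * q) = insertion h p * insertion h q"
proof (induction p rule: poly_add_induct)
  case (add m c p)
  have "insertion h (Poly_Mapping.single m c * q) = insertion h (Poly_Mapping.single m c) * insertion h q"
  proof (induction q rule: poly_add_induct)
    case (add n d q)
    then show ?case
      by (simp add: distrib_left insertion_add mult_single insertion_single lookup_add power_add prod.distrib algebra_simps)
  qed (simp add: insertion_0)
  with add show ?case by (simp add: distrib_right insertion_add)
qed (simp add: insertion_0)

lemma insertion_const: "insertion h (const c) = const c"
  by (simp add: const_def insertion_single)

lemma insertion_var: "insertion h (var i) = h i"
proof -
  have "(\<Prod>j\<in>UNIV. h j ^ (Poly_Mapping.lookup (Poly_Mapping.single i (1::nat)) j)) = (\<Prod>j\<in>UNIV. if j = i then h j else 1)"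
    by (intro prod.cong refl) (simp add: lookup_single when_def)
  then show ?thesis by (simp add: var_def insertion_single)
qed

lemma partial_superset:
  assumes "finite A" "Poly_Mapping.keys p \<subseteq> A"
  shows "partial i p = (\<Sum>m\<in>A. Poly_Mapping.single (m - Poly_Mapping.single i 1) (of_nat (Poly_Mapping.lookup m i) * Poly_Mapping.lookup p m))"
  unfolding partial_def using assms by (intro sum.mono_neutral_left) (auto simp: in_keys_iff)

lemma partial_add: "partial i (p + q) = partial i p + partial i q"
proof -
  let ?A = "Poly_Mapping.keys p \<union> Poly_Mapping.keys q"
  have "partial i r = (\<Sum>m\<in>?A. Poly_Mapping.single (m - Poly_Mapping.single i 1) (of_nat (Poly_Mapping.lookup m i) * Poly_Mapping.lookup r m))"
    if "r \<in> {p, q, p + q}" for r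
    using that keys_add[of p q] by (intro partial_superset) auto
  then show ?thesis by (simp add: lookup_add algebra_simps sum.distrib single_add)
qed

lemma partial_single:
  "partial i (Poly_Mapping.single m c) = Poly_Mapping.single (m - Poly_Mapping.single i 1) (of_nat (Poly_Mapping.lookup m i) * c)"
  by (subst partial_superset[of "{m}"]) auto

lemma partial_0: "partial i 0 = 0"
  by (simp add: partial_def)

lemma partial_mult: "partial i (p * q) = p * partial i q + q * partial i p"
proof (induction p rule: poly_add_induct)
  case (add m c p)
  let ?e = "Poly_Mapping.single i (1::nat)"
  have shift: "m + (n - ?e) = m + n - ?e" if "Poly_Mapping.lookup n i \<noteq> 0" for m n :: monom3
    using that by (intro poly_mapping_eqI) (auto simp: lookup_add lookup_minus lookup_single when_def)
  \<comment> \<open>Where \<open>shift\<close> fails because the subtraction of exponents truncates,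
    the coefficient is 0 on both sides.\<close>
  have shift': "Poly_Mapping.single (m + (n - ?e)) (of_nat (Poly_Mapping.lookup n i) * a)
     = Poly_Mapping.single (m + n - ?e) (of_nat (Poly_Mapping.lookup n i) * a)" for m n and a :: complex
    using shift[of n m] by (cases "Poly_Mapping.lookup n i = 0") auto
  have "partial i (Poly_Mapping.single m c * q) = Poly_Mapping.single m c * partial i q + q * partial i (Poly_Mapping.single m c)"
  proof (induction q rule: poly_add_induct)
    case (add n d q)
    have "partial i (Poly_Mapping.single m c * Poly_Mapping.single n d) =
      Poly_Mapping.single (m + n - ?e) (of_nat (Poly_Mapping.lookup n i) * (c * d))
      + Poly_Mapping.single (n + m - ?e) (of_nat (Poly_Mapping.lookup m i) * (c * d))"
      by (simp add: mult_single partial_single lookup_add single_add[symmetric] algebra_simps)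
    also have "\<dots> = Poly_Mapping.single m c * partial i (Poly_Mapping.single n d) + Poly_Mapping.single n d * partial i (Poly_Mapping.single m c)"
      unfolding shift'[symmetric] by (simp add: mult_single partial_single algebra_simps)
    finally show ?case using add by (simp add: distrib_left partial_add algebra_simps)
  qed (simp add: partial_0)
  with add show ?case by (simp add: distrib_right distrib_left partial_add algebra_simps)
qed (simp add: partial_0)

lemma partial_const [simp]: "partial i (const c) = 0"
  by (simp add: const_def partial_single)

lemma partial_var: "partial i (var j) = (if i = j then 1 else 0)"
  by (auto simp: var_def partial_single lookup_single when_def)

lemma partial_sum: "partial i (sum f A) = (\<Sum>a\<in>A. partial i (f a))"
  by (induction A rule: infinite_finite_induct) (simp_all add: partial_0 partial_add)

lemma linear_form_const: "linear_form a = (\<Sum>i\<in>UNIV. const (a $ i) * var i)"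
  by (simp add: linear_form_def const_def)

lemma partial_linear_form: "partial i (linear_form a) = const (a $ i)"
proof -
  have "partial i (linear_form a) = (\<Sum>j\<in>UNIV. if j = i then const (a $ j) else 0)"
    unfolding linear_form_const partial_sum by (intro sum.cong refl) (simp add: partial_mult partial_var)
  then show ?thesis by simp
qed

lemma linear_form_eq_0_iff: "linear_form a = 0 \<longleftrightarrow> a = 0"
proof
  assume "linear_form a = 0"
  then have "const (a $ i) = 0" for i using partial_linear_form[of i a] by (simp add: partial_0)
  then show "a = 0" by (simp add: vec_eq_iff)
qed (simp add: linear_form_const)

lemma linear_form_simps:
  "linear_form (a + b) = linear_form a + linear_form b" "linear_form (c *s a) = const c * linear_form a"
  "linear_form (a - b) = linear_form a - linear_form b"
  by (simp_all add: linear_form_const algebra_simps sum.distrib sum_distrib_left sum_subtractf)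

section \<open>Restriction of polynomials to a line\<close>

definition dot3 :: "complex ^ 3 \<Rightarrow> complex ^ 3 \<Rightarrow> complex" where
  "dot3 a v = (\<Sum>i\<in>UNIV. a $ i * v $ i)"

text \<open>For \<open>dot3 a v = 1\<close> this is the pullback along the linear projection with
  direction \<open>v\<close> onto the plane \<open>a = 0\<close>. It changes a polynomial only by a
  multiple of \<open>linear_form a\<close> and kills that form, so its kernel is the ideal generated
  by it.\<close>

definition line_subst :: "complex ^ 3 \<Rightarrow> complex ^ 3 \<Rightarrow> poly3 \<Rightarrow> poly3" where
  "line_subst a v = insertion (\<lambda>i. var i - const (v $ i) * linear_form a)"

lemma line_subst_const [simp]: "line_subst a v (const c) = const c"
  by (simp add: line_subst_def insertion_const)

lemma insertion_sum: "insertion h (sum f A) = (\<Sum>a\<in>A. insertion h (f a))"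
  by (induction A rule: infinite_finite_induct) (simp_all add: insertion_0 insertion_add)

lemma line_subst_linear_form: "line_subst a v (linear_form b) = linear_form b - const (dot3 b v) * linear_form a"
proof -
  have "const (dot3 b v) = (\<Sum>i\<in>UNIV. const (b $ i) * const (v $ i))"
    unfolding dot3_def const_sum by simp
  then show ?thesis
    unfolding line_subst_def linear_form_const[of b] insertion_sum insertion_mult insertion_const insertion_var
    by (simp add: algebra_simps sum_subtractf sum_distrib_left)
qed

lemma dvd_line_subst: "linear_form a dvd p - line_subst a v p"
proof (induction p rule: poly3_induct)
  case (const c)
  show ?case by simp
next
  case (var i)
  show ?case by (simp add: line_subst_def insertion_var)
next
  case (add p q)
  have "p + q - line_subst a v (p + q) = (p - line_subst a v p) + (q - line_subst a v q)"
    by (simp add: line_subst_def insertion_add)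
  then show ?case using add by (metis dvd_add)
next
  case (mult p q)
  have "p * q - line_subst a v (p * q) = p * (q - line_subst a v q) + line_subst a v q * (p - line_subst a v p)"
    by (simp add: line_subst_def insertion_mult algebra_simps)
  then show ?case using mult by (metis dvd_add dvd_mult)
qed

lemma ring_substitution_line_subst:
  assumes "dot3 a v = 1"
  shows "ring_substitution (line_subst a v) (linear_form a)"
proof -
  have 0: "line_subst a v (linear_form a) = 0" by (simp add: line_subst_linear_form assms)
  have mult: "line_subst a v (p * q) = line_subst a v p * line_subst a v q" for p q
    by (simp add: line_subst_def insertion_mult)
  show ?thesis
  proof
    show "line_subst a v (p + q) = line_subst a v p + line_subst a v q" for p q
      by (simp add: line_subst_def insertion_add)
    show "line_subst a v 1 = 1" using line_subst_const[of a v 1] by simp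
    show "line_subst a v p = 0 \<longleftrightarrow> linear_form a dvd p" for p
      using dvd_line_subst[of a p v] by (auto simp: mult 0)
  qed (fact mult)
qed

lemma line_subst_idem:
  assumes "dot3 a v = 1"
  shows "line_subst a v (line_subst a v p) = line_subst a v p"
proof -
  interpret ring_substitution "line_subst a v" "linear_form a" using assms by (rule ring_substitution_line_subst)
  show ?thesis using dvd_line_subst[of a p v] by (simp flip: kernel)
qed

lemma dot3_ex:
  assumes "a \<noteq> 0"
  shows "\<exists>v. dot3 a v = 1"
proof -
  from assms obtain k where k: "a $ k \<noteq> 0" by (auto simp: vec_eq_iff)
  have "dot3 a (axis k (1 / a $ k)) = (\<Sum>i\<in>UNIV. if i = k then 1 else 0)"
    unfolding dot3_def axis_def by (intro sum.cong refl) (simp add: k)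
  then show ?thesis by (intro exI[of _ "axis k (1 / a $ k)"]) simp
qed

lemma linear_form_dvd:
  assumes "a \<noteq> 0" "linear_form a dvd linear_form b"
  obtains c where "b = c *s a"
proof -
  obtain v where "dot3 a v = 1" using dot3_ex[OF assms(1)] by blast
  then interpret ring_substitution "line_subst a v" "linear_form a" by (rule ring_substitution_line_subst)
  have "linear_form (b - dot3 b v *s a) = 0"
    using assms(2) by (simp add: linear_form_simps line_subst_linear_form flip: kernel)
  then show thesis using that[of "dot3 b v"] by (simp add: linear_form_eq_0_iff)
qed

section \<open>Homogeneous polynomials and ideals\<close>

lemma mon_degree_add: "mon_degree (m + n) = mon_degree m + mon_degree n"
  by (simp add: mon_degree_def lookup_add sum.distrib)

lemma homogeneous_0 [simp]: "homogeneous k 0"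
  by (simp add: homogeneous_def)

lemma homogeneous_single: "int (mon_degree m) = k \<Longrightarrow> homogeneous k (Poly_Mapping.single m c)"
  by (simp add: homogeneous_def)

lemma homogeneous_const [simp]: "homogeneous 0 (const c)"
  unfolding const_def by (rule homogeneous_single) (simp add: mon_degree_def)

lemma homogeneous_add: "homogeneous k p \<Longrightarrow> homogeneous k q \<Longrightarrow> homogeneous k (p + q)"
  using keys_add[of p q] unfolding homogeneous_def by blast

lemma homogeneous_sum: "(\<And>a. a \<in> A \<Longrightarrow> homogeneous k (f a)) \<Longrightarrow> homogeneous k (sum f A)"
  by (induction A rule: infinite_finite_induct) (simp_all add: homogeneous_add)

lemma homogeneous_mult: "homogeneous k p \<Longrightarrow> homogeneous l q \<Longrightarrow> homogeneous (k + l) (p * q)"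
  using keys_mult[of p q] unfolding homogeneous_def by (fastforce simp: mon_degree_add)

lemma homogeneous_var: "homogeneous 1 (var i)"
  unfolding var_def by (rule homogeneous_single) (simp add: mon_degree_def lookup_single when_def)

lemma homogeneous_const_mult: "homogeneous k p \<Longrightarrow> homogeneous k (const c * p)"
  using homogeneous_mult[OF homogeneous_const, of k p c] by simp

lemma homogeneous_linear_form: "homogeneous 1 (linear_form a)"
  unfolding linear_form_const by (intro homogeneous_sum homogeneous_const_mult homogeneous_var)

lemma homogeneous_partial:
  assumes "homogeneous k p"
  shows "homogeneous (k - 1) (partial i p)"
  unfolding partial_def
proof (rule homogeneous_sum)
  fix m assume m: "m \<in> Poly_Mapping.keys p"
  show "homogeneous (k - 1) (Poly_Mapping.single (m - Poly_Mapping.single i 1)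
    (of_nat (Poly_Mapping.lookup m i) * Poly_Mapping.lookup p m))"
  proof (cases "Poly_Mapping.lookup m i = 0")
    case False
    have "m - Poly_Mapping.single i 1 + Poly_Mapping.single i 1 = m"
      using False by (intro poly_mapping_eqI) (auto simp: lookup_add lookup_minus lookup_single when_def)
    then have "mon_degree m = mon_degree (m - Poly_Mapping.single i 1) + mon_degree (Poly_Mapping.single i 1)"
      by (metis mon_degree_add)
    also have "mon_degree (Poly_Mapping.single i 1) = 1" by (simp add: mon_degree_def lookup_single when_def)
    finally show ?thesis using assms m by (intro homogeneous_single) (auto simp: homogeneous_def)
  qed simp
qed

text \<open>A polynomial is homogeneous of degree \<open>k\<close> if doubling the variables multiplies it by \<open>2\<^sup>k\<close>.\<close>

definition double :: "poly3 \<Rightarrow> poly3" where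
  "double = insertion (\<lambda>i. 2 * var i)"

lemma double_simps [simp]:
  "double (p + q) = double p + double q" "double (p * q) = double p * double q" "double (const c) = const c"
  "double (var i) = 2 * var i"
  by (simp_all add: double_def insertion_add insertion_mult insertion_const insertion_var)

lemma double_simps' [simp]:
  "double 0 = 0" "double 1 = 1" "double (- p) = - double p" "double (p - q) = double p - double q"
  "double (p ^ n) = double p ^ n" "double (numeral k) = numeral k"
proof -
  show 0: "double 0 = 0" and 1: "double 1 = 1" and "double (numeral k) = numeral k"
    using double_simps(3)[of 0] double_simps(3)[of 1] double_simps(3)[of "numeral k"] by simp_all
  show 2: "double (- p) = - double p" for p using double_simps(1)[of p "- p"] 0
    by (simp add: eq_neg_iff_add_eq_0 add.commute del: double_simps(1))
  show "double (p - q) = double p - double q" using double_simps(1)[of p "- q"] 2[of q] by simp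
  show "double (p ^ n) = double p ^ n" by (induction n) (simp_all add: 1)
qed

lemma lookup_const_mult: "Poly_Mapping.lookup (const c * p) m = c * Poly_Mapping.lookup p m"
  unfolding const_def mult_map_scale_conv_mult[symmetric] by (simp add: Poly_Mapping.map.rep_eq when_def)

lemma lookup_double: "Poly_Mapping.lookup (double p) m = 2 ^ mon_degree m * Poly_Mapping.lookup p m"
proof (induction p rule: poly_add_induct)
  case (add n c p)
  have "double (Poly_Mapping.single n c) = const (2 ^ mon_degree n) * Poly_Mapping.single n c"
  proof -
    have 2: "2 ^ k = const (2 ^ k)" for k by (induction k) simp_all
    have "double (Poly_Mapping.single n c) = const c * (\<Prod>i\<in>UNIV. 2 ^ Poly_Mapping.lookup n i * var i ^ Poly_Mapping.lookup n i)"
      by (simp add: double_def insertion_single power_mult_distrib)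
    also have "\<dots> = const c * (2 ^ mon_degree n * (\<Prod>i\<in>UNIV. var i ^ Poly_Mapping.lookup n i))"
      unfolding mon_degree_def power_sum prod.distrib ..
    also have "\<dots> = const (2 ^ mon_degree n) * Poly_Mapping.single n c"
      unfolding monomial_prod[of n c] 2 by (rule mult.left_commute)
    finally show ?thesis .
  qed
  then have "Poly_Mapping.lookup (double (Poly_Mapping.single n c)) m = 2 ^ mon_degree m * Poly_Mapping.lookup (Poly_Mapping.single n c) m"
    by (simp add: lookup_const_mult lookup_single when_def)
  with add show ?case by (simp add: lookup_add algebra_simps)
qed simp

text \<open>Doubling multiplies the coefficient of a monomial by 2 to its degree, and the powers of
  2 are distinct, so one scalar detects the degree. Degrees of long expressions thus become ring
  identities.\<close>

lemma homogeneous_iff_double: "homogeneous (int k) p \<longleftrightarrow> double p = 2 ^ k * p"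
proof -
  have "2 ^ k = const (2 ^ k)" by (induction k) simp_all
  then have "double p = 2 ^ k * p \<longleftrightarrow> (\<forall>m. 2 ^ mon_degree m * Poly_Mapping.lookup p m = 2 ^ k * Poly_Mapping.lookup p m)"
    by (metis lookup_const_mult lookup_double poly_mapping_eqI)
  also have "\<dots> \<longleftrightarrow> (\<forall>m. Poly_Mapping.lookup p m \<noteq> 0 \<longrightarrow> (2::complex) ^ mon_degree m = 2 ^ k)" by auto
  also have "\<dots> \<longleftrightarrow> (\<forall>m. Poly_Mapping.lookup p m \<noteq> 0 \<longrightarrow> mon_degree m = k)"
  proof -
    have "(2::complex) ^ a = 2 ^ b \<longleftrightarrow> a = b" for a b
    proof -
      have "(2::complex) ^ a = 2 ^ b \<longleftrightarrow> (2::nat) ^ a = 2 ^ b"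
        by (metis of_nat_eq_iff of_nat_numeral of_nat_power)
      then show ?thesis by simp
    qed
    then show ?thesis by simp
  qed
  finally show ?thesis unfolding homogeneous_def by (metis in_keys_iff of_nat_eq_iff)
qed

text \<open>Doubling is multiplicative, so the equation for \<open>p\<close> can be cancelled from
  the equation for \<open>p * q\<close>.\<close>

lemma homogeneous_factor:
  assumes "homogeneous (int a) p" "homogeneous (int (a + b)) (p * q)" "p \<noteq> 0"
  shows "homogeneous (int b) q"
proof -
  have "2 ^ a * p * double q = 2 ^ a * p * (2 ^ b * q)"
    using assms(1,2) unfolding homogeneous_iff_double double_simps(2) by (simp add: power_add mult_ac)
  then show ?thesis using assms(3) unfolding homogeneous_iff_double
    by (metis mult_eq_0_iff mult_left_cancel power_not_zero zero_neq_numeral)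
qed

lemma S_ring_simps [simp]:
  "carrier S_ring = UNIV" "a \<oplus>\<^bsub>S_ring\<^esub> b = a + b" "a \<otimes>\<^bsub>S_ring\<^esub> b = a * b" "\<zero>\<^bsub>S_ring\<^esub> = 0" "\<one>\<^bsub>S_ring\<^esub> = 1"
  by (simp_all add: ring_of_type_algebra_def)

lemma ideal_S_ring:
  "ideal I S_ring \<longleftrightarrow> 0 \<in> I \<and> (\<forall>a\<in>I. \<forall>b\<in>I. a + b \<in> I) \<and> (\<forall>a\<in>I. \<forall>p. p * a \<in> I)"
proof
  assume "ideal I S_ring"
  then interpret ideal I S_ring .
  show "0 \<in> I \<and> (\<forall>a\<in>I. \<forall>b\<in>I. a + b \<in> I) \<and> (\<forall>a\<in>I. \<forall>p. p * a \<in> I)"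
    using additive_subgroup.zero_closed[OF additive_subgroup_axioms] additive_subgroup.a_closed[OF additive_subgroup_axioms] I_l_closed
    unfolding S_ring_simps by (intro conjI ballI allI) simp_all
next
  assume I: "0 \<in> I \<and> (\<forall>a\<in>I. \<forall>b\<in>I. a + b \<in> I) \<and> (\<forall>a\<in>I. \<forall>p. p * a \<in> I)"
  interpret cring "S_ring" by (rule cring_from_type_algebra)
  have "\<ominus>\<^bsub>S_ring\<^esub> a = (- 1) * a" for a :: poly3
    by (rule minus_equality) simp_all
  moreover have "inv\<^bsub>add_monoid S_ring\<^esub> a = \<ominus>\<^bsub>S_ring\<^esub> a" for a :: poly3 by (simp add: a_inv_def)
  ultimately have inv: "inv\<^bsub>add_monoid S_ring\<^esub> a = (- 1) * a" for a :: poly3 by metis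
  show "ideal I S_ring"
  proof (rule idealI)
    show "ring (S_ring :: poly3 ring)" by (rule ring_axioms)
    show "subgroup I (add_monoid S_ring)"
    proof
      show "inv\<^bsub>add_monoid S_ring\<^esub> a \<in> I" if "a \<in> I" for a using I that unfolding inv by blast
    qed (use I in simp_all)
    show "a \<in> I \<Longrightarrow> x \<in> carrier S_ring \<Longrightarrow> x \<otimes>\<^bsub>S_ring\<^esub> a \<in> I" for a x using I by simp
    show "a \<in> I \<Longrightarrow> x \<in> carrier S_ring \<Longrightarrow> a \<otimes>\<^bsub>S_ring\<^esub> x \<in> I" for a x using I by (simp add: mult.commute)
  qed
qed

lemma ideal_sum: "ideal I S_ring \<Longrightarrow> (\<And>a. a \<in> A \<Longrightarrow> f a \<in> I) \<Longrightarrow> sum f A \<in> I"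
  unfolding ideal_S_ring by (induction A rule: infinite_finite_induct) simp_all

lemma ideal_genideal: "ideal (genideal S_ring A) (S_ring :: poly3 ring)"
  by (rule ring.genideal_ideal) (simp_all add: ring_from_type_algebra)

lemma genideal_superset: "A \<subseteq> genideal (S_ring :: poly3 ring) A"
  by (rule ring.genideal_self) (simp_all add: ring_from_type_algebra)

lemma jacobian_ideal_iff: "p \<in> jacobian_ideal f \<longleftrightarrow> (\<exists>g. p = (\<Sum>i\<in>UNIV. g i * partial i f))"
proof
  define I where "I = {p. \<exists>g. p = (\<Sum>i\<in>UNIV. g i * partial i f)}"
  have mem: "(\<Sum>i\<in>UNIV. g i * partial i f) \<in> I" for g unfolding I_def by blast
  have "ideal I S_ring"
    unfolding ideal_S_ring
  proof (intro conjI ballI allI)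
    show "0 \<in> I" using mem[of "\<lambda>_. 0"] by simp
    fix a assume "a \<in> I"
    then obtain g where g: "a = (\<Sum>i\<in>UNIV. g i * partial i f)" unfolding I_def by blast
    show "p * a \<in> I" for p using mem[of "\<lambda>i. p * g i"] by (simp add: g sum_distrib_left mult.assoc)
    fix b assume "b \<in> I"
    then obtain h where h: "b = (\<Sum>i\<in>UNIV. h i * partial i f)" unfolding I_def by blast
    show "a + b \<in> I" using mem[of "\<lambda>i. g i + h i"] by (simp add: g h sum.distrib distrib_right)
  qed
  moreover have "partial j f \<in> I" for j
    using mem[of "\<lambda>i. if i = j then 1 else 0"] by (simp add: if_distrib[of "\<lambda>a. a * _"] cong: if_cong)
  ultimately have "jacobian_ideal f \<subseteq> I" unfolding jacobian_ideal_def
    by (intro ring.genideal_minimal) (auto simp: ring_from_type_algebra)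
  then show "p \<in> jacobian_ideal f \<Longrightarrow> \<exists>g. p = (\<Sum>i\<in>UNIV. g i * partial i f)" unfolding I_def by blast
next
  assume "\<exists>g. p = (\<Sum>i\<in>UNIV. g i * partial i f)"
  then obtain g where g: "p = (\<Sum>i\<in>UNIV. g i * partial i f)" ..
  have "ideal (jacobian_ideal f) S_ring" unfolding jacobian_ideal_def by (rule ideal_genideal)
  moreover have "partial i f \<in> jacobian_ideal f" for i
    unfolding jacobian_ideal_def by (rule subsetD[OF genideal_superset]) simp
  ultimately show "p \<in> jacobian_ideal f"
    unfolding g by (intro ideal_sum) (simp_all add: ideal_S_ring)
qed

lemma homogeneous_irrelevant:
  assumes "homogeneous k p" "1 \<le> k"
  shows "p \<in> irrelevant_ideal"
proof -
  have I: "ideal irrelevant_ideal S_ring" unfolding irrelevant_ideal_def by (rule ideal_genideal)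
  have "Poly_Mapping.single m c \<in> irrelevant_ideal" if "mon_degree m \<noteq> 0" for m c
  proof -
    have "\<exists>i. Poly_Mapping.lookup m i \<noteq> 0"
    proof (rule ccontr)
      assume "\<nexists>i. Poly_Mapping.lookup m i \<noteq> 0"
      then have "mon_degree m = 0" by (simp add: mon_degree_def)
      with that show False by simp
    qed
    then obtain i where i: "Poly_Mapping.lookup m i \<noteq> 0" ..
    have "m - Poly_Mapping.single i 1 + Poly_Mapping.single i 1 = m"
      using i by (intro poly_mapping_eqI) (auto simp: lookup_add lookup_minus lookup_single when_def)
    then have "Poly_Mapping.single m c = Poly_Mapping.single (m - Poly_Mapping.single i 1) c * var i"
      by (simp add: var_def mult_single)
    moreover have "var i \<in> irrelevant_ideal" unfolding irrelevant_ideal_def by (rule subsetD[OF genideal_superset]) simp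
    ultimately show ?thesis using I unfolding ideal_S_ring by metis
  qed
  moreover have "mon_degree m \<noteq> 0" if "m \<in> Poly_Mapping.keys p" for m
    using assms that unfolding homogeneous_def by fastforce
  ultimately have "(\<Sum>m\<in>Poly_Mapping.keys p. Poly_Mapping.single m (Poly_Mapping.lookup p m)) \<in> irrelevant_ideal"
    by (intro ideal_sum[OF I]) blast
  then show ?thesis by (simp add: poly_sum_singles)
qed

lemma milnor_projection_eq_zero:
  "milnor_projection f v = \<zero>\<^bsub>milnor_algebra f\<^esub> \<longleftrightarrow> v 0 \<in> jacobian_ideal f"
proof -
  have I: "0 \<in> jacobian_ideal f" "\<And>a b. a \<in> jacobian_ideal f \<Longrightarrow> b \<in> jacobian_ideal f \<Longrightarrow> a + b \<in> jacobian_ideal f"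
    "\<And>a p. a \<in> jacobian_ideal f \<Longrightarrow> p * a \<in> jacobian_ideal f"
    using ideal_genideal[of "range (\<lambda>i. partial i f)"] unfolding jacobian_ideal_def ideal_S_ring by blast+
  have "milnor_projection f v = (\<lambda>a. a + v 0) ` jacobian_ideal f"
    by (auto simp: milnor_projection_def a_r_coset_def' image_def)
  moreover have "(\<lambda>a. a + v 0) ` jacobian_ideal f = jacobian_ideal f \<longleftrightarrow> v 0 \<in> jacobian_ideal f"
  proof
    assume "(\<lambda>a. a + v 0) ` jacobian_ideal f = jacobian_ideal f"
    then show "v 0 \<in> jacobian_ideal f" using I(1) by (metis add_0 imageI)
  next
    assume v: "v 0 \<in> jacobian_ideal f"
    have "a - v 0 \<in> jacobian_ideal f" if "a \<in> jacobian_ideal f" for a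
      using I(2)[OF that I(3)[OF v, of "-1"]] by simp
    then have "a \<in> (\<lambda>a. a + v 0) ` jacobian_ideal f" if "a \<in> jacobian_ideal f" for a
      using that by (intro image_eqI[of _ _ "a - v 0"]) simp_all
    then show "(\<lambda>a. a + v 0) ` jacobian_ideal f = jacobian_ideal f" using I(2) v by blast
  qed
  ultimately show ?thesis by (simp add: milnor_algebra_def FactRing_def)
qed

lemma milnor_projection_surj: "milnor_projection f ` free_module [0] = carrier (milnor_algebra f)"
proof -
  have "\<exists>v\<in>free_module [0]. v 0 = a" for a
    by (intro bexI[of _ "\<lambda>i. if i = 0 then a else 0"]) (auto simp: free_module_def)
  then show ?thesis
    unfolding milnor_algebra_def FactRing_def A_RCOSETS_def' milnor_projection_def
    by (simp add: set_eq_iff image_iff) metis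
qed

section \<open>Resolutions of length three\<close>

definition matrix_map :: "nat \<Rightarrow> nat \<Rightarrow> (nat \<Rightarrow> nat \<Rightarrow> poly3) \<Rightarrow> (nat \<Rightarrow> poly3) \<Rightarrow> nat \<Rightarrow> poly3" where
  "matrix_map n m M v = (\<lambda>i. if i < m then \<Sum>j<n. v j * M j i else 0)"

lemma graded_hom_matrix_map:
  assumes "\<And>i j. j < length ks \<Longrightarrow> i < length ls \<Longrightarrow> homogeneous (ls ! i - ks ! j) (M j i)"
  shows "graded_hom ks ls (matrix_map (length ks) (length ls) M)"
  unfolding graded_hom_def
proof (intro conjI ballI allI)
  show "matrix_map (length ks) (length ls) M \<in> free_module ks \<rightarrow> free_module ls"
    by (auto simp: matrix_map_def free_module_def)
next
  fix v w
  show "matrix_map (length ks) (length ls) M (\<lambda>i. v i + w i) =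
    (\<lambda>i. matrix_map (length ks) (length ls) M v i + matrix_map (length ks) (length ls) M w i)"
    by (auto simp: matrix_map_def distrib_right sum.distrib)
next
  fix p v
  show "matrix_map (length ks) (length ls) M (\<lambda>i. p * v i) = (\<lambda>i. p * matrix_map (length ks) (length ls) M v i)"
    by (auto simp: matrix_map_def sum_distrib_left mult.assoc)
next
  fix t
  show "matrix_map (length ks) (length ls) M ` graded_part ks t \<subseteq> graded_part ls t"
  proof (rule image_subsetI)
    fix v assume "v \<in> graded_part ks t"
    then have v: "homogeneous (ks ! j + t) (v j)" if "j < length ks" for j
      using that by (simp add: graded_part_def)
    have "homogeneous (ls ! i + t) (v j * M j i)" if "j < length ks" "i < length ls" for i j
      using homogeneous_mult[OF v[OF that(1)] assms[OF that]] by (simp add: algebra_simps)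
    then have "homogeneous (ls ! i + t) (\<Sum>j<length ks. v j * M j i)" if "i < length ls" for i
      using that by (intro homogeneous_sum) simp
    then show "matrix_map (length ks) (length ls) M v \<in> graded_part ls t"
      by (simp add: graded_part_def free_module_def matrix_map_def)
  qed
qed

lemma minimal_map_matrix_map:
  assumes "\<And>i j. j < n \<Longrightarrow> i < m \<Longrightarrow> \<exists>k\<ge>1. homogeneous k (M j i)"
  shows "minimal_map ks (matrix_map n m M)"
proof -
  have I: "ideal irrelevant_ideal S_ring" unfolding irrelevant_ideal_def by (rule ideal_genideal)
  have M: "M j i \<in> irrelevant_ideal" if "j < n" "i < m" for i j
    using assms[OF that] homogeneous_irrelevant by blast
  have "(\<Sum>j<n. v j * M j i) \<in> irrelevant_ideal" if "i < m" for v i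
    using I M[OF _ that] by (intro ideal_sum[OF I]) (simp add: ideal_S_ring)
  moreover have "0 \<in> irrelevant_ideal" using I by (simp add: ideal_S_ring)
  ultimately show ?thesis by (simp add: minimal_map_def matrix_map_def)
qed

text \<open>The elements of the type \<open>3\<close> are listed as 1, 2, 3 by \<open>sum_3\<close>
  and \<open>exhaust_3\<close>, with \<open>3 = 0\<close>. The shift by one sends the positions 0,
  1, 2 to them in this order.\<close>

abbreviation coord :: "nat \<Rightarrow> 3" where
  "coord i \<equiv> of_nat (Suc i)"

lemma sum_coord: "(\<Sum>i<3. f (coord i)) = (\<Sum>i\<in>UNIV. f i)"
proof -
  have "{..<3} = {0, 1, 2 :: nat}" by auto
  then show ?thesis by (simp add: sum_3 add.assoc)
qed

text \<open>Isolates the algebraic content: generators \<open>s\<close> of the syzygies of the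
  partial derivatives and one relation \<open>q\<close> of which every relation is a multiple.
  \<open>q 2 \<noteq> 0\<close> makes the last map injective. Minimality holds because all matrix
  entries have positive degree; for the partial derivatives this is
  \<open>2 \<le> d\<close>.\<close>

lemma minimal_resolution:
  fixes f :: poly3 and s :: "nat \<Rightarrow> 3 \<Rightarrow> poly3" and q :: "nat \<Rightarrow> poly3" and d :: nat and ds :: "nat list" and e :: int
  assumes f: "homogeneous (int d) f" "2 \<le> d"
    and ds: "length ds = 3" "\<And>j. j < 3 \<Longrightarrow> 1 \<le> ds ! j"
    and s: "\<And>i j. j < 3 \<Longrightarrow> homogeneous (int (ds ! j)) (s j i)"
    and q: "\<And>j. j < 3 \<Longrightarrow> homogeneous (e + 1 - int d - int (ds ! j)) (q j)"
      "\<And>j. j < 3 \<Longrightarrow> 1 \<le> e + 1 - int d - int (ds ! j)"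
    and kill: "\<And>j. j < 3 \<Longrightarrow> (\<Sum>i\<in>UNIV. s j i * partial i f) = 0"
    and generate: "\<And>g. (\<Sum>i\<in>UNIV. g i * partial i f) = 0 \<Longrightarrow> \<exists>v. \<forall>i. g i = (\<Sum>j<3. v j * s j i)"
    and relation: "\<And>i. (\<Sum>j<3. q j * s j i) = 0"
    and relations: "\<And>v. (\<And>i. (\<Sum>j<3. v j * s j i) = 0) \<Longrightarrow> \<exists>c. \<forall>j<3. v j = c * q j"
    and q2: "q 2 \<noteq> 0"
  shows "has_minimal_graded_free_resolution f [- e] (map (\<lambda>a. 1 - int d - int a) ds) (replicate 3 (1 - int d))"
proof -
  let ?F2 = "map (\<lambda>a. 1 - int d - int a) ds" and ?F1 = "replicate 3 (1 - int d)"
  define \<phi>1 where "\<phi>1 = matrix_map 3 1 (\<lambda>j i. partial (coord j) f)"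
  define \<phi>2 where "\<phi>2 = matrix_map 3 3 (\<lambda>j i. s j (coord i))"
  define \<phi>3 where "\<phi>3 = matrix_map 1 3 (\<lambda>j i. q i)"
  have partial: "homogeneous (int d - 1) (partial i f)" for i
    using f(1) by (rule homogeneous_partial)
  have surj: "\<exists>n<3. i = coord n" for i :: 3
  proof -
    have "i = coord 0 \<or> i = coord 1 \<or> i = coord 2" using exhaust_3[of i] by simp
    moreover have "(0::nat) < 3" "(1::nat) < 3" "(2::nat) < 3" by simp_all
    ultimately show ?thesis by blast
  qed
  have F3: "free_module [- e] = {v. \<forall>i\<ge>1. v i = 0}" and F2: "free_module ?F2 = {v. \<forall>i\<ge>3. v i = 0}"
    and F1: "free_module ?F1 = {v. \<forall>i\<ge>3. v i = 0}" and F0: "free_module [0] = {v. \<forall>i\<ge>1. v i = 0}"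
    using ds by (simp_all add: free_module_def)
  have hom3: "graded_hom [- e] ?F2 \<phi>3"
    using graded_hom_matrix_map[of "[- e]" ?F2 "\<lambda>j i. q i"] q(1) ds(1) by (simp add: \<phi>3_def algebra_simps)
  have hom2: "graded_hom ?F2 ?F1 \<phi>2"
    using graded_hom_matrix_map[of ?F2 ?F1 "\<lambda>j i. s j (coord i)"] s ds(1) by (simp add: \<phi>2_def)
  have hom1: "graded_hom ?F1 [0] \<phi>1"
    using graded_hom_matrix_map[of ?F1 "[0]" "\<lambda>j i. partial (coord j) f"] partial by (simp add: \<phi>1_def)
  have ker3: "module_kernel [- e] \<phi>3 = {\<lambda>_. 0}"
  proof -
    have "v = (\<lambda>_. 0)" if "\<forall>i\<ge>1. v i = 0" "\<phi>3 v = (\<lambda>_. 0)" for v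
    proof
      fix i
      have "v 0 * q 2 = 0" using fun_cong[OF that(2), of 2] by (simp add: \<phi>3_def matrix_map_def)
      then show "v i = 0" using q2 that(1) by (cases i) auto
    qed
    moreover have "\<phi>3 (\<lambda>_. 0) = (\<lambda>_. 0)" by (simp add: \<phi>3_def matrix_map_def fun_eq_iff)
    ultimately show ?thesis unfolding module_kernel_def F3 by auto
  qed
  have \<phi>2: "\<phi>2 v = (\<lambda>_. 0) \<longleftrightarrow> (\<forall>i. (\<Sum>j<3. v j * s j i) = 0)" for v
    using surj by (auto simp: \<phi>2_def matrix_map_def fun_eq_iff) metis
  have im3: "\<phi>3 ` free_module [- e] = module_kernel ?F2 \<phi>2"
  proof (intro equalityI subsetI)
    fix v assume "v \<in> \<phi>3 ` free_module [- e]"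
    then obtain u where u: "v = \<phi>3 u" by blast
    then have v: "v j = (if j < 3 then u 0 * q j else 0)" for j by (simp add: \<phi>3_def matrix_map_def)
    have "(\<Sum>j<3. v j * s j i) = u 0 * (\<Sum>j<3. q j * s j i)" for i
      unfolding sum_distrib_left by (intro sum.cong refl) (simp add: v mult.assoc)
    then show "v \<in> module_kernel ?F2 \<phi>2"
      unfolding module_kernel_def F2 by (simp add: \<phi>2 relation) (simp add: v)
  next
    fix v assume v: "v \<in> module_kernel ?F2 \<phi>2"
    then obtain c where c: "\<forall>j<3. v j = c * q j" using relations unfolding module_kernel_def \<phi>2 by blast
    have "v = \<phi>3 (\<lambda>i. if i = 0 then c else 0)"
      using c v unfolding module_kernel_def F2 by (auto simp: \<phi>3_def matrix_map_def fun_eq_iff)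
    then show "v \<in> \<phi>3 ` free_module [- e]" unfolding F3 by auto
  qed
  have \<phi>1: "\<phi>1 v = (\<lambda>i. if i = 0 then \<Sum>j<3. v j * partial (coord j) f else 0)" for v
    by (auto simp: \<phi>1_def matrix_map_def fun_eq_iff)
  have \<phi>10: "\<phi>1 v = (\<lambda>_. 0) \<longleftrightarrow> (\<Sum>j<3. v j * partial (coord j) f) = 0" for v
    unfolding \<phi>1 by (auto simp: fun_eq_iff)
  have inj: "\<exists>g. \<forall>j<3. v j = g (coord j)" for v :: "nat \<Rightarrow> poly3"
  proof -
    have "coord 0 = 1" "coord 1 = 2" "coord 2 = 3" by simp_all
    then show ?thesis
      by (intro exI[of _ "\<lambda>i. if i = 1 then v 0 else if i = 2 then v 1 else v 2"]) (auto simp: less_Suc_eq eval_nat_numeral)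
  qed
  have im2: "\<phi>2 ` free_module ?F2 = module_kernel ?F1 \<phi>1"
  proof (intro equalityI subsetI)
    fix v assume "v \<in> \<phi>2 ` free_module ?F2"
    then obtain u where u: "v = \<phi>2 u" by blast
    have "(\<Sum>i<3. v i * partial (coord i) f) = (\<Sum>i<3. (\<Sum>j<3. u j * s j (coord i)) * partial (coord i) f)"
      by (simp add: u \<phi>2_def matrix_map_def)
    also have "\<dots> = (\<Sum>i\<in>UNIV. (\<Sum>j<3. u j * s j i) * partial i f)" by (rule sum_coord)
    also have "\<dots> = (\<Sum>j<3. u j * (\<Sum>i\<in>UNIV. s j i * partial i f))"
      unfolding sum_distrib_left sum_distrib_right by (subst sum.swap) (simp add: mult.assoc)
    also have "\<dots> = 0" by (simp add: kill)
    finally show "v \<in> module_kernel ?F1 \<phi>1"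
      unfolding module_kernel_def F1 by (simp add: \<phi>10) (simp add: u \<phi>2_def matrix_map_def)
  next
    fix v assume v: "v \<in> module_kernel ?F1 \<phi>1"
    obtain g where g: "\<forall>j<3. v j = g (coord j)" using inj by blast
    have "(\<Sum>i\<in>UNIV. g i * partial i f) = (\<Sum>i<3. g (coord i) * partial (coord i) f)" by (rule sum_coord[symmetric])
    also have "\<dots> = (\<Sum>i<3. v i * partial (coord i) f)" by (intro sum.cong refl) (simp add: g)
    also have "\<dots> = 0" using v unfolding module_kernel_def \<phi>10 by blast
    finally obtain u where u: "\<forall>i. g i = (\<Sum>j<3. u j * s j i)" using generate by blast
    have "v = \<phi>2 (\<lambda>i. if i < 3 then u i else 0)"
      using g v unfolding module_kernel_def F1 by (auto simp: \<phi>2_def matrix_map_def fun_eq_iff u)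
    then show "v \<in> \<phi>2 ` free_module ?F2" unfolding F2 by auto
  qed
  have im1: "\<phi>1 ` free_module ?F1 = {v \<in> free_module [0]. milnor_projection f v = \<zero>\<^bsub>milnor_algebra f\<^esub>}"
  proof (intro equalityI subsetI)
    fix v assume "v \<in> \<phi>1 ` free_module ?F1"
    then obtain u where u: "v = \<phi>1 u" by blast
    obtain g where g: "\<forall>j<3. u j = g (coord j)" using inj by blast
    have "v 0 = (\<Sum>i<3. g (coord i) * partial (coord i) f)" by (simp add: u \<phi>1 g)
    also have "\<dots> = (\<Sum>i\<in>UNIV. g i * partial i f)" by (rule sum_coord)
    finally have "v 0 \<in> jacobian_ideal f" unfolding jacobian_ideal_iff by blast
    then show "v \<in> {v \<in> free_module [0]. milnor_projection f v = \<zero>\<^bsub>milnor_algebra f\<^esub>}"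
      unfolding milnor_projection_eq_zero F0 by (simp add: u \<phi>1)
  next
    fix v assume "v \<in> {v \<in> free_module [0]. milnor_projection f v = \<zero>\<^bsub>milnor_algebra f\<^esub>}"
    then have v: "\<forall>i\<ge>1. v i = 0" "v 0 \<in> jacobian_ideal f" unfolding milnor_projection_eq_zero F0 mem_Collect_eq by auto
    then obtain g where "v 0 = (\<Sum>i\<in>UNIV. g i * partial i f)" unfolding jacobian_ideal_iff by blast
    then have "v 0 = (\<Sum>i<3. g (coord i) * partial (coord i) f)"
      unfolding sum_coord[of "\<lambda>i. g i * partial i f"] .
    then have "v = \<phi>1 (\<lambda>i. if i < 3 then g (coord i) else 0)" using v(1) by (auto simp: \<phi>1 fun_eq_iff)
    then show "v \<in> \<phi>1 ` free_module ?F1" unfolding F1 by auto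
  qed
  have min3: "minimal_map [- e] \<phi>3" unfolding \<phi>3_def using q by (intro minimal_map_matrix_map) blast
  have min2: "minimal_map ?F2 \<phi>2" unfolding \<phi>2_def
  proof (intro minimal_map_matrix_map)
    fix i j :: nat assume "j < 3"
    then show "\<exists>k\<ge>1. homogeneous k (s j (coord i))" using s[of j] ds(2)[of j] by (intro exI[of _ "int (ds ! j)"]) simp
  qed
  have min1: "minimal_map ?F1 \<phi>1" unfolding \<phi>1_def
  proof (intro minimal_map_matrix_map)
    fix i j :: nat
    show "\<exists>k\<ge>1. homogeneous k (partial (coord j) f)" using partial f(2) by (intro exI[of _ "int d - 1"]) simp
  qed
  show ?thesis
    unfolding has_minimal_graded_free_resolution_def
    by (rule exI[of _ \<phi>3], rule exI[of _ \<phi>2], rule exI[of _ \<phi>1])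
      (intro conjI hom3 hom2 hom1 ker3 im3 im2 im1 milnor_projection_surj min3 min2 min1)
qed

section \<open>The deleted Klein arrangement in adapted coordinates\<close>

text \<open>A prime that occurs once in the product cannot divide \<open>t\<close> if
  \<open>t^2\<close> divides the product. It therefore divides the cofactor of \<open>t^2\<close>
  and can be cancelled, which leaves the shorter product.\<close>

lemma squarefree_prod_list:
  fixes f :: "'b \<Rightarrow> 'a::idom"
  assumes "distinct cs" "\<And>c. c \<in> set cs \<Longrightarrow> prime_elem (f c)"
    and "\<And>c d. c \<in> set cs \<Longrightarrow> d \<in> set cs \<Longrightarrow> c \<noteq> d \<Longrightarrow> \<not> f c dvd f d" and "u dvd 1"
  shows "squarefree (u * prod_list (map f cs))"
  using assms
proof (induction cs)
  case Nil
  show ?case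
  proof (rule squarefreeI)
    fix t assume "t ^ 2 dvd u * prod_list (map f [])"
    with Nil.prems(4) have "t * t dvd 1" by (simp add: power2_eq_square dvd_trans)
    then show "t dvd 1" by (rule dvd_mult_left)
  qed
next
  case (Cons c cs)
  have sf: "squarefree (u * prod_list (map f cs))" using Cons by simp
  have p: "prime_elem (f c)" using Cons.prems by simp
  then have 0: "f c \<noteq> 0" by (simp add: prime_elem_def)
  have "\<not> f c dvd u" using p Cons.prems(4) by (metis dvd_trans prime_elem_not_unit)
  moreover have "\<not> f c dvd prod_list (map f cs)"
  proof
    assume "f c dvd prod_list (map f cs)"
    then obtain e where "e \<in> set cs" "f c dvd f e" using prime_dvd_prod_list[OF p] by blast
    moreover from this(1) have "c \<noteq> e" using Cons.prems(1) by auto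
    ultimately show False using Cons.prems(3)[of c e] by simp
  qed
  ultimately have n: "\<not> f c dvd u * prod_list (map f cs)" using p by (simp add: prime_elem_dvd_mult_iff)
  show ?case
  proof (rule squarefreeI)
    fix t assume "t ^ 2 dvd u * prod_list (map f (c # cs))"
    then obtain m where "u * prod_list (map f (c # cs)) = t ^ 2 * m" ..
    then have m: "f c * (u * prod_list (map f cs)) = t ^ 2 * m" by (simp add: mult.left_commute)
    have "\<not> f c dvd t"
    proof
      assume "f c dvd t"
      then obtain t' where "t = f c * t'" ..
      then have "f c * (u * prod_list (map f cs)) = f c * (f c * (t' ^ 2 * m))"
        using m by (simp add: power2_eq_square mult_ac)
      then have "u * prod_list (map f cs) = f c * (t' ^ 2 * m)" using 0 by simp
      with n show False by simp
    qed
    then have "\<not> f c dvd t ^ 2" using p prime_elem_dvd_power by blast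
    moreover have "f c dvd t ^ 2 * m" using m by (metis dvd_triv_left)
    ultimately have "f c dvd m" using p by (simp add: prime_elem_dvd_mult_iff)
    then obtain m' where "m = f c * m'" ..
    then have "f c * (u * prod_list (map f cs)) = f c * (t ^ 2 * m')" using m by (simp add: mult_ac)
    then have "t ^ 2 dvd u * prod_list (map f cs)" using 0 by simp
    with sf show "t dvd 1" by (rule squarefreeD)
  qed
qed

lemma (in klein_coordinates) squarefree_F: "u dvd 1 \<Longrightarrow> squarefree (u * F)"
  unfolding F_def using distinct_roots prime_root nonassoc by (intro squarefree_prod_list) auto

lemma klein_roots_not_proportional:
  fixes w :: complex
  assumes w: "w * w = w - 2"
    and "(c1, c2, c3) \<in> set (all_roots w)" "(k * c1, k * c2, k * c3) \<in> set (all_roots w)"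
  shows "k = 1"
proof -
  define Q where "Q p q r \<longleftrightarrow> (p = 1 \<and> q = 0 \<and> r = 0) \<or> (p = 0 \<and> q = 1 \<and> r = 0) \<or> (p = 0 \<and> q = 0 \<and> r = 1)
    \<or> (p = 1 \<and> q * q = 1 \<and> r = 0) \<or> (p = 1 \<and> q = 0 \<and> r * r = 1) \<or> (p = 0 \<and> q = 1 \<and> r * r = 1)
    \<or> (p = w \<and> q * q = 1 \<and> r * r = 1) \<or> (q = w \<and> p * p = 1 \<and> r * r = 1) \<or> (r = w \<and> p * p = 1 \<and> q * q = 1)" for p q r
  have Q: "Q p q r" if "(p, q, r) \<in> set (all_roots w)" for p q r
  proof -
    have "case (p, q, r) of (p, q, r) \<Rightarrow> Q p q r" using that
      by (rule klein_roots_cases) (simp_all add: Q_def)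
    then show ?thesis by simp
  qed
  have w0: "w \<noteq> 0" using w by auto
  \<comment> \<open>Two roots with \<open>w\<close> in different positions would force
    \<open>w^4 = 1\<close>. But \<open>w^4 = (w - 2)^2 = 2 - 3*w\<close>, and \<open>3*w = 1\<close>
    contradicts \<open>w*w = w - 2\<close>.\<close>
  have mixed: False if "k * q = w" "q * q = 1" "(k * w) * (k * w) = 1" for q
  proof -
    have "(w * w) * (w * w) = (k * w) * (k * w) * (q * q)" unfolding that(1)[symmetric] by (simp add: mult_ac)
    then have "(w - 2) * (w - 2) = 1" using that w by simp
    then have *: "3 * w = 1" using w by (simp add: algebra_simps)
    have "(3 * w) * (3 * w) = 3 * (3 * w) - 18" using w by simp
    then show False unfolding * by simp
  qed
  show ?thesis using Q[OF assms(2)] Q[OF assms(3)] mixed[of c1] mixed[of c2] mixed[of c3] w0 unfolding Q_def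
    by (elim disjE conjE) auto
qed

lemma klein_roots_const:
  "klein_roots (const w) = map (\<lambda>(a, b, c). (const a, const b, const c)) (klein_roots w)"
  by (simp add: klein_roots_def)

section \<open>Linear forms from a dual frame\<close>

lemma dot3_simps [simp]:
  "dot3 (a + b) v = dot3 a v + dot3 b v" "dot3 (a - b) v = dot3 a v - dot3 b v" "dot3 (k *s a) v = k * dot3 a v"
  "dot3 a (v + u) = dot3 a v + dot3 a u" "dot3 a (v - u) = dot3 a v - dot3 a u" "dot3 a (k *s v) = k * dot3 a v"
  "dot3 0 v = 0" "dot3 a 0 = 0" "dot3 (- a) v = - dot3 a v" "dot3 a (- v) = - dot3 a v"
  by (simp_all add: dot3_def sum_3 algebra_simps)

text \<open>Duality says that the matrix of covectors times the matrix of vectors is 1; for square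
  matrices the product in the other order is then 1 as well.\<close>

lemma dual_complete:
  assumes "dot3 a1 v1 = 1" "dot3 a1 v2 = 0" "dot3 a1 v3 = 0" "dot3 a2 v1 = 0" "dot3 a2 v2 = 1" "dot3 a2 v3 = 0"
    "dot3 a3 v1 = 0" "dot3 a3 v2 = 0" "dot3 a3 v3 = 1"
  shows "v1 $ i * a1 $ j + v2 $ i * a2 $ j + v3 $ i * a3 $ j = (if i = j then 1 else 0)"
proof -
  define A :: "complex ^ 3 ^ 3" where "A = vector [a1, a2, a3]"
  define V :: "complex ^ 3 ^ 3" where "V = transpose (vector [v1, v2, v3])"
  have "A ** V = mat 1"
    using assms unfolding A_def V_def dot3_def
    by (simp add: vec_eq_iff forall_3 matrix_matrix_mult_def transpose_def mat_def sum_3 vector_3)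
  then have "V ** A = mat 1" by (simp add: matrix_left_right_inverse)
  then have "(V ** A) $ i $ j = (if i = j then 1 else 0)" by (simp add: mat_def)
  then show ?thesis
    unfolding A_def V_def by (simp add: matrix_matrix_mult_def transpose_def sum_3 vector_3)
qed

text \<open>The covectors serve as coordinates \<open>x, y, z\<close>, and the vectors as directions
  of the derivations dual to them.\<close>

locale dual_frame =
  fixes w :: complex and a1 a2 a3 v1 v2 v3 :: "complex ^ 3"
  assumes w: "w * w = w - 2"
    and dual: "dot3 a1 v1 = 1" "dot3 a1 v2 = 0" "dot3 a1 v3 = 0"
      "dot3 a2 v1 = 0" "dot3 a2 v2 = 1" "dot3 a2 v3 = 0"
      "dot3 a3 v1 = 0" "dot3 a3 v2 = 0" "dot3 a3 v3 = 1"
begin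

lemmas dual' = dual_complete[OF dual]

abbreviation "x \<equiv> linear_form a1"
abbreviation "y \<equiv> linear_form a2"
abbreviation "z \<equiv> linear_form a3"

definition root_vec :: "complex \<times> complex \<times> complex \<Rightarrow> complex ^ 3" where
  "root_vec c = (case c of (k1, k2, k3) \<Rightarrow> k1 *s a1 + k2 *s a2 + k3 *s a3)"

lemma dot3_root_vec:
  "dot3 (root_vec (k1, k2, k3)) v1 = k1" "dot3 (root_vec (k1, k2, k3)) v2 = k2" "dot3 (root_vec (k1, k2, k3)) v3 = k3"
  by (simp_all add: root_vec_def dual)

lemma linear_form_root_vec:
  "linear_form (root_vec (k1, k2, k3)) = form (const k1, const k2, const k3) x y z"
  by (simp add: root_vec_def linear_form_simps)

lemma root_vec_neq_0: "c \<in> set (all_roots w) \<Longrightarrow> root_vec c \<noteq> 0"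
proof
  assume c: "c \<in> set (all_roots w)" and 0: "root_vec c = 0"
  obtain k1 k2 k3 where k: "c = (k1, k2, k3)" by (cases c)
  have "k1 = 0" "k2 = 0" "k3 = 0" using dot3_root_vec[of k1 k2 k3] 0 unfolding k by (simp_all add: dot3_def)
  then show False using klein_roots_unit[of k1 k2 k3 w] c k by auto
qed

lemma root_vec_proportional:
  assumes "c \<in> set (all_roots w)" "d \<in> set (all_roots w)" "root_vec d = k *s root_vec c"
  shows "c = d"
proof -
  obtain k1 k2 k3 where c: "c = (k1, k2, k3)" by (cases c)
  obtain l1 l2 l3 where d: "d = (l1, l2, l3)" by (cases d)
  have "l1 = k * k1" "l2 = k * k2" "l3 = k * k3"
    using dot3_root_vec[of l1 l2 l3] unfolding d[symmetric] assms(3) dot3_simps c dot3_root_vec by simp_all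
  with klein_roots_not_proportional[OF w, of k1 k2 k3 k] assms c d show ?thesis by simp
qed

lemma roots_const_cases:
  assumes "c \<in> set (all_roots (const w))"
  obtains d where "d \<in> set (all_roots w)" "c = (case d of (k1, k2, k3) \<Rightarrow> (const k1, const k2, const k3))"
    "form c x y z = linear_form (root_vec d)"
proof -
  have "set (all_roots (const w)) = (\<lambda>(a, b, c). (const a, const b, const c)) ` set (all_roots w)"
    by (simp add: klein_roots_const)
  then obtain d where "d \<in> set (all_roots w)" "c = (case d of (k1, k2, k3) \<Rightarrow> (const k1, const k2, const k3))"
    using assms by blast
  moreover obtain k1 k2 k3 where "d = (k1, k2, k3)" by (cases d)
  ultimately show thesis using that[of d] by (simp only: linear_form_root_vec prod.case)
qed

definition frame_deriv :: "complex ^ 3 \<Rightarrow> poly3 \<Rightarrow> poly3" where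
  "frame_deriv v p = (\<Sum>i\<in>UNIV. const (v $ i) * partial i p)"

lemma derivation_frame_deriv: "derivation (frame_deriv v)"
  unfolding derivation_def frame_deriv_def
  by (simp add: partial_add partial_mult algebra_simps sum.distrib sum_distrib_left)

lemma frame_deriv_linear_form: "frame_deriv v (linear_form a) = const (dot3 a v)"
  by (simp add: frame_deriv_def partial_linear_form dot3_def const_sum mult.commute)

lemma frame_deriv_const: "frame_deriv v (const c) = 0"
  by (simp add: frame_deriv_def)

sublocale klein_derivations "const w" x y z
  "frame_deriv v1" "frame_deriv v2" "frame_deriv v3"
proof
  show "const w * const w = const w - 2"
    using arg_cong[OF w, of const] by simp
  show "of_nat (Suc n) dvd (1::poly3)" for n
  proof
    have "complex_of_nat (Suc n) * (1 / of_nat (Suc n)) = 1" by (simp del: of_nat_Suc)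
    then have "const (of_nat (Suc n) * (1 / of_nat (Suc n))) = 1" by (simp only: const_simps(2))
    then show "1 = of_nat (Suc n) * const (1 / of_nat (Suc n))" by (simp only: const_simps const_of_nat)
  qed
  show "\<exists>\<sigma>. ring_substitution \<sigma> (form c x y z) \<and> \<sigma> (const w) = const w"
    if c: "c \<in> set (all_roots (const w))" for c
  proof -
    obtain d where d: "d \<in> set (all_roots w)"
      "form c x y z = linear_form (root_vec d)"
      using roots_const_cases[OF c] by metis
    obtain v where "dot3 (root_vec d) v = 1" using root_vec_neq_0[OF d(1)] dot3_ex by blast
    then show ?thesis unfolding d(2) by (intro exI[of _ "line_subst (root_vec d) v"] conjI ring_substitution_line_subst) simp_all
  qed
  show "\<exists>\<sigma>. ring_substitution \<sigma> x \<and> \<sigma> (const w) = const w \<and> \<sigma> y = y \<and> \<sigma> z = z \<and> (\<forall>p. \<sigma> (\<sigma> p) = \<sigma> p)"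
    by (intro exI[of _ "line_subst a1 v1"] conjI allI ring_substitution_line_subst line_subst_idem)
      (simp_all add: line_subst_linear_form dual)
  show "\<not> form c x y z dvd form d x y z"
    if c: "c \<in> set (all_roots (const w))" and d: "d \<in> set (all_roots (const w))" and ne: "c \<noteq> d" for c d
  proof
    obtain c' where c': "c' \<in> set (all_roots w)" "c = (case c' of (k1, k2, k3) \<Rightarrow> (const k1, const k2, const k3))"
      "form c x y z = linear_form (root_vec c')"
      using roots_const_cases[OF c] .
    obtain d' where d': "d' \<in> set (all_roots w)" "d = (case d' of (k1, k2, k3) \<Rightarrow> (const k1, const k2, const k3))"
      "form d x y z = linear_form (root_vec d')"
      using roots_const_cases[OF d] .
    assume "form c x y z dvd form d x y z"
    then obtain k where "root_vec d' = k *s root_vec c'"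
      unfolding c'(3) d'(3) using linear_form_dvd[OF root_vec_neq_0[OF c'(1)]] by blast
    then have "c' = d'" by (rule root_vec_proportional[OF c'(1) d'(1)])
    then show False using ne c'(2) d'(2) by simp
  qed
qed (simp_all add: derivation_frame_deriv frame_deriv_linear_form frame_deriv_const dual)

end

section \<open>Degrees, and the resolution for the deleted arrangement\<close>

context dual_frame
begin

text \<open>The standard components of the field \<open>p v1 + q v2 + r v3\<close>. The change of
  frame is needed because the Jacobian ideal is generated by the partial derivatives in the standard
  coordinates.\<close>

definition field_comp :: "poly3 \<Rightarrow> poly3 \<Rightarrow> poly3 \<Rightarrow> 3 \<Rightarrow> poly3" where
  "field_comp p q r i = const (v1 $ i) * p + const (v2 $ i) * q + const (v3 $ i) * r"

lemma sum_field_comp: "(\<Sum>i\<in>UNIV. field_comp p q r i * partial i f) = D p q r f"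
  unfolding field_comp_def D_def frame_deriv_def sum_distrib_left sum.distrib[symmetric]
  by (intro sum.cong refl) (simp add: algebra_simps)

lemma field_comp_inverse:
  "g i = field_comp (\<Sum>j\<in>UNIV. const (a1 $ j) * g j) (\<Sum>j\<in>UNIV. const (a2 $ j) * g j) (\<Sum>j\<in>UNIV. const (a3 $ j) * g j) i"
proof -
  have "field_comp (\<Sum>j\<in>UNIV. const (a1 $ j) * g j) (\<Sum>j\<in>UNIV. const (a2 $ j) * g j) (\<Sum>j\<in>UNIV. const (a3 $ j) * g j) i
    = (\<Sum>j\<in>UNIV. const (v1 $ i * a1 $ j + v2 $ i * a2 $ j + v3 $ i * a3 $ j) * g j)"
    by (simp add: field_comp_def distrib_right sum.distrib sum_distrib_left mult.assoc)
  also have "\<dots> = (\<Sum>j\<in>UNIV. if i = j then g j else 0)"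
    unfolding dual' by (intro sum.cong refl) simp
  finally show ?thesis by simp
qed

lemma field_comp_eq_0:
  assumes "\<And>i. field_comp p q r i = 0"
  shows "p = 0 \<and> q = 0 \<and> r = 0"
proof -
  have "(\<Sum>i\<in>UNIV. const (a $ i) * field_comp p q r i) = const (dot3 a v1) * p + const (dot3 a v2) * q + const (dot3 a v3) * r" for a
    by (simp add: field_comp_def dot3_def const_sum sum_distrib_right distrib_left sum.distrib mult.assoc)
  then have "const (dot3 a v1) * p + const (dot3 a v2) * q + const (dot3 a v3) * r = 0" for a
    using assms by simp
  from this[of a1] this[of a2] this[of a3] show ?thesis by (simp add: dual)
qed

lemma double_linear_form: "double (linear_form a) = 2 * linear_form a"
  using homogeneous_linear_form[of a] homogeneous_iff_double[of 1 "linear_form a"] by simp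

lemma double_radial:
  "double (lin9 (const w) (x^2) (y^2) (z^2)) = 2^6 * lin9 (const w) (x^2) (y^2) (z^2)"
  "double (quad9 (const w) (x^2) (y^2) (z^2)) = 2^4 * quad9 (const w) (x^2) (y^2) (z^2)"
  "double (lin11 (const w) (x^2) (y^2) (z^2)) = 2^8 * lin11 (const w) (x^2) (y^2) (z^2)"
  "double (quad11 (const w) (x^2) (y^2) (z^2)) = 2^6 * quad11 (const w) (x^2) (y^2) (z^2)"
  "double R12 = 2^4 * R12"
  "double (quart12 (const w) (x^2) (y^2) (z^2)) = 2^8 * quart12 (const w) (x^2) (y^2) (z^2)"
  unfolding lin9_def quad9_def lin11_def quad11_def quad_mult_def quart12_def double_simps double_simps' double_linear_form
  by Groebner_Basis.algebra+

lemma double_N: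
  "double (N9 x) = 2^8 * N9 x" "double (N9 y) = 2^8 * N9 y" "double (N9 z) = 2^8 * N9 z"
  "double (N11 x) = 2^10 * N11 x" "double (N11 y) = 2^10 * N11 y" "double (N11 z) = 2^10 * N11 z"
  unfolding radial9_def radial11_def double_simps double_simps' double_linear_form double_radial
  by Groebner_Basis.algebra+

lemma double_12: "double f12x = 2^12 * f12x" "double f12z = 2^12 * f12z"
  unfolding f12x_def f12z_def double_simps double_simps' double_linear_form double_radial
  by Groebner_Basis.algebra+

lemma double_F: "double F = 2^20 * F"
proof -
  have "double (prod_list (map root_form cs)) = 2 ^ length cs * prod_list (map root_form cs)"
    if "set cs \<subseteq> set (klein_roots (const w))" for cs
    using that
  proof (induction cs)
    case (Cons c cs)
    then have "c \<in> set (all_roots (const w))" by simp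
    then obtain d where "root_form c = linear_form (root_vec d)" by (rule roots_const_cases)
    with Cons show ?case by (simp add: double_linear_form)
  qed simp
  from this[of "klein_roots (const w)"] show ?thesis by (simp add: F_def klein_roots_def)
qed

lemma homogeneous_F: "homogeneous 20 F"
  using homogeneous_iff_double[of 20 F] double_F by simp

lemma homogeneous_frame_deriv: "homogeneous 19 (frame_deriv v F)"
  unfolding frame_deriv_def using homogeneous_partial[OF homogeneous_F]
  by (intro homogeneous_sum homogeneous_const_mult) simp

text \<open>Both \<open>F\<close> and \<open>F * k\<close> are homogeneous, so the degree of the
  cofactor \<open>k\<close> follows without a formula for it.\<close>

lemma homogeneous_D:
  assumes "double p = 2 ^ Suc n * p" "double q = 2 ^ Suc n * q" "double r = 2 ^ Suc n * r"
    and "D p q r F = F * k"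
  shows "double k = 2 ^ n * k"
proof -
  have "homogeneous (int (Suc n) + 19) (D p q r F)"
    unfolding D_def using assms(1-3)
    by (intro homogeneous_add homogeneous_mult homogeneous_frame_deriv) (simp_all only: homogeneous_iff_double)
  then have "homogeneous (int (20 + n)) (F * k)" unfolding assms(4) by (simp add: algebra_simps)
  then have "homogeneous (int n) k"
    using homogeneous_F F_nz by (intro homogeneous_factor[of 20 F n k]) simp_all
  then show ?thesis by (simp only: homogeneous_iff_double)
qed

lemma double_K: "double K9 = 2^8 * K9" "double K11 = 2^10 * K11" "double K12 = 2^11 * K12"
proof -
  show "double K9 = 2^8 * K9" by (rule homogeneous_D[OF _ _ _ K9]) (simp_all add: double_linear_form double_N)
  show "double K11 = 2^10 * K11" by (rule homogeneous_D[OF _ _ _ K11]) (simp_all add: double_linear_form double_N)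
  show "double K12 = 2^11 * K12" by (rule homogeneous_D[OF _ _ _ K12]) (simp_all add: double_12)
qed

lemma double_syz:
  "double (syz9 x) = 2^9 * syz9 x" "double (syz9 y) = 2^9 * syz9 y" "double (syz9 z) = 2^9 * syz9 z"
  "double (syz11 x) = 2^11 * syz11 x" "double (syz11 y) = 2^11 * syz11 y" "double (syz11 z) = 2^11 * syz11 z"
  "double syz12x = 2^12 * syz12x" "double syz12y = 2^12 * syz12y" "double syz12z = 2^12 * syz12z"
  unfolding syz9_def syz11_def syz12x_def syz12y_def syz12z_def double_simps double_simps' double_linear_form double_N double_12 double_K
  by Groebner_Basis.algebra+

lemma homogeneous_field_comp:
  assumes "double p = 2 ^ n * p" "double q = 2 ^ n * q" "double r = 2 ^ n * r"
  shows "homogeneous (int n) (field_comp p q r i)"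
  unfolding homogeneous_iff_double field_comp_def double_simps assms by (simp add: algebra_simps)

definition syz :: "nat \<Rightarrow> 3 \<Rightarrow> poly3" where
  "syz j = (if j = 0 then field_comp (syz9 x) (syz9 y) (syz9 z)
     else if j = 1 then field_comp (syz11 x) (syz11 y) (syz11 z) else field_comp syz12x syz12y syz12z)"

definition rel :: "nat \<Rightarrow> poly3" where
  "rel j = (if j = 0 then - R12 else if j = 1 then y^2 + z^2 else x)"

lemma sum_lessThan_3: "(\<Sum>j<3. f j) = f 0 + f 1 + f (2::nat)"
proof -
  have "{..<3} = {0, 1, 2 :: nat}" by auto
  then show ?thesis by (simp add: add.assoc)
qed

lemma sum_syz: "(\<Sum>j<3. u j * syz j i) = field_comp (u 0 * syz9 x + u 1 * syz11 x + u 2 * syz12x)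
    (u 0 * syz9 y + u 1 * syz11 y + u 2 * syz12y) (u 0 * syz9 z + u 1 * syz11 z + u 2 * syz12z) i"
  by (simp add: sum_lessThan_3 syz_def field_comp_def algebra_simps)

lemma sum_syz_eq_0_iff:
  "(\<forall>i. (\<Sum>j<3. u j * syz j i) = 0) \<longleftrightarrow> u 0 * syz9 x + u 1 * syz11 x + u 2 * syz12x = 0
    \<and> u 0 * syz9 y + u 1 * syz11 y + u 2 * syz12y = 0 \<and> u 0 * syz9 z + u 1 * syz11 z + u 2 * syz12z = 0"
proof -
  have "(\<forall>i. field_comp p q r i = 0) \<longleftrightarrow> p = 0 \<and> q = 0 \<and> r = 0" for p q r
    using field_comp_eq_0[of p q r] by (auto simp: field_comp_def)
  then show ?thesis unfolding sum_syz .
qed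

lemma syz_rel: "(\<Sum>j<3. rel j * syz j i) = 0"
proof -
  have "\<forall>i. (\<Sum>j<3. rel j * syz j i) = 0"
    unfolding sum_syz_eq_0_iff using syz_relation by (simp add: rel_def)
  then show ?thesis ..
qed

text \<open>After multiplication by \<open>x\<close>, the third syzygy can be replaced by the first
  two, which are independent. Their vanishing coefficients give
  \<open>x * u 1 = u 2 * (y^2 + z^2)\<close>, so \<open>x\<close> divides \<open>u 2\<close>, and
  the quotient is the common factor.\<close>

lemma syz_relations:
  assumes "\<And>i. (\<Sum>j<3. u j * syz j i) = 0"
  shows "\<exists>c. \<forall>j<3. u j = c * rel j"
proof -
  have u: "u 0 * syz9 x + u 1 * syz11 x + u 2 * syz12x = 0"
    "u 0 * syz9 y + u 1 * syz11 y + u 2 * syz12y = 0" "u 0 * syz9 z + u 1 * syz11 z + u 2 * syz12z = 0"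
    using assms sum_syz_eq_0_iff[of u] by blast+
  have "(x * u 0 + u 2 * R12) * syz9 x + (x * u 1 - u 2 * (y^2 + z^2)) * syz11 x = 0"
    "(x * u 0 + u 2 * R12) * syz9 y + (x * u 1 - u 2 * (y^2 + z^2)) * syz11 y = 0"
    "(x * u 0 + u 2 * R12) * syz9 z + (x * u 1 - u 2 * (y^2 + z^2)) * syz11 z = 0"
    using u syz_relation by Groebner_Basis.algebra+
  from syz_independent[OF this] have 1: "x * u 0 = - (u 2 * R12)" "x * u 1 = u 2 * (y^2 + z^2)"
    by (simp_all add: eq_neg_iff_add_eq_0)
  then have "x dvd u 2 * (y^2 + z^2)" by (metis dvd_triv_left)
  then have "x dvd u 2" using prime_x not_x_dvd_sum_squares by (metis prime_elem_dvd_mult_iff)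
  then obtain c where c: "u 2 = x * c" ..
  have x0: "x \<noteq> 0" using prime_x by (simp add: prime_elem_def)
  have "x * u 0 = x * (c * - R12)" "x * u 1 = x * (c * (y^2 + z^2))" using 1 by (simp_all add: c mult_ac)
  then have "u 0 = c * - R12" "u 1 = c * (y^2 + z^2)" using x0 by (metis mult_left_cancel)+
  then have "u 0 = c * rel 0" "u 1 = c * rel 1" "u 2 = c * rel 2"
    using c by (simp_all add: rel_def mult.commute)
  then have "\<forall>j<3. u j = c * rel j" by (auto simp: less_Suc_eq eval_nat_numeral)
  then show ?thesis ..
qed

lemma syz_generate_frame:
  assumes "(\<Sum>i\<in>UNIV. g i * partial i F) = 0"
  shows "\<exists>u. \<forall>i. g i = (\<Sum>j<3. u j * syz j i)"
proof -
  define p q r where "p = (\<Sum>j\<in>UNIV. const (a1 $ j) * g j)" and "q = (\<Sum>j\<in>UNIV. const (a2 $ j) * g j)"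
    and "r = (\<Sum>j\<in>UNIV. const (a3 $ j) * g j)"
  have g: "g i = field_comp p q r i" for i unfolding p_def q_def r_def by (rule field_comp_inverse)
  have "D p q r F = 0" using assms unfolding g sum_field_comp .
  then obtain h k m where *: "p = h * syz9 x + k * syz11 x + m * syz12x" "q = h * syz9 y + k * syz11 y + m * syz12y"
    "r = h * syz9 z + k * syz11 z + m * syz12z" using syz_generate by blast
  have "g i = (\<Sum>j<3. (if j = 0 then h else if j = 1 then k else m) * syz j i)" for i
    unfolding sum_syz g by (simp add: *)
  then show ?thesis by (intro exI[of _ "\<lambda>j. if j = 0 then h else if j = 1 then k else m"]) blast
qed

theorem minimal_plus_one_generated_F:
  assumes "c \<noteq> 0"
  shows "minimal_plus_one_generated 20 (const c * F) 9 11 12"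
proof -
  have u: "const c dvd 1"
  proof
    show "1 = const c * const (1 / c)" using assms by (simp flip: const_simps(4))
  qed
  have hom: "homogeneous (int 20) (const c * F)" using homogeneous_F by (simp add: homogeneous_const_mult)
  have red: "reduced_plane_curve 20 (const c * F)"
    unfolding reduced_plane_curve_def using hom squarefree_F[OF u] F_nz assms by simp
  have partial: "(\<Sum>i\<in>UNIV. g i * partial i (const c * F)) = const c * (\<Sum>i\<in>UNIV. g i * partial i F)" for g
    by (simp add: partial_mult sum_distrib_left mult_ac)
  \<comment> \<open>The relation has degree 13 = 4 + 9 = 2 + 11 = 1 + 12 among the syzygies, and the
    generators of the first free module lie in degree 19; hence the shift 32.\<close>
  have "has_minimal_graded_free_resolution (const c * F) [- 32] (map (\<lambda>a. 1 - int 20 - int a) [9, 11, 12]) (replicate 3 (1 - int 20))"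
  proof (rule minimal_resolution[where s = syz and q = rel])
    show "homogeneous (int ([9, 11, 12] ! j)) (syz j i)" if "j < 3" for i j
    proof -
      have "homogeneous (int 9) (syz 0 i)" "homogeneous (int 11) (syz 1 i)" "homogeneous (int 12) (syz 2 i)"
        using double_syz by (simp_all only: syz_def if_True if_False refl one_neq_zero numeral_eq_one_iff zero_neq_numeral
          semiring_norm zero_neq_numeral[symmetric] homogeneous_field_comp)
      moreover have "j = 0 \<or> j = 1 \<or> j = 2" using that by auto
      ultimately show ?thesis by auto
    qed
    have "double R12 = 2^4 * R12" "double (y^2 + z^2) = 2^2 * (y^2 + z^2)"
      by (simp_all add: double_radial double_linear_form algebra_simps)
    then have "homogeneous (int 4) (- R12)" "homogeneous (int 2) (y^2 + z^2)"
      unfolding homogeneous_iff_double by simp_all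
    then show "homogeneous (32 + 1 - int 20 - int ([9, 11, 12] ! j)) (rel j)" if "j < 3" for j
      using that homogeneous_linear_form[of a1] by (auto simp: rel_def less_Suc_eq eval_nat_numeral)
    show "(\<Sum>i\<in>UNIV. syz j i * partial i (const c * F)) = 0" for j
      unfolding partial syz_def using D_syz by (simp add: sum_field_comp)
    show "\<exists>v. \<forall>i. g i = (\<Sum>j<3. v j * syz j i)" if "(\<Sum>i\<in>UNIV. g i * partial i (const c * F)) = 0" for g
      using that assms unfolding partial by (intro syz_generate_frame) simp
    show "rel 2 \<noteq> 0" using prime_x by (simp add: rel_def prime_elem_def)
  qed (use hom syz_rel syz_relations in \<open>auto simp: less_Suc_eq eval_nat_numeral\<close>)
  then have "syzygy_curve 20 (const c * F) [9, 11, 12]"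
    unfolding syzygy_curve_def using red by (intro conjI exI[of _ "[32]"]) simp_all
  then show ?thesis by (simp add: minimal_plus_one_generated_def plus_one_generated_def)
qed

end

section \<open>Involutions of the projective plane\<close>

lemma dot3_eqI: "(\<And>v. dot3 a v = dot3 b v) \<Longrightarrow> a = b"
proof -
  assume *: "\<And>v. dot3 a v = dot3 b v"
  have "dot3 c (axis i 1) = c $ i" for c i
    by (simp add: dot3_def axis_def if_distrib[of "\<lambda>t. _ * t"] cong: if_cong)
  with * show ?thesis by (metis vec_eq_iff)
qed

lemma dot3_proportional:
  assumes "a \<noteq> 0" "\<And>v. dot3 a v = 0 \<Longrightarrow> dot3 b v = 0"
  obtains k where "b = k *s a"
proof -
  obtain v where v: "dot3 a v = 1" using dot3_ex[OF assms(1)] by blast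
  have "b = dot3 b v *s a"
  proof (rule dot3_eqI)
    fix u
    have "dot3 a (u - dot3 a u *s v) = 0" using v by simp
    from assms(2)[OF this] show "dot3 b u = dot3 (dot3 b v *s a) u" by simp
  qed
  then show thesis by (rule that)
qed

text \<open>Up to a scalar, \<open>M\<close> is \<open>2 v a^T - 1\<close>, a harmonic homology with
  centre \<open>v\<close> and axis \<open>a = 0\<close>. The scalar \<open>l\<close> makes this a
  property of the class of \<open>M\<close> in \<open>PGL3\<close>.\<close>

definition reflects :: "complex ^ 3 ^ 3 \<Rightarrow> complex ^ 3 \<Rightarrow> complex ^ 3 \<Rightarrow> bool" where
  "reflects M v a \<longleftrightarrow> dot3 a v = 1 \<and> (\<exists>l. l \<noteq> 0 \<and> (\<forall>x. M *v x = l *s ((2 * dot3 a x) *s v - x)))"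

lemma matrix_entries: "M *v x = (\<chi> i. M $ i $ 1 * x $ 1 + M $ i $ 2 * x $ 2 + M $ i $ 3 * x $ 3)"
  for M :: "complex ^ 3 ^ 3"
  by (simp add: matrix_vector_mult_def sum_3)

definition adjugate3 :: "complex ^ 3 ^ 3 \<Rightarrow> complex ^ 3 ^ 3" where
  "adjugate3 N = (let n = \<lambda>i j. N $ i $ j in vector
    [vector [n 2 2 * n 3 3 - n 2 3 * n 3 2, n 1 3 * n 3 2 - n 1 2 * n 3 3, n 1 2 * n 2 3 - n 1 3 * n 2 2],
     vector [n 2 3 * n 3 1 - n 2 1 * n 3 3, n 1 1 * n 3 3 - n 1 3 * n 3 1, n 1 3 * n 2 1 - n 1 1 * n 2 3],
     vector [n 2 1 * n 3 2 - n 2 2 * n 3 1, n 1 2 * n 3 1 - n 1 1 * n 3 2, n 1 1 * n 2 2 - n 1 2 * n 2 1]])"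

lemma mult_adjugate3: "N ** adjugate3 N = mat (det N)"
  by (simp add: adjugate3_def Let_def vec_eq_iff forall_3 matrix_matrix_mult_def sum_3 mat_def vector_3 det_3 algebra_simps)

text \<open>Here \<open>N\<close> is its own adjugate, so the adjugate of \<open>N + 1\<close> is
  the scalar \<open>t = tr N + 1\<close>. If \<open>t\<close> were nonzero, \<open>N + 1\<close> and
  hence \<open>N\<close> would be scalar. So all 2 by 2 minors of \<open>N + 1\<close> vanish, and
  this nonzero matrix has rank one. As its square is twice itself, it has the form
  \<open>2 v a^T\<close> with \<open>a v = 1\<close>.\<close>

lemma involution_rank_one:
  fixes N :: "complex ^ 3 ^ 3"
  assumes sq: "N ** N = mat 1" and det: "det N = 1" and ns: "\<And>k. N \<noteq> mat k"
  shows "\<exists>v a. dot3 a v = 1 \<and> (\<forall>x. N *v x = (2 * dot3 a x) *s v - x)"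
proof -
  define n where "n i j = N $ i $ j" for i j
  have sq': "n i 1 * n 1 j + n i 2 * n 2 j + n i 3 * n 3 j = (if i = j then 1 else 0)" for i j
  proof -
    have "(N ** N) $ i $ j = (if i = j then 1 else 0)" unfolding sq by (simp add: mat_def)
    then show ?thesis by (simp add: matrix_matrix_mult_def sum_3 n_def)
  qed
  have "N ** adjugate3 N = mat 1" using mult_adjugate3[of N] det by simp
  then have "adjugate3 N = N" using sq by (metis matrix_mul_assoc matrix_mul_lid matrix_mul_rid)
  then have "adjugate3 N $ i $ j = n i j" for i j by (simp add: n_def)
  note cof = this[of 1 1] this[of 1 2] this[of 1 3] this[of 2 1] this[of 2 2] this[of 2 3] this[of 3 1] this[of 3 2] this[of 3 3]
  note cof = cof[unfolded adjugate3_def Let_def vector_3, folded n_def]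
  define t where "t = n 1 1 + n 2 2 + n 3 3 + 1"
  have "adjugate3 (N + mat 1) = mat t"
    using cof unfolding adjugate3_def Let_def t_def
    by (simp add: vec_eq_iff forall_3 mat_def vector_3 flip: n_def) (simp add: algebra_simps)
  moreover define d where "d = det (N + mat 1)"
  ultimately have T: "(N + mat 1) ** mat t = mat d" using mult_adjugate3[of "N + mat 1"] by simp
  have "t = 0"
  proof (rule ccontr)
    assume "t \<noteq> 0"
    have "((N + mat 1) ** mat t) $ i $ j = t * (n i j + (if i = j then 1 else 0))" for i j
      using exhaust_3[of i] exhaust_3[of j] by (auto simp: matrix_matrix_mult_def sum_3 mat_def n_def)
    then have "t * (n i j + (if i = j then 1 else 0)) = (if i = j then d else 0)" for i j
      unfolding T by (simp add: mat_def)
    then have "n i j + (if i = j then 1 else 0) = (if i = j then d else 0) / t" for i j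
      using \<open>t \<noteq> 0\<close> by (metis nonzero_mult_div_cancel_left)
    then have "n i j = (if i = j then d else 0) / t - (if i = j then 1 else 0)" for i j
      by (metis add_diff_cancel_right')
    then have "N = mat (d / t - 1)" by (simp add: vec_eq_iff mat_def flip: n_def)
    with ns show False by blast
  qed
  define m where "m i j = n i j + (if i = j then 1 else 0)" for i j
  have rank: "m i j * m k l = m i l * m k j" for i j k l
  proof -
    have "\<forall>i j k l. m i j * m k l = m i l * m k j"
      using cof \<open>t = 0\<close> unfolding t_def m_def forall_3 by (auto simp: algebra_simps)
    then show ?thesis by blast
  qed
  have m2: "m i 1 * m 1 j + m i 2 * m 2 j + m i 3 * m 3 j = 2 * m i j" for i j
    using sq'[of i j] exhaust_3[of i] exhaust_3[of j] unfolding m_def by (auto simp: algebra_simps)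
  have "\<exists>p q. m p q \<noteq> 0"
  proof (rule ccontr)
    assume "\<nexists>p q. m p q \<noteq> 0"
    then have "n i j = (if i = j then -1 else 0)" for i j by (auto simp: m_def add_eq_0_iff2 split: if_splits)
    then have "N = mat (-1)" by (simp add: vec_eq_iff mat_def flip: n_def)
    with ns show False by blast
  qed
  then obtain p q where pq: "m p q \<noteq> 0" by blast
  \<comment> \<open>A column and a row of \<open>N + 1\<close> through a nonzero entry, scaled such
    that \<open>2 v a^T\<close> reproduces the rank-one matrix.\<close>
  define v :: "complex ^ 3" where "v = (\<chi> i. m i q)"
  define a :: "complex ^ 3" where "a = (\<chi> j. m p j / (2 * m p q))"
  have va: "2 * v $ i * a $ j = m i j" for i j
    using rank[of i q p j] pq by (simp add: v_def a_def field_simps)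
  have "2 * m p q * dot3 a v = m p 1 * m 1 q + m p 2 * m 2 q + m p 3 * m 3 q"
    using pq by (simp add: dot3_def sum_3 a_def v_def field_simps)
  then have "dot3 a v = 1" using m2[of p q] pq by simp
  moreover have "N *v x = (2 * dot3 a x) *s v - x" for x
  proof -
    have "(N *v x) $ i = ((2 * dot3 a x) *s v - x) $ i" for i
    proof -
      have "((2 * dot3 a x) *s v - x) $ i = (2 * v $ i * a $ 1) * x $ 1 + (2 * v $ i * a $ 2) * x $ 2 + (2 * v $ i * a $ 3) * x $ 3 - x $ i"
        by (simp add: dot3_def sum_3 algebra_simps)
      also have "\<dots> = n i 1 * x $ 1 + n i 2 * x $ 2 + n i 3 * x $ 3"
        unfolding va m_def using exhaust_3[of i] by (auto simp: algebra_simps)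
      finally show ?thesis by (simp add: matrix_entries n_def)
    qed
    then show ?thesis by (simp add: vec_eq_iff)
  qed
  ultimately show ?thesis by blast
qed

lemma mat_mult_vec: "mat k *v x = k *s x" for x :: "complex ^ 3"
  by (simp add: vec_eq_iff matrix_entries mat_def forall_3)

lemma det_mat_mult: "det (mat k ** M) = k ^ 3 * det M" for M :: "complex ^ 3 ^ 3"
  unfolding det_mul by (simp add: det_3 mat_def power3_eq_cube)

lemma mat_mult_commute: "mat k ** M = M ** mat k" for M :: "complex ^ 3 ^ 3"
  by (simp add: vec_eq_iff matrix_matrix_mult_def mat_def sum_3 forall_3)

lemma mat_mult_mat: "mat k ** mat l = (mat (k * l) :: complex ^ 3 ^ 3)"
  by (simp add: vec_eq_iff matrix_matrix_mult_def mat_def sum_3 forall_3)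

lemma mat_mult_mult: "(mat k ** A) ** (mat l ** B) = mat (k * l) ** (A ** B)" for A B :: "complex ^ 3 ^ 3"
proof -
  have "(mat k ** A) ** (mat l ** B) = mat k ** (A ** mat l) ** B" by (simp only: matrix_mul_assoc)
  also have "\<dots> = mat k ** mat l ** (A ** B)" unfolding mat_mult_commute[of l A, symmetric] by (simp only: matrix_mul_assoc)
  finally show ?thesis by (simp only: mat_mult_mat)
qed

text \<open>Dividing by a square root of \<open>c\<close> makes \<open>M\<close> an involution of
  determinant 1 or -1. The dimension is odd, so multiplying by that sign makes the determinant
  1.\<close>

lemma projective_involution_reflects:
  fixes M :: "complex ^ 3 ^ 3"
  assumes sq: "M ** M = mat c" and c: "c \<noteq> 0" and ns: "\<And>k. M \<noteq> mat k"
  shows "\<exists>v a. reflects M v a"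
proof -
  define s where "s = csqrt c"
  have s: "s * s = c" "s \<noteq> 0" using c by (simp_all add: s_def flip: power2_eq_square)
  define d where "d = det (mat (1/s) ** M)"
  have "(mat (1/s) ** M) ** (mat (1/s) ** M) = mat (1/s * (1/s) * c)" unfolding mat_mult_mult sq mat_mult_mat ..
  also have "1/s * (1/s) * c = 1" unfolding s(1)[symmetric] using s(2) by simp
  finally have sq1: "(mat (1/s) ** M) ** (mat (1/s) ** M) = mat 1" .
  then have d: "d * d = 1" unfolding d_def by (metis det_I det_mul)
  define N where "N = mat d ** (mat (1/s) ** M)"
  have "N ** N = mat 1" unfolding N_def mat_mult_mult[of d] sq1 mat_mult_mat d by simp
  moreover have "det N = 1"
    unfolding N_def det_mat_mult[of d] d_def[symmetric] using d by (simp add: power3_eq_cube)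
  moreover have M: "M = mat (s * d) ** N"
  proof -
    have "mat (s * d) ** N = mat (s * d * d * (1/s)) ** M"
      unfolding N_def by (simp only: matrix_mul_assoc mat_mult_mat mult.assoc)
    also have "s * d * d * (1/s) = 1" using s d by (simp add: field_simps)
    finally show ?thesis by simp
  qed
  moreover have "N \<noteq> mat k" for k using ns[of "s * d * k"] M mat_mult_mat by metis
  ultimately obtain v a where va: "dot3 a v = 1" "\<And>x. N *v x = (2 * dot3 a x) *s v - x"
    using involution_rank_one[of N] by blast
  have "M *v x = (s * d) *s ((2 * dot3 a x) *s v - x)" for x
    unfolding M matrix_vector_mul_assoc[symmetric] va(2) mat_mult_vec ..
  moreover have "s * d \<noteq> 0" using s d by auto
  ultimately show ?thesis unfolding reflects_def using va(1) by blast
qed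

lemma reflects_unique:
  assumes "reflects M v a" "reflects M u b"
  shows "\<exists>k. k \<noteq> 0 \<and> u = k *s v \<and> a = k *s b"
proof -
  obtain l where va: "dot3 a v = 1" and l: "l \<noteq> 0" "\<And>x. M *v x = l *s ((2 * dot3 a x) *s v - x)"
    using assms(1) unfolding reflects_def by blast
  obtain l' where ub: "dot3 b u = 1" and l': "l' \<noteq> 0" "\<And>x. M *v x = l' *s ((2 * dot3 b x) *s u - x)"
    using assms(2) unfolding reflects_def by blast
  \<comment> \<open>The trace of \<open>l (2 v a^T - 1)\<close> is \<open>- l\<close>, which shows
    that the scalar depends only on \<open>M\<close>.\<close>
  have tr: "(\<Sum>i\<in>UNIV. (r *s ((2 * dot3 c (axis i 1)) *s t - axis i 1)) $ i) = r * (2 * dot3 c t - 3)" for c t r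
    by (simp add: dot3_def sum_3 axis_def algebra_simps)
  have "(\<Sum>i\<in>UNIV. (M *v axis i 1) $ i) = l * (2 * dot3 a v - 3)" unfolding l(2) tr ..
  moreover have "(\<Sum>i\<in>UNIV. (M *v axis i 1) $ i) = l' * (2 * dot3 b u - 3)" unfolding l'(2) tr ..
  ultimately have "l = l'" using va ub by simp
  have eq: "dot3 a x *s v = dot3 b x *s u" for x
  proof -
    have "l *s ((2 * dot3 a x) *s v - x) = l *s ((2 * dot3 b x) *s u - x)"
      using l(2)[of x] l'(2)[of x] \<open>l = l'\<close> by simp
    with l(1) have "(2 * dot3 a x) *s v = (2 * dot3 b x) *s u" by (simp add: vec_eq_iff)
    then show ?thesis by (simp add: vec_eq_iff)
  qed
  define k where "k = dot3 a u"
  have u: "u = k *s v" using eq[of u] ub by (simp add: k_def)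
  moreover have "k \<noteq> 0" using u ub by auto
  moreover have "a = k *s b"
  proof (rule dot3_eqI)
    fix x
    have "dot3 a (dot3 a x *s v) = dot3 a (dot3 b x *s u)" unfolding eq ..
    then show "dot3 a x = dot3 (k *s b) x" using va by (simp add: k_def)
  qed
  ultimately show ?thesis by blast
qed

lemma reflects_scale:
  assumes "reflects M v a" "k \<noteq> 0"
  shows "reflects M (k *s v) ((1/k) *s a)"
  using assms unfolding reflects_def by (auto simp: vec_eq_iff)

lemma reflects_mult:
  assumes "reflects M v a" "c \<noteq> 0" "\<And>x. M' *v x = c *s (M *v x)"
  shows "reflects M' v a"
proof -
  obtain l where "dot3 a v = 1" and l: "l \<noteq> 0" "\<And>x. M *v x = l *s ((2 * dot3 a x) *s v - x)"
    using assms(1) unfolding reflects_def by blast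
  have "M' *v x = (c * l) *s ((2 * dot3 a x) *s v - x)" for x
    unfolding assms(3) l(2) by (simp add: vec_eq_iff)
  moreover have "c * l \<noteq> 0" using assms(2) l(1) by simp
  ultimately show ?thesis using \<open>dot3 a v = 1\<close> unfolding reflects_def by blast
qed

lemma reflects_conj:
  assumes M: "reflects M v a" and C: "reflects C u b"
  shows "reflects (C ** M ** C) ((2 * dot3 b v) *s u - v) ((2 * dot3 a u) *s b - a)"
proof -
  obtain l where va: "dot3 a v = 1" and l: "l \<noteq> 0" "\<And>x. M *v x = l *s ((2 * dot3 a x) *s v - x)"
    using M unfolding reflects_def by blast
  obtain k where ub: "dot3 b u = 1" and k: "k \<noteq> 0" "\<And>x. C *v x = k *s ((2 * dot3 b x) *s u - x)"
    using C unfolding reflects_def by blast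
  let ?v = "(2 * dot3 b v) *s u - v" and ?a = "(2 * dot3 a u) *s b - a"
  have "(C ** M ** C) *v x = (k * l * k) *s ((2 * dot3 ?a x) *s ?v - x)" for x
    unfolding matrix_vector_mul_assoc[symmetric] l(2) k(2) using va ub
    by (simp add: vec_eq_iff algebra_simps)
  moreover have "k * l * k \<noteq> 0" using l k by simp
  moreover have "dot3 ?a ?v = 1" using va ub by (simp add: algebra_simps)
  ultimately show ?thesis unfolding reflects_def by blast
qed

text \<open>The assumptions on \<open>k\<close> say that \<open>C\<close> maps the centre and the
  axis of \<open>M\<close> to themselves. If \<open>b v\<close> were nonzero, applying
  \<open>b\<close> would give \<open>k = 1\<close>, and then \<open>v\<close>, \<open>u\<close> and
  \<open>a\<close>, \<open>b\<close> would be proportional, so that \<open>C\<close> would be the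
  same reflection. Hence \<open>b v = 0\<close>, and \<open>a v = 1\<close> forces
  \<open>k = -1\<close>, so \<open>a u = 0\<close>.\<close>

lemma reflects_commute:
  assumes M: "reflects M v a" and C: "reflects C u b" and ne: "\<not> reflects C v a"
    and k: "k \<noteq> 0" "v = k *s ((2 * dot3 b v) *s u - v)" "(2 * dot3 a u) *s b - a = k *s a"
  shows "dot3 b v = 0 \<and> dot3 a u = 0"
proof -
  have va: "dot3 a v = 1" and ub: "dot3 b u = 1" using M C unfolding reflects_def by blast+
  have 0: "dot3 b v = 0"
  proof (rule ccontr)
    assume bv: "dot3 b v \<noteq> 0"
    have "dot3 b v = k * dot3 b v" using arg_cong[OF k(2), of "dot3 b"] ub by (simp add: algebra_simps)
    then have "k = 1" using bv by simp
    then have v: "v = dot3 b v *s u" using k(2) by (simp add: vec_eq_iff)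
    moreover have "dot3 a u = 1 / dot3 b v" using arg_cong[OF v, of "dot3 a"] va bv by (simp add: field_simps)
    moreover have "a = dot3 a u *s b" using k(3) \<open>k = 1\<close> by (simp add: vec_eq_iff)
    ultimately show False using ne reflects_scale[OF C bv] by metis
  qed
  then have "dot3 a v = dot3 a (k *s (- v))" using k(2) by simp
  then have "dot3 a v = - (k * dot3 a v)" by simp
  then have "k = -1" using va by (simp add: eq_neg_iff_add_eq_0 add.commute)
  then have "(2 * dot3 a u) *s b = 0" using k(3) by simp
  then have "2 * dot3 a u * dot3 b u = 0" using arg_cong[of "(2 * dot3 a u) *s b" 0 "\<lambda>t. dot3 t u"] by simp
  with 0 ub show ?thesis by simp
qed

text \<open>A fixed point off the axis is the centre. If the plane \<open>b = 0\<close> contained a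
  vector off the axis, adding this vector to those on the axis would show that the whole plane
  consists of multiples of \<open>v\<close>.\<close>

lemma reflects_fixed_line:
  assumes M: "reflects M v a" and b: "b \<noteq> 0"
    and inv: "\<And>x. dot3 b x = 0 \<Longrightarrow> \<exists>k. M *v x = k *s x"
  obtains k where "k \<noteq> 0" "a = k *s b"
proof -
  obtain l where va: "dot3 a v = 1" and l: "l \<noteq> 0" "\<And>x. M *v x = l *s ((2 * dot3 a x) *s v - x)"
    using M unfolding reflects_def by blast
  have span: "\<exists>m. x = m *s v" if "dot3 b x = 0" "dot3 a x \<noteq> 0" for x
  proof -
    obtain k where "M *v x = k *s x" using inv \<open>dot3 b x = 0\<close> by blast
    then have "(k + l) *s x = (2 * l * dot3 a x) *s v" unfolding l(2) by (simp add: vec_eq_iff algebra_simps)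
    moreover have "k + l \<noteq> 0"
    proof
      assume "k + l = 0"
      then have "(2 * l * dot3 a x) *s v = 0" using calculation by simp
      then have "2 * l * dot3 a x * dot3 a v = 0" by (metis dot3_simps(6,8))
      then show False using l(1) that(2) va by simp
    qed
    ultimately have "x = ((2 * l * dot3 a x) / (k + l)) *s v" by (simp add: vec_eq_iff field_simps)
    then show ?thesis ..
  qed
  have "dot3 a x = 0" if x: "dot3 b x = 0" for x
  proof (rule ccontr)
    assume ax: "dot3 a x \<noteq> 0"
    have all: "\<exists>m. y = m *s v" if "dot3 b y = 0" for y
    proof (cases "dot3 a y = 0")
      case True
      then have "\<exists>m. x + y = m *s v" using x that ax by (intro span) simp_all
      then obtain m where "x + y = m *s v" ..
      moreover obtain m' where "x = m' *s v" using span x ax by blast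
      ultimately have "y = (m - m') *s v" by (simp add: vec_eq_iff algebra_simps)
      then show ?thesis ..
    qed (use span that in blast)
    \<comment> \<open>Up to sign, the cross products of \<open>b\<close> with the unit vectors. They
      span the plane \<open>b = 0\<close>, so they cannot all be multiples of one vector.\<close>
    define e1 e2 e3 :: "complex ^ 3" where "e1 = vector [0, b $ 3, - b $ 2]" and "e2 = vector [b $ 3, 0, - b $ 1]"
      and "e3 = vector [b $ 2, - b $ 1, 0]"
    have "dot3 b e1 = 0" "dot3 b e2 = 0" "dot3 b e3 = 0"
      by (simp_all add: dot3_def sum_3 e1_def e2_def e3_def vector_3 mult.commute)
    then obtain m1 m2 m3 where m: "e1 = m1 *s v" "e2 = m2 *s v" "e3 = m3 *s v" using all by metis
    have "b $ 1 \<noteq> 0 \<or> b $ 2 \<noteq> 0 \<or> b $ 3 \<noteq> 0" using b by (auto simp: vec_eq_iff forall_3)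
    moreover have "m1 * v $ 1 = 0" "m1 * v $ 2 = b $ 3" "m1 * v $ 3 = - b $ 2"
      "m2 * v $ 1 = b $ 3" "m2 * v $ 2 = 0" "m2 * v $ 3 = - b $ 1"
      "m3 * v $ 1 = b $ 2" "m3 * v $ 2 = - b $ 1" "m3 * v $ 3 = 0"
      using m by (simp_all add: vec_eq_iff forall_3 e1_def e2_def e3_def vector_3)
    ultimately show False by (metis mult_eq_0_iff neg_equal_0_iff_equal)
  qed
  then obtain k where k: "a = k *s b" using dot3_proportional[OF b] by blast
  moreover have "k \<noteq> 0" using k va by auto
  ultimately show thesis using that by blast
qed

lemma reflects_fixes:
  assumes "reflects M v a" "dot3 a x = 0"
  shows "\<exists>k. M *v x = k *s x"
proof -
  obtain l where l: "M *v x = l *s ((2 * dot3 a x) *s v - x)" using assms(1) unfolding reflects_def by blast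
  then have "M *v x = (- l) *s x" using assms(2) by (simp add: vec_eq_iff)
  then show ?thesis ..
qed

section \<open>Involutions of \<open>SL\<^sub>2(7)/\<plusminus>1\<close>\<close>

definition m2 :: "7 \<Rightarrow> 7 \<Rightarrow> 7 \<Rightarrow> 7 \<Rightarrow> 7 ^ 2 ^ 2" where
  "m2 a b c d = vector [vector [a, b], vector [c, d]]"

lemma m2_simps:
  "m2 a b c d ** m2 e f g h = m2 (a*e+b*g) (a*f+b*h) (c*e+d*g) (c*f+d*h)"
  "- m2 a b c d = m2 (- a) (- b) (- c) (- d)" "mat k = m2 k 0 0 k" "det (m2 a b c d) = a * d - b * c"
  "m2 a b c d = m2 e f g h \<longleftrightarrow> a = e \<and> b = f \<and> c = g \<and> d = h"
  by (simp_all add: m2_def vec_eq_iff matrix_matrix_mult_def sum_2 forall_2 vector_2 mat_def det_2)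

lemma m2_exhaust: obtains a b c d where "A = m2 a b c d"
  using that[of "A $ 1 $ 1" "A $ 1 $ 2" "A $ 2 $ 1" "A $ 2 $ 2"]
  by (simp add: m2_def vec_eq_iff forall_2 vector_2)

lemma m2_neg: "A ** (- B) = - (A ** B)" "(- A) ** B = - (A ** B)" for A B :: "7 ^ 2 ^ 2"
  by (cases A rule: m2_exhaust; cases B rule: m2_exhaust; simp add: m2_simps)+

text \<open>
  Representatives modulo sign, in the order of the corresponding lines in
  \<open>(1,0,0) # klein_roots w\<close>.
\<close>

definition klein_involutions :: "(7 ^ 2 ^ 2) list" where
  "klein_involutions = [m2 0 1 6 0, m2 2 3 3 5, m2 3 5 5 4,
     m2 3 6 3 4, m2 3 3 6 4, m2 1 2 6 6, m2 1 6 2 6, m2 3 2 2 4, m2 2 4 4 5,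
     m2 1 1 5 6, m2 1 5 1 6, m2 3 4 1 4, m2 3 1 4 4,
     m2 2 2 1 5, m2 1 4 3 6, m2 2 1 2 5, m2 1 3 4 6,
     m2 0 2 3 0, m2 2 6 5 5, m2 0 3 2 0, m2 2 5 6 5]"

lemma all_7: "(\<forall>a::7. P a) \<longleftrightarrow> P 0 \<and> P 1 \<and> P 2 \<and> P 3 \<and> P 4 \<and> P 5 \<and> P 6"
proof -
  have "{0,1,2,3,4,5,6} = (UNIV :: 7 set)" by (rule card_subset_eq) simp_all
  then have "(\<forall>a::7. P a) \<longleftrightarrow> (\<forall>a\<in>{0,1,2,3,4,5,6}. P a)" by auto
  then show ?thesis by simp
qed

text \<open>Such a matrix has trace 0, and its entry \<open>b\<close> is nonzero because -1 is not a
  square modulo 7. So \<open>a\<close> and \<open>b\<close> determine it.\<close>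

lemma klein_involutions_complete:
  assumes "det A = 1" "A ** A = - mat 1"
  shows "A \<in> set klein_involutions \<or> - A \<in> set klein_involutions"
proof -
  obtain a b c d where A: "A = m2 a b c d" by (rule m2_exhaust)
  have det: "a * d - b * c = 1" and sq: "a * a + b * c = - 1" "a * b + b * d = 0" "c * a + d * c = 0" "c * b + d * d = - 1"
    using assms unfolding A m2_simps by simp_all
  \<comment> \<open>The bracket is \<open>A ** A\<close> plus the determinant, that is, -1 + 1, and
    the last term contains an off-diagonal entry of the square; so the trace vanishes.\<close>
  have "(a + d) * (a * d - b * c) = d * ((a * a + b * c) + (a * d - b * c)) - c * (a * b + b * d)"
    by (simp add: algebra_simps)
  then have "a + d = 0" unfolding det sq(1,2) by simp
  then have d: "d = - a" by (simp add: eq_neg_iff_add_eq_0 add.commute)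
  have "\<forall>b::7. b = 0 \<or> (\<exists>i::7. (b, i) \<in> {(1,1), (2,4), (3,5), (4,2), (5,3), (6,6)})"
    unfolding all_7 by simp
  moreover have "b \<noteq> 0"
  proof
    assume "b = 0"
    moreover have "\<forall>a::7. a * a \<noteq> - 1" unfolding all_7 by simp
    ultimately show False using sq(1) by simp
  qed
  ultimately obtain i :: 7 where i: "(b, i) \<in> {(1,1), (2,4), (3,5), (4,2), (5,3), (6,6)}" by blast
  then have "i * b = 1" by auto
  then have "c = i * ((a * a + b * c) - a * a)" by (simp add: mult.assoc[symmetric])
  then have c: "c = i * (- 1 - a * a)" unfolding sq(1) .
  \<comment> \<open>The 6 values of \<open>b\<close> and 7 values of \<open>a\<close> give 42
    matrices, two for each class modulo sign.\<close>
  have "\<forall>(b, i) \<in> {(1,1), (2,4), (3,5), (4,2), (5,3), (6,6)}. \<forall>a. m2 a b (i * (- 1 - a * a)) (- a) \<in> set klein_involutions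
      \<or> m2 (- a) (- b) (- (i * (- 1 - a * a))) (- (- a)) \<in> set klein_involutions"
    unfolding all_7 klein_involutions_def by (simp add: m2_simps)
  with i have "m2 a b (i * (- 1 - a * a)) (- a) \<in> set klein_involutions
      \<or> m2 (- a) (- b) (- (i * (- 1 - a * a))) (- (- a)) \<in> set klein_involutions" by blast
  then show ?thesis unfolding A d c m2_simps .
qed

text \<open>Serves to treat an arbitrary line \<open>l\<close>: an inner automorphism moves its
  involution to \<open>m2 0 1 6 0\<close>, whose axis becomes \<open>x = 0\<close>.\<close>

lemma klein_involutions_conj:
  assumes "A \<in> set klein_involutions"
  shows "\<exists>h g. det h = 1 \<and> h ** g = mat 1 \<and> g ** h = mat 1 \<and>
    (h ** m2 0 1 6 0 ** g = A \<or> h ** m2 0 1 6 0 ** g = - A)"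
proof -
  have *: "\<exists>h g. det h = 1 \<and> h ** g = mat 1 \<and> g ** h = mat 1 \<and>
    (h ** m2 0 1 6 0 ** g = A \<or> h ** m2 0 1 6 0 ** g = - A)"
    if "a * d - b * c = 1" "m2 a b c d ** m2 0 1 6 0 ** m2 d (- b) (- c) a = A \<or> m2 a b c d ** m2 0 1 6 0 ** m2 d (- b) (- c) a = - A"
    for a b c d A
    by (rule exI[of _ "m2 a b c d"], rule exI[of _ "m2 d (- b) (- c) a"])
      (use that in \<open>simp add: m2_simps mult.commute\<close>)
  \<comment> \<open>Entries of explicit conjugating matrices of determinant 1, in the order of
    \<open>klein_involutions\<close>; their inverses are the matrices
    \<open>m2 d (- b) (- c) a\<close>.\<close>
  let ?hs = "[(0, 1, 6, 0), (0, 2, 3, 1), (0, 3, 2, 1), (0, 1, 6, 3), (0, 2, 3, 5), (0, 3, 2, 2), (0, 1, 6, 1), (0, 3, 2, 6), (0, 2, 3, 6), (0, 1, 6, 6), (0, 3, 2, 5), (0, 2, 3, 2), (0, 1, 6, 4), (0, 3, 2, 4), (0, 2, 3, 3), (0, 1, 6, 5), (0, 2, 3, 4), (0, 3, 2, 0), (0, 1, 6, 2), (0, 2, 3, 0), (0, 3, 2, 3)] :: (7 \<times> 7 \<times> 7 \<times> 7) list"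
  have 1: "\<forall>(A, a, b, c, d) \<in> set (zip klein_involutions ?hs). a * d - b * c = 1 \<and>
      (m2 a b c d ** m2 0 1 6 0 ** m2 d (- b) (- c) a = A \<or> m2 a b c d ** m2 0 1 6 0 ** m2 d (- b) (- c) a = - A)"
    unfolding klein_involutions_def by (simp add: m2_simps)
  have "length klein_involutions = length ?hs" by (simp add: klein_involutions_def)
  then obtain y where "(A, y) \<in> set (zip klein_involutions ?hs)" using assms by (rule in_set_impl_in_set_zip1)
  moreover obtain a b c d :: 7 where "y = (a, b, c, d)" by (cases y)
  ultimately have "(A, a, b, c, d) \<in> set (zip klein_involutions ?hs)" by simp
  from bspec[OF 1 this] have "a * d - b * c = 1 \<and>
      (m2 a b c d ** m2 0 1 6 0 ** m2 d (- b) (- c) a = A \<or> m2 a b c d ** m2 0 1 6 0 ** m2 d (- b) (- c) a = - A)"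
    unfolding prod.case .
  then show ?thesis using *[of a d b c A] by simp
qed

lemma klein_involutions_sq:
  "A \<in> set klein_involutions \<Longrightarrow> det A = 1 \<and> A ** A = - mat 1"
proof -
  have "\<forall>A\<in>set klein_involutions. det A = 1 \<and> A ** A = - mat 1"
    unfolding klein_involutions_def by (simp add: m2_simps)
  then show "A \<in> set klein_involutions \<Longrightarrow> det A = 1 \<and> A ** A = - mat 1" by blast
qed

text \<open>\<open>R A\<close> represents the image of the class of \<open>A\<close> under an embedding into \<open>PGL\<^sub>3\<close>.\<close>

locale projective_representation =
  fixes R :: "7 ^ 2 ^ 2 \<Rightarrow> complex ^ 3 ^ 3"
  assumes mult: "det A = 1 \<Longrightarrow> det B = 1 \<Longrightarrow> \<exists>c. c \<noteq> 0 \<and> R A ** R B = mat c ** R (A ** B)"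
    and neg: "R (- A) = R A"
    and invertible: "det A = 1 \<Longrightarrow> invertible (R A)"
    and faithful: "det A = 1 \<Longrightarrow> R A = mat k \<Longrightarrow> A = mat 1 \<or> A = - mat 1"
begin

definition involution :: "7 ^ 2 ^ 2 \<Rightarrow> bool" where
  "involution A \<longleftrightarrow> det A = 1 \<and> A ** A = - mat 1"

lemma R_one: "\<exists>k. k \<noteq> 0 \<and> R (mat 1) = mat k"
proof -
  obtain c where c: "c \<noteq> 0" "R (mat 1) ** R (mat 1) = mat c ** R (mat 1)"
    using mult[of "mat 1" "mat 1"] by auto
  obtain N where N: "R (mat 1) ** N = mat 1" using invertible[of "mat 1"] unfolding invertible_def by auto
  have "R (mat 1) ** R (mat 1) ** N = mat c ** R (mat 1) ** N" using c by simp
  then have "R (mat 1) = mat c" using N by (metis matrix_mul_assoc matrix_mul_rid)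
  with c(1) show ?thesis by blast
qed

lemma reflects_involution:
  assumes "involution A"
  shows "\<exists>v a. reflects (R A) v a"
proof -
  have A: "det A = 1" "A ** A = - mat 1" using assms unfolding involution_def by auto
  obtain c where c: "c \<noteq> 0" "R A ** R A = mat c ** R (A ** A)" using mult A by blast
  obtain k where k: "k \<noteq> 0" "R (mat 1) = mat k" using R_one by blast
  have "R A ** R A = mat (c * k)" unfolding c(2) A(2) neg k(2) mat_mult_mat ..
  moreover have "c * k \<noteq> 0" using c k by simp
  moreover have "R A \<noteq> mat l" for l
  proof
    assume "R A = mat l"
    with faithful A have "A = mat 1 \<or> A = - mat 1" by blast
    then have "A ** A = mat 1" by (auto simp: m2_simps)
    with A(2) show False by (simp add: m2_simps)
  qed
  ultimately show ?thesis using projective_involution_reflects by blast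
qed

text \<open>With equal centre and axis, \<open>R A\<close> and \<open>R C\<close> are proportional
  and \<open>R A ** R C\<close> is scalar, so \<open>A ** C\<close> is 1 or -1 by
  faithfulness.\<close>

lemma reflects_inj:
  assumes "involution A" "involution C" "reflects (R A) v a" "reflects (R C) v a"
  shows "C = A \<or> C = - A"
proof -
  have A: "det A = 1" "A ** A = - mat 1" "det C = 1" "C ** C = - mat 1" using assms unfolding involution_def by auto
  obtain l where va: "dot3 a v = 1" and l: "l \<noteq> 0" "\<And>x. R A *v x = l *s ((2 * dot3 a x) *s v - x)"
    using assms(3) unfolding reflects_def by blast
  obtain k where k: "k \<noteq> 0" "\<And>x. R C *v x = k *s ((2 * dot3 a x) *s v - x)"
    using assms(4) unfolding reflects_def by blast
  obtain c where c: "c \<noteq> 0" "R A ** R C = mat c ** R (A ** C)" using mult A by blast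
  have "(mat c ** R (A ** C)) *v x = (l * k) *s x" for x
    unfolding c(2)[symmetric] matrix_vector_mul_assoc[symmetric] l(2) k(2) using va
    by (simp add: vec_eq_iff algebra_simps)
  then have "c *s (R (A ** C) *v x) = (l * k) *s x" for x
    by (simp add: matrix_vector_mul_assoc[symmetric] mat_mult_vec)
  then have "R (A ** C) *v x = mat (l * k / c) *v x" for x
    using c(1) by (simp add: mat_mult_vec vec_eq_iff field_simps)
  then have "R (A ** C) = mat (l * k / c)" by (simp add: matrix_eq)
  moreover have "det (A ** C) = 1" using A by (simp add: det_mul)
  ultimately have "A ** C = mat 1 \<or> A ** C = - mat 1" using faithful by blast
  then have "A ** (A ** C) = A \<or> A ** (A ** C) = - A" by (auto simp: m2_neg)
  moreover have "A ** (A ** C) = - C" unfolding matrix_mul_assoc A(2) by (simp add: m2_neg)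
  ultimately show ?thesis by (metis minus_minus)
qed

lemma reflects_R_conj:
  assumes A: "involution A" "involution C" and B: "C ** A ** C = B \<or> C ** A ** C = - B"
    and r: "reflects (R A) v a" "reflects (R C) u b"
  shows "reflects (R B) ((2 * dot3 b v) *s u - v) ((2 * dot3 a u) *s b - a)"
proof -
  have d: "det A = 1" "det C = 1" using A unfolding involution_def by auto
  obtain c where c: "c \<noteq> 0" "R C ** R A = mat c ** R (C ** A)" using mult d by blast
  have "det (C ** A) = 1" using d by (simp add: det_mul)
  then obtain c' where c': "c' \<noteq> 0" "R (C ** A) ** R C = mat c' ** R (C ** A ** C)" using mult d by blast
  have "R C ** R A ** R C = mat (c * c') ** R (C ** A ** C)"
    unfolding c(2) matrix_mul_assoc[symmetric] c'(2) by (simp only: matrix_mul_assoc mat_mult_mat)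
  also have "R (C ** A ** C) = R B" using B neg by auto
  finally have e: "R C ** R A ** R C = mat (c * c') ** R B" .
  have "R B *v x = (1 / (c * c')) *s ((R C ** R A ** R C) *v x)" for x
    unfolding e matrix_vector_mul_assoc[symmetric] mat_mult_vec using c c' by (simp add: vec_eq_iff)
  moreover have "1 / (c * c') \<noteq> 0" using c c' by simp
  ultimately show ?thesis using reflects_mult[OF reflects_conj[OF r]] by blast
qed

lemma reflects_R_commute:
  assumes A: "involution A" "involution C" and B: "C ** A ** C = A \<or> C ** A ** C = - A" and ne: "C \<noteq> A" "C \<noteq> - A"
    and r: "reflects (R A) v a" "reflects (R C) u b"
  shows "dot3 b v = 0" "dot3 a u = 0"
proof -
  have "reflects (R A) ((2 * dot3 b v) *s u - v) ((2 * dot3 a u) *s b - a)"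
    using A B r by (rule reflects_R_conj)
  then obtain k where k: "k \<noteq> 0" "v = k *s ((2 * dot3 b v) *s u - v)" "(2 * dot3 a u) *s b - a = k *s a"
    using reflects_unique[OF _ r(1)] by blast
  have "\<not> reflects (R C) v a" using reflects_inj[OF A r(1)] ne by blast
  then show "dot3 b v = 0" "dot3 a u = 0" using reflects_commute[OF r _ k] by blast+
qed

end

section \<open>Coordinates adapted to an embedding\<close>

lemma covector_expand:
  assumes "dot3 a1 v1 = 1" "dot3 a1 v2 = 0" "dot3 a1 v3 = 0" "dot3 a2 v1 = 0" "dot3 a2 v2 = 1" "dot3 a2 v3 = 0"
    "dot3 a3 v1 = 0" "dot3 a3 v2 = 0" "dot3 a3 v3 = 1"
  shows "b = dot3 b v1 *s a1 + dot3 b v2 *s a2 + dot3 b v3 *s a3"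
proof -
  have "(dot3 b v1 *s a1 + dot3 b v2 *s a2 + dot3 b v3 *s a3) $ j = b $ j" for j
  proof -
    have "(dot3 b v1 *s a1 + dot3 b v2 *s a2 + dot3 b v3 *s a3) $ j =
      (\<Sum>i\<in>UNIV. b $ i * (v1 $ i * a1 $ j + v2 $ i * a2 $ j + v3 $ i * a3 $ j))"
      by (simp add: dot3_def sum_3 algebra_simps)
    also have "\<dots> = b $ j" unfolding dual_complete[OF assms] by (simp add: if_distrib[of "\<lambda>t. _ * t"] cong: if_cong)
    finally show ?thesis .
  qed
  then show ?thesis by (simp add: vec_eq_iff)
qed

context projective_representation
begin

definition covector :: "7 ^ 2 ^ 2 \<Rightarrow> complex ^ 3 \<Rightarrow> bool" where
  "covector A a \<longleftrightarrow> (\<exists>v. reflects (R A) v a)"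

lemma covector_scale: "covector A a \<Longrightarrow> k \<noteq> 0 \<Longrightarrow> covector A (k *s a)"
  unfolding covector_def using reflects_scale[of "R A" _ a "1 / k"] by fastforce

lemma covector_conj:
  assumes "covector A a" "reflects (R C) u b" "involution A" "involution C" "C ** A ** C = B \<or> C ** A ** C = - B"
  shows "covector B ((2 * dot3 a u) *s b - a)"
  using assms reflects_R_conj unfolding covector_def by blast

lemma involution_m2:
  "A \<in> set klein_involutions \<Longrightarrow> involution A"
  using klein_involutions_sq by (simp add: involution_def)

text \<open>Relations between involutions become equations by computing the centre of one involution
  in two ways. Here \<open>m2 2 4 4 5\<close> exchanges the second and third axis,
  \<open>m2 3 3 6 4\<close> the first and second, and \<open>m2 1 1 5 6\<close> supplies
  \<open>w\<close>.\<close>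

lemma adapted_frame:
  "\<exists>w a1 a2 a3 v1 v2 v3. dual_frame w a1 a2 a3 v1 v2 v3 \<and>
    reflects (R (m2 0 1 6 0)) v1 a1 \<and> reflects (R (m2 2 3 3 5)) v2 a2 \<and> reflects (R (m2 3 5 5 4)) v3 a3 \<and>
    reflects (R (m2 2 4 4 5)) (v2 - v3) ((1/2) *s (a2 - a3)) \<and>
    reflects (R (m2 3 3 6 4)) (v1 - v2) ((1/2) *s (a1 - a2)) \<and>
    covector (m2 1 1 5 6) (w *s a1 + a2 + a3)"
proof -
  have inv: "involution (m2 0 1 6 0)" "involution (m2 2 3 3 5)" "involution (m2 3 5 5 4)"
    "involution (m2 2 4 4 5)" "involution (m2 3 3 6 4)" "involution (m2 1 1 5 6)" "involution (m2 3 2 2 4)"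
    "involution (m2 2 2 1 5)"
    by (intro involution_m2; simp add: klein_involutions_def m2_simps)+
  obtain v2 a2 where 2: "reflects (R (m2 2 3 3 5)) v2 a2" using reflects_involution inv by blast
  obtain t s where T: "reflects (R (m2 2 4 4 5)) t s" using reflects_involution inv by blast
  obtain t' s' where T': "reflects (R (m2 3 3 6 4)) t' s'" using reflects_involution inv by blast
  obtain u b where U: "reflects (R (m2 1 1 5 6)) u b" using reflects_involution inv by blast
  \<comment> \<open>The negatives of the reflected vector and covector. With this sign
    \<open>v2 - v3\<close> is a multiple of the centre \<open>t\<close>, so the reflection acts by
    exchanging coordinates up to a common sign.\<close>
  define v3 a3 where "v3 = v2 - (2 * dot3 s v2) *s t" and "a3 = a2 - (2 * dot3 a2 t) *s s"
  define v1 a1 where "v1 = v2 - (2 * dot3 s' v2) *s t'" and "a1 = a2 - (2 * dot3 a2 t') *s s'"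
  have "reflects (R (m2 3 5 5 4)) ((2 * dot3 s v2) *s t - v2) ((2 * dot3 a2 t) *s s - a2)"
    by (rule reflects_R_conj[OF inv(2,4) _ 2 T]) (simp add: m2_simps)
  from reflects_scale[OF this, of "-1"] have 3: "reflects (R (m2 3 5 5 4)) v3 a3"
    by (simp add: v3_def a3_def vec_eq_iff)
  have "reflects (R (m2 0 1 6 0)) ((2 * dot3 s' v2) *s t' - v2) ((2 * dot3 a2 t') *s s' - a2)"
    by (rule reflects_R_conj[OF inv(2,5) _ 2 T']) (simp add: m2_simps)
  from reflects_scale[OF this, of "-1"] have 1: "reflects (R (m2 0 1 6 0)) v1 a1"
    by (simp add: v1_def a1_def vec_eq_iff)
  have one: "dot3 a1 v1 = 1" "dot3 a2 v2 = 1" "dot3 a3 v3 = 1" "dot3 s t = 1" "dot3 s' t' = 1" "dot3 b u = 1"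
    using 1 2 3 T T' U unfolding reflects_def by blast+
  have 12: "dot3 a2 v1 = 0" "dot3 a1 v2 = 0"
    by (rule reflects_R_commute[OF inv(1,2) _ _ _ 1 2]; simp add: m2_simps)+
  have 13: "dot3 a3 v1 = 0" "dot3 a1 v3 = 0"
    by (rule reflects_R_commute[OF inv(1,3) _ _ _ 1 3]; simp add: m2_simps)+
  have 23: "dot3 a3 v2 = 0" "dot3 a2 v3 = 0"
    by (rule reflects_R_commute[OF inv(2,3) _ _ _ 2 3]; simp add: m2_simps)+
  \<comment> \<open>The factors \<open>?p\<close> and \<open>?q\<close> that relate
    \<open>t\<close>, \<open>s\<close> to the differences have product 2, which fixes the
    normalisation \<open>1/2\<close>.\<close>
  have tangentT: "reflects (R A) (v - v') ((1/2) *s (a - a'))"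
    if r: "reflects (R A) t s" and v': "v' = v - (2 * dot3 s v) *s t" and a': "a' = a - (2 * dot3 a t) *s s"
      and d: "dot3 a v = 1" "dot3 a' v' = 1" "dot3 a' v = 0" "dot3 a v' = 0" "dot3 s t = 1" for A v v' a a' t s
  proof -
    let ?p = "2 * dot3 s v" and ?q = "2 * dot3 a t"
    have v: "?p *s t = v - v'" and a: "?q *s s = a - a'" by (simp_all add: v' a' vec_eq_iff)
    have "dot3 (?q *s s) (?p *s t) = 2" unfolding v a using d by simp
    then have pq: "?p * ?q = 2" using d(5) by (simp add: algebra_simps)
    then have p: "?p \<noteq> 0" by auto
    have "(1 / ?p) *s s = (1/2) *s (a - a')"
    proof -
      have "1 / ?p = ?q / 2" using pq p by (simp add: field_simps)
      then show ?thesis unfolding a[symmetric] by (simp add: vec_eq_iff)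
    qed
    then show ?thesis using reflects_scale[OF r p] unfolding v by simp
  qed
  have T23: "reflects (R (m2 2 4 4 5)) (v2 - v3) ((1/2) *s (a2 - a3))"
    using one 23 by (intro tangentT[OF T v3_def a3_def]) auto
  have "reflects (R (m2 3 3 6 4)) (v2 - v1) ((1/2) *s (a2 - a1))"
    using one 12 by (intro tangentT[OF T' v1_def a1_def]) auto
  from reflects_scale[OF this, of "-1"] have T12: "reflects (R (m2 3 3 6 4)) (v1 - v2) ((1/2) *s (a1 - a2))"
    by (simp add: vec_eq_iff)
  \<comment> \<open>The involution \<open>m2 3 2 2 4\<close> is a conjugate of the swap
    \<open>m2 2 4 4 5\<close> and also of \<open>m2 0 1 6 0\<close> by \<open>m2 1 1 5 6\<close>.
    Comparing centres gives one equation for \<open>b v1\<close> and shows that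
    \<open>dot3 a2 u\<close> is nonzero.\<close>
  have T23': "reflects (R (m2 3 2 2 4)) ((2 * dot3 a2 (v2 - v3)) *s v2 - (v2 - v3))
      ((2 * dot3 ((1/2) *s (a2 - a3)) v2) *s a2 - (1/2) *s (a2 - a3))"
    by (rule reflects_R_conj[OF inv(4,2) _ T23 2]) (simp add: m2_simps)
  have U1: "reflects (R (m2 3 2 2 4)) ((2 * dot3 b v1) *s u - v1) ((2 * dot3 a1 u) *s b - a1)"
    by (rule reflects_R_conj[OF inv(1,6) _ 1 U]) (simp add: m2_simps)
  obtain k where k: "k \<noteq> 0" "(2 * dot3 b v1) *s u - v1 = k *s ((2 * dot3 a2 (v2 - v3)) *s v2 - (v2 - v3))"
    using reflects_unique[OF T23' U1] by blast
  from arg_cong[OF k(2), of "dot3 a1"] arg_cong[OF k(2), of "dot3 a2"]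
  have p: "2 * dot3 b v1 * dot3 a1 u = 1" and q: "2 * dot3 b v1 * dot3 a2 u = k"
    using one 12 13 23 by (simp_all add: algebra_simps)
  \<comment> \<open>The involution \<open>m2 1 1 5 6\<close> commutes with the swap of the last two
    axes, so its last two coordinates agree.\<close>
  have UT: "dot3 ((1/2) *s (a2 - a3)) u = 0" "dot3 b (v2 - v3) = 0"
    by (rule reflects_R_commute[OF inv(6,4) _ _ _ U T23]; simp add: m2_simps)+
  \<comment> \<open>Rescaling the centre makes its last two coordinates 1; its first coordinate
    \<open>\<beta>\<close> is the only unknown left.\<close>
  define q where "q = dot3 a2 u"
  have q0: "q \<noteq> 0" using q k(1) unfolding q_def by auto
  define u' b' where "u' = (1/q) *s u" and "b' = q *s b"
  have U': "reflects (R (m2 1 1 5 6)) u' b'" using reflects_scale[OF U, of "1/q"] q0 by (simp add: u'_def b'_def)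
  define \<beta> where "\<beta> = dot3 a1 u'"
  have u': "dot3 a2 u' = 1" "dot3 a3 u' = 1" using UT(1) q0 by (simp_all add: u'_def q_def)
  have b1: "2 * dot3 b' v1 * \<beta> = 1" using p q0 by (simp add: b'_def \<beta>_def u'_def mult.assoc)
  then have \<beta>0: "\<beta> \<noteq> 0" by auto
  have b23: "dot3 b' v2 = dot3 b' v3" using UT(2) by (simp add: b'_def)
  have dual: "dot3 a1 v1 = 1" "dot3 a1 v2 = 0" "dot3 a1 v3 = 0"
      "dot3 a2 v1 = 0" "dot3 a2 v2 = 1" "dot3 a2 v3 = 0"
      "dot3 a3 v1 = 0" "dot3 a3 v2 = 0" "dot3 a3 v3 = 1" using one 12 13 23 by simp_all
  have expand: "b' = dot3 b' v1 *s a1 + dot3 b' v2 *s a2 + dot3 b' v3 *s a3"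
    by (rule covector_expand[OF dual])
  have "dot3 b' u' = dot3 b' v1 * \<beta> + dot3 b' v2 + dot3 b' v3"
    by (subst expand) (simp add: \<beta>_def u')
  moreover have "dot3 b' u' = 1" using U' unfolding reflects_def by blast
  ultimately have "1 = dot3 b' v1 * \<beta> + 2 * dot3 b' v2" using b23 by (simp add: algebra_simps)
  moreover have "dot3 b' v1 * \<beta> = 1/2" using b1 by (simp add: field_simps)
  ultimately have "2 * dot3 b' v2 = 1 - 1/2" by (metis add_diff_cancel_left')
  then have "2 * (2 * dot3 b' v2) = 2 * (1 - 1/2)" by (simp only:)
  then have b2: "dot3 b' v2 = 1/4" by (simp add: field_simps)
  have b1': "dot3 b' v1 = 1 / (2 * \<beta>)" using b1 \<beta>0 by (simp add: field_simps)
  \<comment> \<open>The product of \<open>m2 3 3 6 4\<close> and \<open>m2 1 1 5 6\<close> has order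
    3 modulo sign, so conjugating either by the other gives the same involution. Equality of the two
    centres is a quadratic equation for \<open>\<beta>\<close>.\<close>
  have UTU: "reflects (R (m2 2 2 1 5)) ((2 * dot3 b' (v1 - v2)) *s u' - (v1 - v2))
      ((2 * dot3 ((1/2) *s (a1 - a2)) u') *s b' - (1/2) *s (a1 - a2))"
    by (rule reflects_R_conj[OF inv(5,6) _ T12 U']) (simp add: m2_simps)
  have TUT: "reflects (R (m2 2 2 1 5)) ((2 * dot3 ((1/2) *s (a1 - a2)) u') *s (v1 - v2) - u')
      ((2 * dot3 b' (v1 - v2)) *s ((1/2) *s (a1 - a2)) - b')"
    by (rule reflects_R_conj[OF inv(6,5) _ U' T12]) (simp add: m2_simps)
  obtain m where m: "(2 * dot3 b' (v1 - v2)) *s u' - (v1 - v2) = m *s ((2 * dot3 ((1/2) *s (a1 - a2)) u') *s (v1 - v2) - u')"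
    using reflects_unique[OF TUT UTU] by blast
  from arg_cong[OF m, of "dot3 a3"] arg_cong[OF m, of "dot3 a1"]
  have m1: "2 * (1 / (2 * \<beta>) - 1/4) = - m" and m2: "2 * (1 / (2 * \<beta>) - 1/4) * \<beta> - 1 = - m"
    using dual u' b2 b1' by (simp_all add: \<beta>_def[symmetric] algebra_simps)
  have "2 * (1 / (2 * \<beta>) - 1/4) * \<beta> - 1 = 2 * (1 / (2 * \<beta>) - 1/4)" using m1 m2 by simp
  then have "\<beta> * 2 = 4 + \<beta> * (\<beta> * 2)" using \<beta>0 by (simp add: field_simps)
  then have "2 * \<beta> = 2 * (2 + \<beta> * \<beta>)" by (simp add: algebra_simps)
  then have "\<beta> = 2 + \<beta> * \<beta>" by (metis mult_left_cancel zero_neq_numeral)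
  then have \<beta>: "\<beta> * \<beta> = \<beta> - 2" by (metis add_diff_cancel_left')
  \<comment> \<open>The root conjugate to \<open>\<beta>\<close>. The roots have product 2, and the
    covector has coordinates proportional to \<open>2 / \<beta>\<close>, 1, 1.\<close>
  define w where "w = 1 - \<beta>"
  have w: "w * w = w - 2" using \<beta> by (simp add: w_def algebra_simps)
  have w\<beta>: "w = 2 / \<beta>" using \<beta> \<beta>0 by (simp add: w_def field_simps)
  have "4 *s b' = w *s a1 + a2 + a3"
    by (subst expand) (simp add: b23[symmetric] b2 b1' w\<beta> vec_eq_iff)
  moreover have "covector (m2 1 1 5 6) (4 *s b')"
    using U' covector_scale[of "m2 1 1 5 6" b' 4] unfolding covector_def by auto
  ultimately have "covector (m2 1 1 5 6) (w *s a1 + a2 + a3)" by simp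
  then show ?thesis
    using 1 2 3 T23 T12 w dual by (intro exI conjI) (auto intro!: dual_frame.intro)
qed

text \<open>Conjugation is followed simultaneously on matrices modulo 7 and on covectors up to
  scale, where it acts by signed permutations. The given involutions reach all 21 pairs, which
  matches the two lists entry by entry.\<close>

lemma all_covectors:
  assumes "dual_frame w a1 a2 a3 v1 v2 v3"
    and r: "reflects (R (m2 0 1 6 0)) v1 a1" "reflects (R (m2 2 3 3 5)) v2 a2" "reflects (R (m2 3 5 5 4)) v3 a3"
      "reflects (R (m2 2 4 4 5)) (v2 - v3) ((1/2) *s (a2 - a3))"
      "reflects (R (m2 3 3 6 4)) (v1 - v2) ((1/2) *s (a1 - a2))"
    and U: "covector (m2 1 1 5 6) (w *s a1 + a2 + a3)"
  shows "\<forall>(A, c) \<in> set (zip klein_involutions (all_roots w)). \<exists>k. k \<noteq> 0 \<and> covector A (k *s dual_frame.root_vec a1 a2 a3 c)"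
proof -
  interpret dual_frame w a1 a2 a3 v1 v2 v3 by fact
  define P where "P A x y z \<longleftrightarrow> (\<exists>k. k \<noteq> 0 \<and> covector A (k *s (x *s a1 + y *s a2 + z *s a3)))" for A x y z
  have inv: "involution (m2 a b c d)" if "m2 a b c d \<in> set klein_involutions" for a b c d
    using that by (rule involution_m2)
  have I: "involution (m2 0 1 6 0)" "involution (m2 2 3 3 5)" "involution (m2 3 5 5 4)"
    "involution (m2 2 4 4 5)" "involution (m2 3 3 6 4)" "involution (m2 1 6 2 6)"
    by (intro inv; simp add: klein_involutions_def m2_simps)+
  have neg: "P A (- x) (- y) (- z) \<Longrightarrow> P A x y z" for A x y z
  proof -
    assume "P A (- x) (- y) (- z)"
    then obtain k where k: "k \<noteq> 0" "covector A (k *s ((- x) *s a1 + (- y) *s a2 + (- z) *s a3))" unfolding P_def by blast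
    have "k *s ((- x) *s a1 + (- y) *s a2 + (- z) *s a3) = (- k) *s (x *s a1 + y *s a2 + z *s a3)"
      by (simp add: vec_eq_iff algebra_simps)
    with k show "P A x y z" unfolding P_def by (intro exI[of _ "- k"]) simp
  qed
  have scale_twist: "(2 * (k * d)) *s b - k *s a = k *s ((2 * d) *s b - a)" for k d :: complex and a b :: "complex ^ 3"
    by (simp add: vec_eq_iff algebra_simps)
  have conj: "P B x' y' z'" if "P A x y z" "involution A" "involution C" "reflects (R C) u b"
    "C ** A ** C = B \<or> C ** A ** C = - B"
    "(2 * dot3 (x *s a1 + y *s a2 + z *s a3) u) *s b - (x *s a1 + y *s a2 + z *s a3) = x' *s a1 + y' *s a2 + z' *s a3"
    for A B C u b x y z x' y' z'
  proof -
    from that(1)[unfolded P_def] obtain k where k: "k \<noteq> 0" "covector A (k *s (x *s a1 + y *s a2 + z *s a3))"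
      by (elim exE conjE)
    have "covector B ((2 * dot3 (k *s (x *s a1 + y *s a2 + z *s a3)) u) *s b - k *s (x *s a1 + y *s a2 + z *s a3))"
      by (rule covector_conj[OF k(2) that(4,2,3,5)])
    also have "(2 * dot3 (k *s (x *s a1 + y *s a2 + z *s a3)) u) *s b - k *s (x *s a1 + y *s a2 + z *s a3)
      = k *s ((2 * dot3 (x *s a1 + y *s a2 + z *s a3) u) *s b - (x *s a1 + y *s a2 + z *s a3))"
      unfolding dot3_simps(3) scale_twist ..
    finally show ?thesis unfolding that(6) P_def using k(1) by blast
  qed
  \<comment> \<open>The exchange of the first and third coordinate, as a conjugate of the two
    exchanges already known.\<close>
  have "reflects (R (m2 1 6 2 6)) ((2 * dot3 ((1/2) *s (a1 - a2)) (v2 - v3)) *s (v1 - v2) - (v2 - v3))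
    ((2 * dot3 ((1/2) *s (a2 - a3)) (v1 - v2)) *s ((1/2) *s (a1 - a2)) - (1/2) *s (a2 - a3))"
    by (rule reflects_R_conj[OF I(4,5) _ r(4,5)]) (simp add: m2_simps)
  from reflects_scale[OF this, of "-1"] have r13: "reflects (R (m2 1 6 2 6)) (v1 - v3) ((1/2) *s (a1 - a3))"
    by (simp add: dual vec_eq_iff algebra_simps)
  have c1: "P B x (- y) (- z)" if "P A x y z" "involution A" "m2 0 1 6 0 ** A ** m2 0 1 6 0 = B \<or> m2 0 1 6 0 ** A ** m2 0 1 6 0 = - B" for A B x y z
    by (rule conj[OF that(1,2) I(1) r(1) that(3)]) (simp add: dual vec_eq_iff algebra_simps)
  have c2: "P B (- x) y (- z)" if "P A x y z" "involution A" "m2 2 3 3 5 ** A ** m2 2 3 3 5 = B \<or> m2 2 3 3 5 ** A ** m2 2 3 3 5 = - B" for A B x y z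
    by (rule conj[OF that(1,2) I(2) r(2) that(3)]) (simp add: dual vec_eq_iff algebra_simps)
  have c3: "P B (- x) (- y) z" if "P A x y z" "involution A" "m2 3 5 5 4 ** A ** m2 3 5 5 4 = B \<or> m2 3 5 5 4 ** A ** m2 3 5 5 4 = - B" for A B x y z
    by (rule conj[OF that(1,2) I(3) r(3) that(3)]) (simp add: dual vec_eq_iff algebra_simps)
  \<comment> \<open>Reflecting in \<open>a1 - a2\<close> yields the negative of the permuted
    covector; \<open>neg\<close> removes the sign.\<close>
  have c12: "P B y x z" if "P A x y z" "involution A" "m2 3 3 6 4 ** A ** m2 3 3 6 4 = B \<or> m2 3 3 6 4 ** A ** m2 3 3 6 4 = - B" for A B x y z
    by (rule neg, rule conj[OF that(1,2) I(5) r(5) that(3)]) (simp add: dual vec_eq_iff algebra_simps)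
  have c13: "P B z y x" if "P A x y z" "involution A" "m2 1 6 2 6 ** A ** m2 1 6 2 6 = B \<or> m2 1 6 2 6 ** A ** m2 1 6 2 6 = - B" for A B x y z
    by (rule neg, rule conj[OF that(1,2) I(6) r13 that(3)]) (simp add: dual vec_eq_iff algebra_simps)
  have base: "P A x y z" if "reflects (R A) v (k *s (x *s a1 + y *s a2 + z *s a3))" "k \<noteq> 0" for A v k x y z
    using that unfolding P_def covector_def by blast
  have p1: "P (m2 0 1 6 0) 1 0 0" using base[of _ v1 1 1 0 0] r(1) by simp
  have p2: "P (m2 2 3 3 5) 0 1 0" using base[of _ v2 1 0 1 0] r(2) by simp
  have p3: "P (m2 3 5 5 4) 0 0 1" using base[of _ v3 1 0 0 1] r(3) by simp
  have p12: "P (m2 3 3 6 4) 1 (-1) 0" using base[of _ "v1 - v2" "1/2" 1 "-1" 0] r(5) by simp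
  have p13: "P (m2 1 6 2 6) 1 0 (-1)" using base[of _ "v1 - v3" "1/2" 1 0 "-1"] r13 by simp
  have p23: "P (m2 2 4 4 5) 0 1 (-1)" using base[of _ "v2 - v3" "1/2" 0 1 "-1"] r(4) by simp
  have u: "P (m2 1 1 5 6) w 1 1" unfolding P_def using U by (intro exI[of _ 1]) simp
  have q12: "P (m2 3 6 3 4) 1 1 0" using c1[OF p12 I(5), of "m2 3 6 3 4"] by (simp add: m2_simps)
  have q13: "P (m2 1 2 6 6) 1 0 1" using c1[OF p13 I(6), of "m2 1 2 6 6"] by (simp add: m2_simps)
  have q23: "P (m2 3 2 2 4) 0 1 1" using c2[OF p23 I(4), of "m2 3 2 2 4"] by (simp add: m2_simps)
  have J: "involution (m2 1 1 5 6)" "involution (m2 1 5 1 6)" "involution (m2 3 4 1 4)" "involution (m2 3 1 4 4)"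
    by (intro inv; simp add: klein_involutions_def m2_simps)+
  have u1: "P (m2 1 5 1 6) w (-1) (-1)" using c1[OF u J(1), of "m2 1 5 1 6"] by (simp add: m2_simps)
  have u2: "P (m2 3 4 1 4) w (-1) 1" by (rule neg) (use c2[OF u J(1), of "m2 3 4 1 4"] in \<open>simp add: m2_simps\<close>)
  have u3: "P (m2 3 1 4 4) w 1 (-1)" by (rule neg) (use c3[OF u J(1), of "m2 3 1 4 4"] in \<open>simp add: m2_simps\<close>)
  have y: "P (m2 2 2 1 5) 1 w 1" "P (m2 1 4 3 6) (-1) w (-1)" "P (m2 2 1 2 5) (-1) w 1" "P (m2 1 3 4 6) 1 w (-1)"
    using c12[OF u J(1), of "m2 2 2 1 5"] c12[OF u1 J(2), of "m2 1 4 3 6"] c12[OF u2 J(3), of "m2 2 1 2 5"]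
      c12[OF u3 J(4), of "m2 1 3 4 6"] by (simp_all add: m2_simps)
  have z: "P (m2 0 2 3 0) 1 1 w" "P (m2 2 6 5 5) (-1) (-1) w" "P (m2 0 3 2 0) (-1) 1 w" "P (m2 2 5 6 5) 1 (-1) w"
    using c13[OF u J(1), of "m2 0 2 3 0"] c13[OF u1 J(2), of "m2 2 6 5 5"] c13[OF u3 J(4), of "m2 0 3 2 0"]
      c13[OF u2 J(3), of "m2 2 5 6 5"] by (simp_all add: m2_simps)
  have "\<forall>(A, c) \<in> set (zip klein_involutions (all_roots w)). case c of (p, q, r) \<Rightarrow> P A p q r"
    unfolding klein_involutions_def klein_roots_def
    using p1 p2 p3 p12 p13 p23 q12 q13 q23 u u1 u2 u3 y z by simp
  then show ?thesis unfolding P_def root_vec_def by (simp add: split_def)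
qed

end

section \<open>The Klein arrangement\<close>

lemma const_prod: "const (prod f A) = (\<Prod>a\<in>A. const (f a))"
  by (induction A rule: infinite_finite_induct) simp_all

lemma proj_point_self: "v \<in> proj_point v"
  unfolding proj_point_def by (rule range_eqI[of _ _ 1]) simp

lemma proj_point_mem: "u \<in> proj_point v \<longleftrightarrow> (\<exists>c. u = c *s v)"
  unfolding proj_point_def by blast

lemma proj_line_dot3: "proj_line a = {proj_point v | v. v \<noteq> 0 \<and> dot3 a v = 0}"
  by (simp add: proj_line_def dot3_def)

lemma proj_line_scale: "k \<noteq> 0 \<Longrightarrow> proj_line (k *s a) = proj_line a"
  unfolding proj_line_dot3 by simp

lemma proj_line_eq:
  assumes "a \<noteq> 0" "b \<noteq> 0" "proj_line a = proj_line b"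
  obtains k where "k \<noteq> 0" "b = k *s a"
proof -
  have "dot3 b v = 0" if "dot3 a v = 0" for v
  proof (cases "v = 0")
    case False
    then have "proj_point v \<in> proj_line b" using that assms(3) unfolding proj_line_dot3 by blast
    then obtain v' where v': "proj_point v = proj_point v'" "dot3 b v' = 0" unfolding proj_line_dot3 by blast
    then obtain c where "v = c *s v'" using proj_point_self[of v] proj_point_mem by auto
    then show ?thesis using v'(2) by simp
  qed simp
  then obtain k where k: "b = k *s a" using dot3_proportional[OF assms(1)] by blast
  moreover have "k \<noteq> 0" using k assms(2) by auto
  ultimately show thesis using that by blast
qed

section \<open>Representatives of the elements of \<open>PGL3\<close> and
  \<open>PSL27\<close>\<close>

definition scalar_class :: "complex ^ 3 ^ 3 \<Rightarrow> (complex ^ 3 ^ 3) set" where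
  "scalar_class M = {mat c ** M | c. c \<noteq> 0}"

lemma scalar_class_self: "M \<in> scalar_class M"
  unfolding scalar_class_def by (auto intro!: exI[of _ 1])

lemma scalar_class_eq: "N \<in> scalar_class M \<Longrightarrow> scalar_class N = scalar_class M"
proof -
  assume "N \<in> scalar_class M"
  then obtain c where c: "c \<noteq> 0" "N = mat c ** M" unfolding scalar_class_def by blast
  have "M = mat (1/c) ** N" unfolding c(2) matrix_mul_assoc mat_mult_mat using c(1) by simp
  then have M: "mat d ** M = mat (d * (1/c)) ** N" for d by (metis matrix_mul_assoc mat_mult_mat)
  have N: "mat d ** N = mat (d * c) ** M" for d unfolding c(2) matrix_mul_assoc mat_mult_mat ..
  show ?thesis
  proof (intro equalityI subsetI)
    fix T assume "T \<in> scalar_class N"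
    then obtain d where "d \<noteq> 0" "T = mat d ** N" unfolding scalar_class_def by blast
    with c(1) show "T \<in> scalar_class M" unfolding scalar_class_def N by (intro CollectI exI[of _ "d * c"]) simp
  next
    fix T assume "T \<in> scalar_class M"
    then obtain d where "d \<noteq> 0" "T = mat d ** M" unfolding scalar_class_def by blast
    with c(1) show "T \<in> scalar_class N" unfolding scalar_class_def M by (intro CollectI exI[of _ "d * (1/c)"]) simp
  qed
qed

lemma carrier_PGL3: "T \<in> carrier PGL3 \<longleftrightarrow> (\<exists>M. invertible M \<and> T = scalar_class M)"
proof -
  have "{mat c | c. c \<noteq> 0} #>\<^bsub>GL3\<^esub> M = scalar_class M" for M :: "complex ^ 3 ^ 3"
    unfolding r_coset_def scalar_class_def GL3_def by auto
  then show ?thesis by (auto simp: PGL3_def FactGroup_def RCOSETS_def GL3_def)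
qed

lemma mult_PGL3: "scalar_class M \<otimes>\<^bsub>PGL3\<^esub> scalar_class N = scalar_class (M ** N)"
proof -
  have "scalar_class M \<otimes>\<^bsub>PGL3\<^esub> scalar_class N = {A ** B | A B. A \<in> scalar_class M \<and> B \<in> scalar_class N}"
    by (auto simp: PGL3_def FactGroup_def GL3_def set_mult_def)
  also have "\<dots> = scalar_class (M ** N)"
  proof (intro equalityI subsetI)
    fix T assume "T \<in> {A ** B | A B. A \<in> scalar_class M \<and> B \<in> scalar_class N}"
    then obtain c d where "c \<noteq> 0" "d \<noteq> 0" "T = (mat c ** M) ** (mat d ** N)" unfolding scalar_class_def by blast
    then show "T \<in> scalar_class (M ** N)" unfolding mat_mult_mult scalar_class_def by (intro CollectI exI[of _ "c * d"]) simp
  next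
    fix T assume "T \<in> scalar_class (M ** N)"
    then obtain c where "c \<noteq> 0" "T = (mat c ** M) ** N" unfolding scalar_class_def by (auto simp: matrix_mul_assoc)
    moreover from this have "mat c ** M \<in> scalar_class M" unfolding scalar_class_def by blast
    ultimately show "T \<in> {A ** B | A B. A \<in> scalar_class M \<and> B \<in> scalar_class N}" using scalar_class_self by blast
  qed
  finally show ?thesis .
qed

definition sign_class :: "7 ^ 2 ^ 2 \<Rightarrow> (7 ^ 2 ^ 2) set" where
  "sign_class A = {A, - A}"

lemma mult_minus_one: "(- mat 1) ** A = - A" for A :: "7 ^ 2 ^ 2"
  by (simp add: m2_neg)

lemma carrier_PSL27: "g \<in> carrier PSL27 \<longleftrightarrow> (\<exists>A. det A = 1 \<and> g = sign_class A)"
proof -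
  have "{mat 1, - mat 1} #>\<^bsub>SL27\<^esub> A = sign_class A" for A :: "7 ^ 2 ^ 2"
    unfolding r_coset_def sign_class_def SL27_def by (auto simp: mult_minus_one)
  then show ?thesis by (auto simp: PSL27_def FactGroup_def RCOSETS_def SL27_def)
qed

lemma mult_PSL27: "sign_class A \<otimes>\<^bsub>PSL27\<^esub> sign_class B = sign_class (A ** B)"
  by (auto simp: PSL27_def FactGroup_def SL27_def set_mult_def sign_class_def m2_neg)

lemma one_PSL27: "\<one>\<^bsub>PSL27\<^esub> = sign_class (mat 1)"
  by (simp add: PSL27_def FactGroup_def sign_class_def)

lemma sign_class_eq: "sign_class A = sign_class B \<longleftrightarrow> A = B \<or> A = - B"
  unfolding sign_class_def doubleton_eq_iff by (metis minus_minus)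

text \<open>Adding the determinant to the first entry of the square gives
  \<open>a * (a + d) = 2\<close>, so the trace is invertible modulo 7 and the off-diagonal entries
  vanish. Hence an involution of \<open>PSL27\<close> lifts to a matrix with square -1.\<close>

lemma SL27_square_one:
  fixes A :: "7 ^ 2 ^ 2"
  assumes "det A = 1" "A ** A = mat 1"
  shows "A = mat 1 \<or> A = - mat 1"
proof -
  obtain a b c d where A: "A = m2 a b c d" by (rule m2_exhaust)
  have det: "a * d - b * c = 1" and sq: "a * a + b * c = 1" "a * b + b * d = 0" "c * a + d * c = 0" "c * b + d * d = 1"
    using assms unfolding A m2_simps by simp_all
  have "a * (a + d) = (a * a + b * c) + (a * d - b * c)" by (simp add: algebra_simps)
  then have s: "a * (a + d) = 2" unfolding det sq(1) by simp
  have two: "\<forall>t::7. 2 * t = 0 \<longrightarrow> t = 0" unfolding all_7 by simp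
  have "b * (a * (a + d)) = a * (a * b + b * d)" by (simp add: algebra_simps)
  then have "b = 0" using two unfolding s sq(2) by (simp add: mult.commute)
  have "c * (a * (a + d)) = a * (c * a + d * c)" by (simp add: algebra_simps)
  then have "c = 0" using two unfolding s sq(3) by (simp add: mult.commute)
  have "\<forall>a d::7. a * a = 1 \<longrightarrow> a * d = 1 \<longrightarrow> (a = 1 \<and> d = 1) \<or> (a = - 1 \<and> d = - 1)" unfolding all_7 by simp
  then show ?thesis using det sq \<open>b = 0\<close> \<open>c = 0\<close> unfolding A m2_simps by simp
qed

lemma involutions_PSL27: "g \<in> involutions PSL27 \<longleftrightarrow> (\<exists>A. det A = 1 \<and> A ** A = - mat 1 \<and> g = sign_class A)"
proof
  assume g: "g \<in> involutions PSL27"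
  then obtain A where A: "det A = 1" "g = sign_class A" unfolding involutions_def carrier_PSL27 by blast
  have "sign_class A \<noteq> sign_class (mat 1) \<and> sign_class (A ** A) = sign_class (mat 1)"
    using g unfolding involutions_def A(2) one_PSL27 mem_Collect_eq mult_PSL27 by (elim conjE) (intro conjI)
  then have "A \<noteq> mat 1" "A \<noteq> - mat 1" "A ** A = mat 1 \<or> A ** A = - mat 1" unfolding sign_class_eq by simp_all
  then show "\<exists>A. det A = 1 \<and> A ** A = - mat 1 \<and> g = sign_class A" using SL27_square_one[OF A(1)] A by blast
next
  assume "\<exists>A. det A = 1 \<and> A ** A = - mat 1 \<and> g = sign_class A"
  then obtain A where A: "det A = 1" "A ** A = - mat 1" "g = sign_class A" by blast
  have "A \<noteq> mat 1 \<and> A \<noteq> - mat 1"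
  proof (rule ccontr)
    assume "\<not> (A \<noteq> mat 1 \<and> A \<noteq> - mat 1)"
    then have "A ** A = mat 1" by (auto simp: m2_neg)
    with A(2) show False by (simp add: m2_simps)
  qed
  then show "g \<in> involutions PSL27"
    using A unfolding involutions_def one_PSL27 A(3) mem_Collect_eq mult_PSL27 sign_class_eq carrier_PSL27 by blast
qed

text \<open>The lines fixed pointwise, in terms of representing matrices and eigenvectors; cosets
  are eliminated here.\<close>

definition fixed_lines :: "(7 ^ 2 ^ 2 \<Rightarrow> complex ^ 3 ^ 3) \<Rightarrow> point set set" where
  "fixed_lines R = {proj_line a | a. a \<noteq> 0 \<and>
    (\<exists>A. det A = 1 \<and> A ** A = - mat 1 \<and> (\<forall>v. dot3 a v = 0 \<longrightarrow> (\<exists>k. R A *v v = k *s v)))}"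

text \<open>A fixed point must be mapped onto itself, so an eigenvector with eigenvalue 0 would not
  do; invertibility excludes it.\<close>

lemma fixes_point_scalar_class:
  assumes "invertible M"
  shows "fixes_point (scalar_class M) (proj_point v) \<longleftrightarrow> (\<exists>k. M *v v = k *s v)"
proof
  assume "fixes_point (scalar_class M) (proj_point v)"
  then have "(*v) M ` proj_point v = proj_point v" using scalar_class_self unfolding fixes_point_def by blast
  then have "M *v v \<in> proj_point v" using proj_point_self by blast
  then show "\<exists>k. M *v v = k *s v" unfolding proj_point_mem .
next
  assume "\<exists>k. M *v v = k *s v"
  then obtain k where k: "M *v v = k *s v" by blast
  show "fixes_point (scalar_class M) (proj_point v)"
    unfolding fixes_point_def
  proof
    fix T assume "T \<in> scalar_class M"
    then obtain c where c: "c \<noteq> 0" "T = mat c ** M" unfolding scalar_class_def by blast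
    have T: "T *v (d *s v) = (c * k * d) *s v" for d
      unfolding c(2) matrix_vector_mul_assoc[symmetric] mat_mult_vec vector_scalar_commute k by (simp add: vec_eq_iff)
    show "(*v) T ` proj_point v = proj_point v"
    proof (cases "v = 0")
      case True
      then show ?thesis unfolding proj_point_def image_image T by simp
    next
      case False
      have "k \<noteq> 0"
      proof
        assume "k = 0"
        then have "M *v v = 0" using k by simp
        moreover obtain N where "N ** M = mat 1" using assms unfolding invertible_def by blast
        ultimately show False using False by (metis matrix_vector_mul_assoc matrix_vector_mul_lid matrix_vector_mult_0_right)
      qed
      show ?thesis
      proof (intro equalityI subsetI)
        fix p assume "p \<in> (*v) T ` proj_point v"
        then obtain d where "p = T *v (d *s v)" unfolding proj_point_def by blast
        then show "p \<in> proj_point v" unfolding T proj_point_mem by blast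
      next
        fix p assume "p \<in> proj_point v"
        then obtain d where "p = d *s v" unfolding proj_point_mem by blast
        then have "p = T *v ((d / (c * k)) *s v)" unfolding T using c(1) \<open>k \<noteq> 0\<close> by simp
        then show "p \<in> (*v) T ` proj_point v" unfolding proj_point_def by blast
      qed
    qed
  qed
qed

lemma klein_arrangement_representation:
  assumes "klein_arrangement K"
  obtains R where "projective_representation R" "K = fixed_lines R"
proof -
  obtain \<rho> where hom: "\<rho> \<in> hom PSL27 PGL3" and inj: "inj_on \<rho> (carrier PSL27)"
    and K: "K = {L \<in> proj_lines. \<exists>g\<in>involutions PSL27. \<forall>P\<in>L. fixes_point (\<rho> g) P}"
    using assms unfolding klein_arrangement_def by blast
  \<comment> \<open>The choice depends only on the class of \<open>A\<close> modulo sign, which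
    gives \<open>R (- A) = R A\<close>.\<close>
  define R where "R A = (SOME M. M \<in> \<rho> (sign_class A))" for A
  have R: "\<rho> (sign_class A) = scalar_class (R A)" "invertible (R A)" if "det A = 1" for A
  proof -
    have "\<rho> (sign_class A) \<in> carrier PGL3" using that by (intro hom_in_carrier[OF hom]) (auto simp: carrier_PSL27)
    then obtain M where M: "invertible M" "\<rho> (sign_class A) = scalar_class M" unfolding carrier_PGL3 by blast
    then have "R A \<in> scalar_class M" using scalar_class_self unfolding R_def by (metis someI_ex)
    then show "\<rho> (sign_class A) = scalar_class (R A)" using M scalar_class_eq by metis
    obtain c where c: "c \<noteq> 0" "R A = mat c ** M" using \<open>R A \<in> scalar_class M\<close> unfolding scalar_class_def by blast
    have "invertible (mat c :: complex ^ 3 ^ 3)"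
      unfolding invertible_def using c(1) by (intro exI[of _ "mat (1/c)"]) (simp add: mat_mult_mat)
    then show "invertible (R A)" unfolding c(2) using M(1) by (rule invertible_mult)
  qed
  have prod: "scalar_class (R (A ** B)) = scalar_class (R A ** R B)" if "det A = 1" "det B = 1" for A B
  proof -
    have "\<rho> (sign_class A \<otimes>\<^bsub>PSL27\<^esub> sign_class B) = \<rho> (sign_class A) \<otimes>\<^bsub>PGL3\<^esub> \<rho> (sign_class B)"
      using that by (intro hom_mult[OF hom]) (auto simp: carrier_PSL27)
    moreover have "det (A ** B) = 1" using that by (simp add: det_mul)
    ultimately show ?thesis using that by (simp only: mult_PSL27 R mult_PGL3)
  qed
  have rep: "projective_representation R"
  proof
    fix A B :: "7 ^ 2 ^ 2" assume d: "det A = 1" "det B = 1"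
    have "R A ** R B \<in> scalar_class (R (A ** B))" unfolding prod[OF d] by (rule scalar_class_self)
    then show "\<exists>c. c \<noteq> 0 \<and> R A ** R B = mat c ** R (A ** B)" unfolding scalar_class_def by blast
  next
    show "R (- A) = R A" for A unfolding R_def sign_class_def by (simp add: insert_commute)
  next
    show "det A = 1 \<Longrightarrow> invertible (R A)" for A by (rule R)
  next
    fix A :: "7 ^ 2 ^ 2" and k assume A: "det A = 1" "R A = mat k"
    have one: "det (mat 1 :: 7 ^ 2 ^ 2) = 1" by simp
    have "scalar_class (R A) = scalar_class (R A ** R (mat 1))" using prod[OF A(1) one] by simp
    also have "R A ** R (mat 1) \<in> scalar_class (R (mat 1))"
    proof -
      have "k \<noteq> 0"
      proof
        assume "k = 0"
        then have "R A = 0" using A(2) by (simp add: vec_eq_iff mat_def)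
        moreover obtain N where "R A ** N = mat 1" using R(2)[OF A(1)] unfolding invertible_def by blast
        ultimately have "(mat 1 :: complex ^ 3 ^ 3) = 0" by simp
        then have "(mat 1 :: complex ^ 3 ^ 3) $ 1 $ 1 = 0" by simp
        then show False by (simp add: mat_def)
      qed
      then show ?thesis unfolding A(2) scalar_class_def by blast
    qed
    then have "scalar_class (R A ** R (mat 1)) = scalar_class (R (mat 1))" by (rule scalar_class_eq)
    finally have "\<rho> (sign_class A) = \<rho> (sign_class (mat 1))" using R(1) A(1) one by simp
    then have "sign_class A = sign_class (mat 1)"
      using inj_onD[OF inj] A(1) one unfolding carrier_PSL27 by blast
    then show "A = mat 1 \<or> A = - mat 1" unfolding sign_class_eq .
  qed
  have fixed: "(\<forall>P\<in>proj_line a. fixes_point (\<rho> (sign_class A)) P) \<longleftrightarrow> (\<forall>v. dot3 a v = 0 \<longrightarrow> (\<exists>k. R A *v v = k *s v))"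
    if "det A = 1" for A a
  proof -
    have "(\<forall>P\<in>proj_line a. fixes_point (\<rho> (sign_class A)) P) \<longleftrightarrow> (\<forall>v. v \<noteq> 0 \<and> dot3 a v = 0 \<longrightarrow> (\<exists>k. R A *v v = k *s v))"
      unfolding proj_line_dot3 R(1)[OF that] using fixes_point_scalar_class[OF R(2)[OF that]] by blast
    also have "\<dots> \<longleftrightarrow> (\<forall>v. dot3 a v = 0 \<longrightarrow> (\<exists>k. R A *v v = k *s v))"
    proof -
      have "\<exists>k. R A *v v = k *s v" if "v = 0" for v using that by simp
      then show ?thesis by metis
    qed
    finally show ?thesis .
  qed
  have "K = fixed_lines R"
    unfolding K proj_lines_def
  proof (intro equalityI subsetI)
    fix L assume "L \<in> {L \<in> {proj_line a |a. a \<noteq> 0}. \<exists>g\<in>involutions PSL27. \<forall>P\<in>L. fixes_point (\<rho> g) P}"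
    then obtain a g where a: "L = proj_line a" "a \<noteq> 0" "g \<in> involutions PSL27" "\<forall>P\<in>proj_line a. fixes_point (\<rho> g) P" by blast
    then obtain A where A: "det A = 1" "A ** A = - mat 1" "g = sign_class A" unfolding involutions_PSL27 by blast
    have "\<forall>v. dot3 a v = 0 \<longrightarrow> (\<exists>k. R A *v v = k *s v)" using a(4) unfolding A(3) fixed[OF A(1)] .
    with a(1,2) A(1,2) show "L \<in> fixed_lines R"
      unfolding fixed_lines_def by (intro CollectI exI[of _ a] conjI exI[of _ A])
  next
    fix L assume "L \<in> fixed_lines R"
    then obtain a A where a: "L = proj_line a" "a \<noteq> 0" "det A = 1" "A ** A = - mat 1" "\<forall>v. dot3 a v = 0 \<longrightarrow> (\<exists>k. R A *v v = k *s v)" 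
      unfolding fixed_lines_def by blast
    have 1: "sign_class A \<in> involutions PSL27" using a(3,4) unfolding involutions_PSL27 by blast
    have 2: "\<forall>P\<in>L. fixes_point (\<rho> (sign_class A)) P" using a(5) unfolding a(1) fixed[OF a(3)] .
    from a(1,2) 1 2 show "L \<in> {L \<in> {proj_line a |a. a \<noteq> 0}. \<exists>g\<in>involutions PSL27. \<forall>P\<in>L. fixes_point (\<rho> g) P}" by blast
  qed
  with rep show thesis by (rule that)
qed

text \<open>An inner automorphism permutes the involutions, so twisting the embedding by it does not
  change the set of their fixed lines.\<close>

lemma (in projective_representation) conjugate:
  assumes h: "det h = 1" "h ** g = mat 1" "g ** h = mat 1"
  shows "projective_representation (\<lambda>A. R (h ** A ** g))" "fixed_lines (\<lambda>A. R (h ** A ** g)) = fixed_lines R"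
proof -
  have "det h * det g = 1" using h(2) by (metis det_I det_mul)
  then have g: "det g = 1" using h(1) by simp
  have det: "det (h ** A ** g) = 1" "det (g ** A ** h) = 1" if "det A = 1" for A
    using that h g by (simp_all add: det_mul)
  have cancel: "A ** h ** (g ** B) = A ** B" "A ** g ** (h ** B) = A ** B" for A B
  proof -
    have "A ** h ** (g ** B) = A ** (h ** g) ** B" "A ** g ** (h ** B) = A ** (g ** h) ** B"
      by (simp_all only: matrix_mul_assoc)
    then show "A ** h ** (g ** B) = A ** B" "A ** g ** (h ** B) = A ** B" unfolding h by simp_all
  qed
  have comp: "(h ** A ** g) ** (h ** B ** g) = h ** (A ** B) ** g" "(g ** A ** h) ** (g ** B ** h) = g ** (A ** B) ** h" for A B
    using cancel(2)[of "h ** A" "B ** g"] cancel(1)[of "g ** A" "B ** h"] by (simp_all only: matrix_mul_assoc)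
  have inverse: "h ** (g ** A ** h) ** g = A" "g ** (h ** A ** g) ** h = A" for A
    using cancel(1)[of "mat 1" "A ** (h ** g)"] cancel(2)[of "mat 1" "A ** (g ** h)"]
    by (simp_all only: matrix_mul_assoc h matrix_mul_lid matrix_mul_rid) (simp_all only: matrix_mul_assoc[symmetric] h matrix_mul_rid)
  have one: "g ** mat 1 ** h = mat 1" "h ** mat 1 ** g = mat 1" using h by simp_all
  show "projective_representation (\<lambda>A. R (h ** A ** g))"
  proof
    fix A B :: "7 ^ 2 ^ 2" assume "det A = 1" "det B = 1"
    then show "\<exists>c. c \<noteq> 0 \<and> R (h ** A ** g) ** R (h ** B ** g) = mat c ** R (h ** (A ** B) ** g)"
      using mult[of "h ** A ** g" "h ** B ** g"] det comp by simp
  next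
    show "R (h ** (- A) ** g) = R (h ** A ** g)" for A unfolding m2_neg neg ..
  next
    show "det A = 1 \<Longrightarrow> invertible (R (h ** A ** g))" for A using invertible det by blast
  next
    fix A :: "7 ^ 2 ^ 2" and k assume "det A = 1" "R (h ** A ** g) = mat k"
    then have "h ** A ** g = mat 1 \<or> h ** A ** g = - mat 1" using faithful det by blast
    then have "g ** (h ** A ** g) ** h = mat 1 \<or> g ** (h ** A ** g) ** h = - mat 1"
      by (elim disjE) (simp_all only: one m2_neg simp_thms)
    then show "A = mat 1 \<or> A = - mat 1" unfolding inverse .
  qed
  have sq: "(h ** A ** g) ** (h ** A ** g) = - mat 1" "(g ** A ** h) ** (g ** A ** h) = - mat 1" if "A ** A = - mat 1" for A
    unfolding comp that m2_neg one by (rule refl)+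
  have "(\<exists>A. det A = 1 \<and> A ** A = - mat 1 \<and> P (h ** A ** g)) \<longleftrightarrow> (\<exists>A. det A = 1 \<and> A ** A = - mat 1 \<and> P A)" for P
  proof
    assume "\<exists>A. det A = 1 \<and> A ** A = - mat 1 \<and> P (h ** A ** g)"
    then show "\<exists>A. det A = 1 \<and> A ** A = - mat 1 \<and> P A" using det sq by blast
  next
    assume "\<exists>A. det A = 1 \<and> A ** A = - mat 1 \<and> P A"
    then obtain A where "det A = 1" "A ** A = - mat 1" "P A" by blast
    then show "\<exists>A. det A = 1 \<and> A ** A = - mat 1 \<and> P (h ** A ** g)"
      using det sq by (intro exI[of _ "g ** A ** h"]) (simp add: inverse)
  qed
  from this[of "\<lambda>A. \<forall>v. dot3 _ v = 0 \<longrightarrow> (\<exists>k. R A *v v = k *s v)"]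
  show "fixed_lines (\<lambda>A. R (h ** A ** g)) = fixed_lines R" unfolding fixed_lines_def by simp
qed

lemma klein_arrangement_frame:
  assumes "klein_arrangement K" "l \<in> K"
  obtains w a1 a2 a3 v1 v2 v3 where "dual_frame w a1 a2 a3 v1 v2 v3"
    "K = (\<lambda>c. proj_line (dual_frame.root_vec a1 a2 a3 c)) ` set (all_roots w)" "l = proj_line a1"
proof -
  obtain R0 where R0: "projective_representation R0" "K = fixed_lines R0"
    using klein_arrangement_representation[OF assms(1)] .
  interpret R0: projective_representation R0 by fact
  obtain a A0 where a: "l = proj_line a" "a \<noteq> 0" "det A0 = 1" "A0 ** A0 = - mat 1"
    "\<forall>v. dot3 a v = 0 \<longrightarrow> (\<exists>k. R0 A0 *v v = k *s v)"
    using assms(2) unfolding R0(2) fixed_lines_def by blast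
  obtain A where A: "A \<in> set klein_involutions" "R0 A = R0 A0"
    using klein_involutions_complete[OF a(3,4)] R0.neg by metis
  obtain h g where h: "det h = 1" "h ** g = mat 1" "g ** h = mat 1"
    and A': "h ** m2 0 1 6 0 ** g = A \<or> h ** m2 0 1 6 0 ** g = - A"
    using klein_involutions_conj[OF A(1)] by blast
  \<comment> \<open>After this twist the involution that fixes \<open>l\<close> is the image of
    \<open>m2 0 1 6 0\<close>.\<close>
  define R where "R A = R0 (h ** A ** g)" for A
  have R: "projective_representation R" "K = fixed_lines R"
    using R0.conjugate[OF h] R0(2) unfolding R_def[abs_def] by simp_all
  interpret projective_representation R by fact
  have RA: "R (m2 0 1 6 0) = R0 A0" unfolding R_def A(2)[symmetric] using A' R0.neg by auto
  obtain w a1 a2 a3 v1 v2 v3 where frame: "dual_frame w a1 a2 a3 v1 v2 v3" and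
    r: "reflects (R (m2 0 1 6 0)) v1 a1" "reflects (R (m2 2 3 3 5)) v2 a2" "reflects (R (m2 3 5 5 4)) v3 a3"
      "reflects (R (m2 2 4 4 5)) (v2 - v3) ((1/2) *s (a2 - a3))"
      "reflects (R (m2 3 3 6 4)) (v1 - v2) ((1/2) *s (a1 - a2))"
      "covector (m2 1 1 5 6) (w *s a1 + a2 + a3)"
    using adapted_frame by blast
  interpret dual_frame w a1 a2 a3 v1 v2 v3 by fact
  let ?roots = "(1,0,0) # klein_roots w"
  have cov: "\<exists>k v. k \<noteq> 0 \<and> reflects (R B) v (k *s root_vec c)" if "(B, c) \<in> set (zip klein_involutions ?roots)" for B c
    using bspec[OF all_covectors[OF frame r] that] unfolding prod.case covector_def by blast
  have len: "length klein_involutions = length ?roots" by (simp add: klein_involutions_def klein_roots_def)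
  \<comment> \<open>A line fixed pointwise by a reflection is its axis, by
    \<open>reflects_fixed_line\<close>.\<close>
  have l: "l = proj_line a1"
  proof -
    obtain k where "k \<noteq> 0" "a1 = k *s a" using reflects_fixed_line[OF r(1) a(2)] a(5) unfolding RA by blast
    then show ?thesis using a(1) proj_line_scale by simp
  qed
  have "K = (\<lambda>c. proj_line (root_vec c)) ` set ?roots"
  proof (intro equalityI subsetI)
    fix L assume "L \<in> K"
    then obtain b B0 where b: "L = proj_line b" "b \<noteq> 0" "det B0 = 1" "B0 ** B0 = - mat 1"
      "\<And>v. dot3 b v = 0 \<Longrightarrow> \<exists>k. R B0 *v v = k *s v"
      unfolding R(2) fixed_lines_def by blast
    obtain B where B: "B \<in> set klein_involutions" "R B = R B0"
      using klein_involutions_complete[OF b(3,4)] neg by metis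
    obtain c where c: "(B, c) \<in> set (zip klein_involutions ?roots)"
      using len B(1) by (rule in_set_impl_in_set_zip1)
    obtain k v where k: "k \<noteq> 0" "reflects (R B) v (k *s root_vec c)" using cov[OF c] by blast
    obtain m where "m \<noteq> 0" "k *s root_vec c = m *s b"
      using reflects_fixed_line[OF k(2) b(2)] b(5) unfolding B(2) by blast
    then have "L = proj_line (root_vec c)" using b(1) k(1) proj_line_scale by metis
    then show "L \<in> (\<lambda>c. proj_line (root_vec c)) ` set ?roots" using set_zip_rightD[OF c] by blast
  next
    fix L assume "L \<in> (\<lambda>c. proj_line (root_vec c)) ` set ?roots"
    then obtain c where c: "c \<in> set ?roots" "L = proj_line (root_vec c)" by blast
    obtain B where B: "(B, c) \<in> set (zip klein_involutions ?roots)"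
      using len c(1) by (rule in_set_impl_in_set_zip2)
    obtain k v where k: "k \<noteq> 0" "reflects (R B) v (k *s root_vec c)" using cov[OF B] by blast
    have "\<forall>u. dot3 (root_vec c) u = 0 \<longrightarrow> (\<exists>m. R B *v u = m *s u)"
      using reflects_fixes[OF k(2)] by simp
    with klein_involutions_sq[OF set_zip_leftD[OF B]] root_vec_neq_0[OF c(1)] show "L \<in> K"
      unfolding R(2) fixed_lines_def c(2) by blast
  qed
  with frame l show thesis by (intro that)
qed

theorem proposition5p1:
  fixes K :: "point set set" and l :: "point set"
  assumes "klein_arrangement K" and "l \<in> K"
  shows "minimal_plus_one_generated_arrangement (K - {l}) 9 11 12"
proof -
  obtain w a1 a2 a3 v1 v2 v3 where frame: "dual_frame w a1 a2 a3 v1 v2 v3"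
    and K: "K = (\<lambda>c. proj_line (dual_frame.root_vec a1 a2 a3 c)) ` set (all_roots w)" and l: "l = proj_line a1"
    using klein_arrangement_frame[OF assms] .
  interpret dual_frame w a1 a2 a3 v1 v2 v3 by fact
  have sub: "c \<in> set (all_roots w)" if "c \<in> set (klein_roots w)" for c using that by simp
  \<comment> \<open>Distinctness is known for the roots with constant polynomials as entries and
    descends along \<open>const\<close>.\<close>
  have distinct: "distinct (all_roots w)"
  proof -
    have "distinct (map (\<lambda>(a, b, c). (const a, const b, const c)) (all_roots w))"
      using distinct_roots by (simp add: klein_roots_const)
    then show ?thesis unfolding distinct_map by blast
  qed
  have inj: "inj_on (\<lambda>c. proj_line (root_vec c)) (set (all_roots w))"
  proof (rule inj_onI)
    fix c d assume c: "c \<in> set (all_roots w)" and d: "d \<in> set (all_roots w)"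
      and "proj_line (root_vec c) = proj_line (root_vec d)"
    then obtain k where "root_vec d = k *s root_vec c" using proj_line_eq root_vec_neq_0 by metis
    then show "c = d" by (rule root_vec_proportional[OF c d])
  qed
  have "l = proj_line (root_vec (1,0,0))" by (simp add: l root_vec_def)
  then have K': "K - {l} = (\<lambda>c. proj_line (root_vec c)) ` set (klein_roots w)"
    using inj distinct unfolding K by auto
  have inj': "inj_on (\<lambda>c. proj_line (root_vec c)) (set (klein_roots w))"
    using inj by (rule inj_on_subset) auto
  have card: "card (K - {l}) = 20"
  proof -
    have "card (K - {l}) = length (klein_roots w)"
      unfolding K' card_image[OF inj'] using distinct by (intro distinct_card) simp
    then show ?thesis by (simp add: klein_roots_def)
  qed
  have "line_arrangement (K - {l})"
    unfolding line_arrangement_def K' proj_lines_def using root_vec_neq_0[OF sub] by auto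
  moreover have "minimal_plus_one_generated (card (K - {l})) f 9 11 12" if "arrangement_equation (K - {l}) f" for f
  proof -
    from that[unfolded arrangement_equation_def]
    obtain a where a: "\<forall>L\<in>K - {l}. a L \<noteq> 0 \<and> proj_line (a L) = L" and f: "f = (\<Prod>L\<in>K - {l}. linear_form (a L))"
      by (elim exE conjE)
    have "\<exists>k. k \<noteq> 0 \<and> a (proj_line (root_vec c)) = k *s root_vec c" if c: "c \<in> set (klein_roots w)" for c
    proof -
      have "proj_line (root_vec c) \<in> K - {l}" unfolding K' using c by blast
      then have "a (proj_line (root_vec c)) \<noteq> 0" "proj_line (root_vec c) = proj_line (a (proj_line (root_vec c)))"
        using a by metis+
      then show ?thesis using proj_line_eq root_vec_neq_0[OF sub[OF c]] by metis
    qed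
    then obtain k where k: "\<And>c. c \<in> set (klein_roots w) \<Longrightarrow> k c \<noteq> 0 \<and> a (proj_line (root_vec c)) = k c *s root_vec c" by metis
    \<comment> \<open>The forms in \<open>f\<close> are arbitrary multiples of the listed roots;
      their scalars combine to one nonzero constant in front of \<open>F\<close>.\<close>
    have "f = (\<Prod>c\<in>set (klein_roots w). linear_form (a (proj_line (root_vec c))))"
      unfolding f K' by (rule prod.reindex_cong[OF inj' refl refl])
    also have "\<dots> = (\<Prod>c\<in>set (klein_roots w). const (k c) * linear_form (root_vec c))"
      by (intro prod.cong refl) (simp add: k linear_form_simps)
    also have "\<dots> = const (\<Prod>c\<in>set (klein_roots w). k c) * (\<Prod>c\<in>set (klein_roots w). linear_form (root_vec c))"
      unfolding prod.distrib const_prod ..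
    also have "(\<Prod>c\<in>set (klein_roots w). linear_form (root_vec c)) = prod_list (map (\<lambda>c. linear_form (root_vec c)) (klein_roots w))"
      using distinct by (intro prod.distinct_set_conv_list) simp
    also have "\<dots> = F"
      unfolding F_def klein_roots_const map_map comp_def
      by (intro arg_cong[of _ _ prod_list] map_cong refl) (auto simp: linear_form_root_vec)
    finally have "f = const (\<Prod>c\<in>set (klein_roots w). k c) * F" .
    moreover have "(\<Prod>c\<in>set (klein_roots w). k c) \<noteq> 0" using k by simp
    ultimately show ?thesis unfolding card using minimal_plus_one_generated_F by simp
  qed
  ultimately show ?thesis unfolding minimal_plus_one_generated_arrangement_def by blast
qed

end
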